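(* Let $\mathbb H$ be a real separable Hilbert space and let $\{u_t\}_{t\in\mathbb Z}$ be a sequence of independent and identically distributed $\mathbb H$-valued random elements with $\operatorname E u_t=0$ and $\operatorname E\|u_t\|^4<\infty$ for each $t\in\mathbb Z$, and such that $\operatorname E\|u_0\|^2>0$. Let $k:\mathbb R\to[-1,1]$ be a symmetric function that is continuous at zero and at all but a finite number of points, with $k(0)=1$ and $k(x)=O(x^{-\alpha})$ as $x\to\infty$ for some $\alpha>1/2$. Let $\{p_n\}_{n\ge1}$ be a sequence of positive numbers with $p_n\to\infty$ and $p_n/n\to0$ as $n\to\infty$. Let $$T_n=\frac{2^{-1}n\hat Q_n^2-\hat\sigma_n^4C_n(k)}{\|\hat{\mathcal C}_n(0)\|_2^2\sqrt{2D_n(k)}},$$ where the quantities $\hat Q_n^2$, $\hat\sigma_n^2$, $C_n(k)$, $D_n(k)$, $\hat{\mathcal C}_n(0)$ are computed from $u_1,\dots,u_n$, $k$ and $p_n$ as defined in the context. Then $$T_n\xrightarrow{d}N(0,1)\quad\text{as } n\to\infty.$$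
   Context: For $x,y\in\mathbb H$, $x\otimes y:\mathbb H\to\mathbb H$ is the rank one operator $(x\otimes y)(z)=\langle z,y\rangle x$. $\|\cdot\|_2$ applied to operators denotes the Hilbert–Schmidt norm. A superscript $^*$ denotes the adjoint. Sample autocovariance operators: $\hat{\mathcal C}_n(j)=n^{-1}\sum_{t=j+1}^n u_t\otimes u_{t-j}$ for $0\le j<n$ and $\hat{\mathcal C}_n(j)=\hat{\mathcal C}_n^*(-j)$ for $-n<j<0$. Kernel lag-window estimator of the spectral density operator: $\hat{\mathcal F}_n(\omega)=(2\pi)^{-1}\sum_{|j|<n}k(j/p_n)\hat{\mathcal C}_n(j)e^{-\mathbf i j\omega}$, $\omega\in[-\pi,\pi]$, $\mathbf i=\sqrt{-1}$ (an operator on the complexification of $\mathbb H$). $\hat Q_n^2=2\pi\int_{-\pi}^{\pi}\|\hat{\mathcal F}_n(\omega)-(2\pi)^{-1}\hat{\mathcal C}_n(0)\|_2^2\,d\omega$, which equals $2\sum_{j=1}^{n-1}k^2(j/p_n)\|\hat{\mathcal C}_n(j)\|_2^2$. $\hat\sigma_n^2=n^{-1}\sum_{t=1}^n\|u_t\|^2$ and $\hat\sigma_n^4=(\hat\sigma_n^2)^2$. $C_n(k)=\sum_{j=1}^{n-1}(1-j/n)k^2(j/p_n)$ and $D_n(k)=\sum_{j=1}^{n-2}(1-j/n)(1-(j+1)/n)k^4(j/p_n)$. $\xrightarrow{d}$ denotes convergence in distribution. ($T_n$ is considered for $n$ large enough that $D_n(k)>0$, and its value on the event that the denominator vanishes,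 whose probability tends to $0$, is immaterial.) *)

theory Defs
  imports "HOL-Probability.Probability" "HOL-Library.Landau_Symbols"
begin

text \<open>A real separable Hilbert space is a type of class
  \<open>{real_inner, complete_space, second_countable_topology}\<close>; for metric spaces separability and
  second countability coincide. Operators are plain functions. All operators occurring below have
  finite rank and are bounded.\<close>

definition rank_one :: "'h::real_inner \<Rightarrow> 'h \<Rightarrow> 'h \<Rightarrow> 'h" where
  "rank_one x y = (\<lambda>z. (z \<bullet> y) *\<^sub>R x)"

lemma adjoint_rank_one: "adjoint (rank_one x y) = rank_one y x"
  by (rule adjoint_unique) (auto simp: rank_one_def inner_commute)


subsection \<open>Complexification\<close>

text \<open>The pair \<open>(x, y)\<close> stands for \<open>x + \<i> y\<close>. The product norm
  \<open>sqrt (\<parallel>x\<parallel>\<^sup>2 + \<parallel>y\<parallel>\<^sup>2)\<close> is the norm of the complex inner product \<open>cinner\<close>,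
  which is linear in its first argument.\<close>

type_synonym 'h complexified = "'h \<times> 'h"

definition cscale :: "complex \<Rightarrow> 'h::real_vector complexified \<Rightarrow> 'h complexified" where
  "cscale c z = (Re c *\<^sub>R fst z - Im c *\<^sub>R snd z, Im c *\<^sub>R fst z + Re c *\<^sub>R snd z)"

definition cinner :: "'h::real_inner complexified \<Rightarrow> 'h complexified \<Rightarrow> complex" where
  "cinner z w = Complex (fst z \<bullet> fst w + snd z \<bullet> snd w) (snd z \<bullet> fst w - fst z \<bullet> snd w)"

definition complexify :: "('h \<Rightarrow> 'h) \<Rightarrow> 'h complexified \<Rightarrow> 'h complexified" where
  "complexify A z = (A (fst z), A (snd z))"

lemma cinner_self: "cinner z z = of_real ((norm z)\<^sup>2)"
  by (simp add: cinner_def complex_eq_iff norm_prod_def power2_norm_eq_inner inner_commute)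

lemma cinner_cscale_left: "cinner (cscale c z) w = c * cinner z w"
  by (simp add: cinner_def cscale_def complex_eq_iff inner_simps algebra_simps)

lemma cinner_cnj: "cinner w z = cnj (cinner z w)"
  by (simp add: cinner_def complex_eq_iff inner_commute)


subsection \<open>Hilbert--Schmidt norm\<close>

text \<open>An orthonormal basis of a Hilbert space is a maximal orthonormal set, i.e. one to which
  only the zero vector is orthogonal.\<close>

definition orthonormal_basis :: "'h::real_inner set \<Rightarrow> bool" where
  "orthonormal_basis B \<longleftrightarrow>
     (\<forall>e\<in>B. \<forall>f\<in>B. e \<bullet> f = (if e = f then 1 else 0)) \<and>
     (\<forall>x. (\<forall>e\<in>B. x \<bullet> e = 0) \<longrightarrow> x = 0)"

definition corthonormal_basis :: "'h::real_inner complexified set \<Rightarrow> bool" where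
  "corthonormal_basis B \<longleftrightarrow>
     (\<forall>e\<in>B. \<forall>f\<in>B. cinner e f = (if e = f then 1 else 0)) \<and>
     (\<forall>z. (\<forall>e\<in>B. cinner z e = 0) \<longrightarrow> z = 0)"

lemma maximal_orthonormal_exists:
  fixes g :: "'v::zero \<Rightarrow> 'v \<Rightarrow> 'c::zero_neq_one"
  assumes normalize:
    "\<And>x. x \<noteq> 0 \<Longrightarrow> \<exists>y. g y y = 1 \<and> (\<forall>e. g x e = 0 \<longrightarrow> g y e = 0 \<and> g e y = 0)"
  shows "\<exists>B. (\<forall>e\<in>B. \<forall>f\<in>B. g e f = (if e = f then 1 else 0)) \<and>
             (\<forall>x. (\<forall>e\<in>B. g x e = 0) \<longrightarrow> x = 0)"
proof -
  define on where "on e f \<longleftrightarrow> g e f = (if e = f then 1 else 0)" for e f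
  define A where "A = {B. \<forall>e\<in>B. \<forall>f\<in>B. on e f}"
  have "\<exists>M\<in>A. \<forall>X\<in>A. M \<subseteq> X \<longrightarrow> X = M"
  proof (rule subset_Zorn')
    fix C assume C: "subset.chain A C"
    have "on e f" if ef: "e \<in> \<Union>C" "f \<in> \<Union>C" for e f
    proof -
      obtain X Y where XY: "X \<in> C" "Y \<in> C" "e \<in> X" "f \<in> Y" using ef by (elim UnionE)
      have "X \<subseteq> Y \<or> Y \<subseteq> X" using C XY(1,2) unfolding subset_chain_def by blast
      then obtain Z where Z: "Z \<in> C" "e \<in> Z" "f \<in> Z" using XY by (meson subsetD)
      have "Z \<in> A" using C Z(1) unfolding subset_chain_def by blast
      then show ?thesis using Z(2,3) unfolding A_def by simp
    qed
    then show "\<Union>C \<in> A" unfolding A_def by simp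
  qed
  then obtain B where B: "B \<in> A" and max: "\<And>X. X \<in> A \<Longrightarrow> B \<subseteq> X \<Longrightarrow> X = B" by metis
  have "x = 0" if x: "\<forall>e\<in>B. g x e = 0" for x
  proof (rule ccontr)
    assume "x \<noteq> 0"
    then obtain y where y1: "g y y = 1" and y2: "\<And>e. e \<in> B \<Longrightarrow> g y e = 0 \<and> g e y = 0"
      using normalize x by meson
    have notin: "y \<notin> B"
    proof
      assume "y \<in> B"
      from y2[OF this] y1 show False by simp
    qed
    have "on e f" if "e \<in> insert y B" "f \<in> insert y B" for e f
    proof (cases "e = y"; cases "f = y")
      assume "e \<noteq> y" "f \<noteq> y"
      then show ?thesis using that B unfolding A_def by simp
    qed (use that y1 y2 notin in \<open>auto simp: on_def\<close>)
    then have "insert y B \<in> A" unfolding A_def by simp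
    from max[OF this] notin show False by (metis insertI1 subset_insertI)
  qed
  moreover have "\<forall>e\<in>B. \<forall>f\<in>B. g e f = (if e = f then 1 else 0)"
    using B unfolding A_def on_def by (rule CollectD)
  ultimately show ?thesis by (intro exI[of _ B] conjI allI impI)
qed

lemma orthonormal_basis_exists: "\<exists>B :: 'h::real_inner set. orthonormal_basis B"
  unfolding orthonormal_basis_def
proof (rule maximal_orthonormal_exists)
  fix x :: 'h assume "x \<noteq> 0"
  then show "\<exists>y. y \<bullet> y = 1 \<and> (\<forall>e. x \<bullet> e = 0 \<longrightarrow> y \<bullet> e = 0 \<and> e \<bullet> y = 0)"
    by (intro exI[of _ "(1 / norm x) *\<^sub>R x"])
       (simp add: dot_square_norm power2_eq_square inner_commute[of _ x])
qed

lemma corthonormal_basis_exists: "\<exists>B :: 'h::real_inner complexified set. corthonormal_basis B"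
  unfolding corthonormal_basis_def
proof (rule maximal_orthonormal_exists)
  fix z :: "'h complexified" assume "z \<noteq> 0"
  define y where "y = cscale (of_real (1 / norm z)) z"
  have "y = (1 / norm z) *\<^sub>R z" by (simp add: y_def cscale_def prod_eq_iff)
  then have "norm y = 1" using \<open>z \<noteq> 0\<close> by simp
  then have "cinner y y = 1" by (simp add: cinner_self)
  moreover have "cinner y e = 0 \<and> cinner e y = 0" if "cinner z e = 0" for e
    using that cinner_cnj[of e y] by (simp add: y_def cinner_cscale_left)
  ultimately show "\<exists>y. cinner y y = 1 \<and> (\<forall>e. cinner z e = 0 \<longrightarrow> cinner y e = 0 \<and> cinner e y = 0)"
    by blast
qed

text \<open>\<open>hs_norm\<close> is for operators on \<open>\<H>\<close>, \<open>chs_norm\<close> for operators on its complexification. The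
  value does not depend on the chosen orthonormal basis.\<close>

definition hs_norm :: "('h::real_inner \<Rightarrow> 'h) \<Rightarrow> real" where
  "hs_norm A = sqrt (\<Sum>\<^sub>\<infinity>e\<in>(SOME B. orthonormal_basis B). (norm (A e))\<^sup>2)"

definition chs_norm :: "('h::real_inner complexified \<Rightarrow> 'h complexified) \<Rightarrow> real" where
  "chs_norm A = sqrt (\<Sum>\<^sub>\<infinity>e\<in>(SOME B. corthonormal_basis B). (norm (A e))\<^sup>2)"


subsection \<open>The test statistic\<close>

text \<open>In the following, \<open>u\<close> is a realization of the process, of which only
  \<open>u 1, \<dots>, u n\<close> enter; \<open>p\<close> is the bandwidth \<open>p\<^sub>n\<close>.\<close>

definition autocov_nonneg :: "(int \<Rightarrow> 'h::real_inner) \<Rightarrow> nat \<Rightarrow> int \<Rightarrow> 'h \<Rightarrow> 'h" where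
  "autocov_nonneg u n j = (\<lambda>z. (1 / real n) *\<^sub>R (\<Sum>t = j + 1..int n. rank_one (u t) (u (t - j)) z))"

definition autocov :: "(int \<Rightarrow> 'h::real_inner) \<Rightarrow> nat \<Rightarrow> int \<Rightarrow> 'h \<Rightarrow> 'h" where
  "autocov u n j =
     (if 0 \<le> j then autocov_nonneg u n j else adjoint (autocov_nonneg u n (- j)))"

definition spec_density ::
  "(real \<Rightarrow> real) \<Rightarrow> real \<Rightarrow> (int \<Rightarrow> 'h::real_inner) \<Rightarrow> nat \<Rightarrow> real \<Rightarrow> 'h complexified \<Rightarrow> 'h complexified"
where
  "spec_density k p u n \<omega> = (\<lambda>z. (1 / (2 * pi)) *\<^sub>R
     (\<Sum>j \<in> {j::int. \<bar>j\<bar> < int n}.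
        cscale (of_real (k (of_int j / p)) * exp (- \<i> * of_int j * of_real \<omega>))
          (complexify (autocov u n j) z)))"

definition Q_hat_sq :: "(real \<Rightarrow> real) \<Rightarrow> real \<Rightarrow> (int \<Rightarrow> 'h::real_inner) \<Rightarrow> nat \<Rightarrow> real" where
  "Q_hat_sq k p u n = 2 * pi *
     (LBINT \<omega>:{-pi..pi}.
        (chs_norm (\<lambda>z. spec_density k p u n \<omega> z
                      - (1 / (2 * pi)) *\<^sub>R complexify (autocov u n 0) z))\<^sup>2)"

definition sigma_hat_sq :: "(int \<Rightarrow> 'h::real_inner) \<Rightarrow> nat \<Rightarrow> real" where
  "sigma_hat_sq u n = (1 / real n) * (\<Sum>t = 1..int n. (norm (u t))\<^sup>2)"

definition C_coeff :: "(real \<Rightarrow> real) \<Rightarrow> real \<Rightarrow> nat \<Rightarrow> real" where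
  "C_coeff k p n = (\<Sum>j = 1..n - 1. (1 - real j / real n) * (k (real j / p))\<^sup>2)"

definition D_coeff :: "(real \<Rightarrow> real) \<Rightarrow> real \<Rightarrow> nat \<Rightarrow> real" where
  "D_coeff k p n =
     (\<Sum>j = 1..n - 2. (1 - real j / real n) * (1 - real (j + 1) / real n) * (k (real j / p)) ^ 4)"

text \<open>Where the denominator vanishes, \<open>T_stat\<close> is \<open>0\<close> by the convention \<open>x / 0 = 0\<close>.\<close>

definition T_stat :: "(real \<Rightarrow> real) \<Rightarrow> real \<Rightarrow> (int \<Rightarrow> 'h::real_inner) \<Rightarrow> nat \<Rightarrow> real" where
  "T_stat k p u n =
     ((1 / 2) * real n * Q_hat_sq k p u n - (sigma_hat_sq u n)\<^sup>2 * C_coeff k p n)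
     / ((hs_norm (autocov u n 0))\<^sup>2 * sqrt (2 * D_coeff k p n))"

end

theory Submission
  imports Defs
begin

text \<open>Why the limit is normal. Put \<open>w\<^sub>j = k(j/p)\<^sup>2\<close>. By Parseval's identity, in the frequency and in the
  Hilbert space, the centred numerator of the statistic is (\<open>Q_hat_sq_eq\<close>, \<open>statistic_numerator\<close>)

  \<open>diagonal part + (2/n) \<Sum>\<^sub>j \<Sum>\<^sub>s\<^sub><\<^sub>t w\<^sub>j G(t,s,j)\<close>, where
  \<open>G(t,s,j) = \<langle>u\<^sub>t, u\<^sub>s\<rangle> \<langle>u\<^sub>t\<^sub>-\<^sub>j, u\<^sub>s\<^sub>-\<^sub>j\<rangle>\<close>.

  The diagonal part is of order \<open>p / \<surd>n\<close> in \<open>L\<^sup>1\<close> (\<open>diag_err_bound\<close>), hence negligible against the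
  normalization, which is of order \<open>\<surd>p\<close>. Two of the products \<open>G\<close> are uncorrelated as soon as some
  index occurs only once among the eight arguments, because that variable has mean zero and can be
  integrated out. The only other triple correlated with \<open>(t,s,j)\<close> is \<open>(t, t-j, t-s)\<close>, so the variance
  of any weighted sum of \<open>G\<close>'s is at most a constant times the sum of the squared weights
  (\<open>lagged_sum_variance\<close>). With a cut-off \<open>q\<close> of order \<open>\<surd>(p n)\<close>, that is \<open>p \<lless> q \<lless> n\<close>, all terms
  with \<open>j > q\<close>, \<open>s \<le> q\<close> or \<open>t - s \<le> q\<close> are therefore negligible (\<open>rest_bound\<close>).

  What remains is a sum of martingale differences \<open>Z\<^sub>t = \<langle>u\<^sub>t, \<Sum>\<^sub>j w\<^sub>j S\<^sub>j u\<^sub>t\<^sub>-\<^sub>j\<rangle>\<close> with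
  \<open>S\<^sub>j = \<Sum>\<^sub>s u\<^sub>s \<otimes> u\<^sub>s\<^sub>-\<^sub>j\<close>, the sum running over \<open>q < s < t - q\<close>. Because of the gap, \<open>S\<^sub>j\<close> is independent of
  \<open>u\<^sub>t\<^sub>-\<^sub>q, \<dots>, u\<^sub>t\<close>. This has two consequences. Four moments of \<open>u\<close> suffice to bound four moments of
  \<open>Z\<^sub>t\<close> (\<open>increment_fourth_moment\<close>). And the conditional variance of \<open>Z\<^sub>t\<close> given the past before
  \<open>t - q\<close> is an explicit quadratic form, again a sum of lagged products, which is close to its mean in
  \<open>L\<^sup>1\<close> for each single \<open>t\<close> (\<open>condvar_concentration\<close>). The conditional variance being nearly deterministic,
  the characteristic function can be followed step by step: with \<open>h\<^sub>t = exp(i\<theta>(Z\<^sub>1 + \<dots> + Z\<^sub>t))\<close>, passing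
  from \<open>t-1\<close> to \<open>t\<close> multiplies \<open>E h\<close> by \<open>exp(-\<theta>\<^sup>2 v\<^sub>t / 2)\<close>, up to an error controlled by
  \<open>E h\<^sub>t\<^sub>-\<^sub>1 (Z\<^sub>t\<^sup>2 - v\<^sub>t)\<close> and \<open>E |Z\<^sub>t|\<^sup>3\<close>. Replacing \<open>h\<^sub>t\<^sub>-\<^sub>1\<close> by \<open>h\<^sub>t\<^sub>-\<^sub>q\<^sub>-\<^sub>1\<close> makes the concentration
  applicable and costs the \<open>L\<^sup>2\<close> norm of \<open>q\<close> normalized increments, which is \<open>O(\<surd>(q/n))\<close>
  (\<open>char_increments_bound\<close>).

  Finally \<open>\<parallel>C\<^sub>n(0)\<parallel>\<^sup>2\<close> estimates the positive number \<open>kappa = E \<langle>u\<^sub>0, u\<^sub>1\<rangle>\<^sup>2\<close>, the squared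
  Hilbert--Schmidt norm of the covariance operator (\<open>hs_norm_error\<close>, \<open>kappa_pos\<close>); Slutsky's argument
  (\<open>slutsky_char\<close>) and Levy's continuity theorem conclude.

  No conditional expectations are formed. The process is one random path, and \<open>expectation_resample\<close>
  integrates out a single coordinate of it.\<close>

section \<open>Parseval's identity and Hilbert--Schmidt norms\<close>

lemma orthonormal_sum_norm_sq:
  fixes B :: "'h::real_inner set"
  assumes "finite F" "\<And>e f. e \<in> F \<Longrightarrow> f \<in> F \<Longrightarrow> e \<bullet> f = (if e = f then 1 else 0)"
  shows "(norm (\<Sum>e\<in>F. c e *\<^sub>R e))\<^sup>2 = (\<Sum>e\<in>F. (c e)\<^sup>2)"
proof -
  have "(norm (\<Sum>e\<in>F. c e *\<^sub>R e))\<^sup>2 = (\<Sum>e\<in>F. \<Sum>f\<in>F. c e * c f * (e \<bullet> f))"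
    by (simp add: power2_norm_eq_inner inner_sum_left inner_sum_right sum_distrib_left
        inner_commute mult_ac)
  also have "\<dots> = (\<Sum>e\<in>F. \<Sum>f\<in>F. if e = f then c e * c f else 0)"
    using assms(2) by (intro sum.cong) auto
  also have "\<dots> = (\<Sum>e\<in>F. (c e)\<^sup>2)"
    using assms(1) by (simp add: power2_eq_square)
  finally show ?thesis .
qed

lemma bessel:
  fixes x :: "'h::real_inner"
  assumes "finite F" "\<And>e f. e \<in> F \<Longrightarrow> f \<in> F \<Longrightarrow> e \<bullet> f = (if e = f then 1 else 0)"
  shows "(norm (x - (\<Sum>e\<in>F. (x \<bullet> e) *\<^sub>R e)))\<^sup>2 = (norm x)\<^sup>2 - (\<Sum>e\<in>F. (x \<bullet> e)\<^sup>2)"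
proof -
  let ?y = "\<Sum>e\<in>F. (x \<bullet> e) *\<^sub>R e"
  have "x \<bullet> ?y = (\<Sum>e\<in>F. (x \<bullet> e)\<^sup>2)"
    by (simp add: inner_sum_right power2_eq_square)
  moreover have "?y \<bullet> ?y = (\<Sum>e\<in>F. (x \<bullet> e)\<^sup>2)"
    using orthonormal_sum_norm_sq[OF assms, of "\<lambda>e. x \<bullet> e"] by (simp add: power2_norm_eq_inner)
  ultimately show ?thesis
    by (simp add: power2_norm_eq_inner inner_diff inner_commute)
qed

text \<open>Let \<open>S\<close> be the sum of the squared coefficients. The partial sums of the expansion of \<open>x\<close> along an
increasing sequence of finite sets that exhausts \<open>S\<close> form a Cauchy sequence. The difference of \<open>x\<close> and
its limit is orthogonal to the whole of \<open>B\<close>, hence zero by maximality. An element of \<open>B\<close>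
outside all the sets has coefficient zero, since otherwise it could be added to exceed \<open>S\<close>.\<close>

lemma parseval:
  fixes x :: "'h::{real_inner, complete_space}"
  assumes B: "orthonormal_basis B"
  shows "((\<lambda>e. (x \<bullet> e)\<^sup>2) has_sum (norm x)\<^sup>2) B"
proof -
  have on: "e \<bullet> f = (if e = f then 1 else 0)" if "e \<in> B" "f \<in> B" for e f
    using B that unfolding orthonormal_basis_def by blast
  have max: "z = 0" if "\<And>e. e \<in> B \<Longrightarrow> z \<bullet> e = 0" for z
    using B that unfolding orthonormal_basis_def by blast
  define s where "s F = (\<Sum>e\<in>F. (x \<bullet> e)\<^sup>2)" for F
  have s_le: "s F \<le> (norm x)\<^sup>2" if "finite F" "F \<subseteq> B" for F
    using bessel[of F x] that on unfolding s_def by (smt (verit) subsetD zero_le_power2)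
  have summ: "(\<lambda>e. (x \<bullet> e)\<^sup>2) summable_on B"
  proof (rule nonneg_bdd_above_summable_on)
    show "bdd_above (sum (\<lambda>e. (x \<bullet> e)\<^sup>2) ` {F. F \<subseteq> B \<and> finite F})"
      using s_le unfolding s_def by (intro bdd_aboveI[of _ "(norm x)\<^sup>2"]) auto
  qed simp
  define S where "S = (\<Sum>\<^sub>\<infinity>e\<in>B. (x \<bullet> e)\<^sup>2)"
  have hs: "((\<lambda>e. (x \<bullet> e)\<^sup>2) has_sum S) B" unfolding S_def using summ by simp
  have sS: "s F \<le> S" if "finite F" "F \<subseteq> B" for F
    unfolding s_def S_def using that summ by (intro finite_sum_le_infsum) auto
  have "\<exists>F. finite F \<and> F \<subseteq> B \<and> S - 1 / real (Suc n) < s F" for n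
  proof -
    have "\<forall>\<^sub>F F in finite_subsets_at_top B. S - 1 / real (Suc n) < s F"
      using hs unfolding has_sum_def s_def by (rule order_tendstoD(1)) simp
    then show ?thesis unfolding eventually_finite_subsets_at_top by blast
  qed
  then obtain f where f: "\<And>n. finite (f n)" "\<And>n. f n \<subseteq> B" "\<And>n. S - 1 / real (Suc n) < s (f n)"
    by metis
  define G where "G n = (\<Union>i\<le>n. f i)" for n
  have G: "finite (G n)" "G n \<subseteq> B" for n using f unfolding G_def by auto
  have Gmono: "G m \<subseteq> G n" if "m \<le> n" for m n using that unfolding G_def by force
  have sG: "S - 1 / real (Suc n) < s (G n)" for n
  proof -
    have "s (f n) \<le> s (G n)" unfolding s_def using G(1) by (intro sum_mono2) (auto simp: G_def)
    with f(3)[of n] show ?thesis by linarith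
  qed
  define y where "y n = (\<Sum>e\<in>G n. (x \<bullet> e) *\<^sub>R e)" for n
  have ydiff: "(norm (y n - y m))\<^sup>2 \<le> 1 / real (Suc m)" if "m \<le> n" for m n
  proof -
    have "y n - y m = (\<Sum>e\<in>G n - G m. (x \<bullet> e) *\<^sub>R e)"
      unfolding y_def using Gmono[OF that] G(1) by (simp add: sum_diff)
    then have "(norm (y n - y m))\<^sup>2 = s (G n - G m)"
      unfolding s_def using G on orthonormal_sum_norm_sq[of "G n - G m" "\<lambda>e. x \<bullet> e"]
      by (metis (no_types, lifting) DiffD1 finite_Diff subsetD)
    also have "\<dots> = s (G n) - s (G m)" unfolding s_def using Gmono[OF that] G(1) by (simp add: sum_diff)
    also have "\<dots> \<le> 1 / real (Suc m)" using sS[OF G, of n] sG[of m] by linarith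
    finally show ?thesis .
  qed
  have "Cauchy y"
  proof (rule metric_CauchyI)
    fix \<epsilon> :: real assume "\<epsilon> > 0"
    then have "(\<epsilon>/2)\<^sup>2 > 0" by simp
    then obtain N where N: "1 / real (Suc N) < (\<epsilon>/2)\<^sup>2"
      by (rule nat_approx_posE)
    have *: "dist (y n) (y N) < \<epsilon> / 2" if "n \<ge> N" for n
    proof -
      have "(norm (y n - y N))\<^sup>2 < (\<epsilon>/2)\<^sup>2" using ydiff[OF that] N by linarith
      then have "norm (y n - y N) < \<epsilon> / 2" by (rule power2_less_imp_less) (use \<open>\<epsilon> > 0\<close> in simp)
      then show ?thesis by (simp add: dist_norm)
    qed
    show "\<exists>M. \<forall>m\<ge>M. \<forall>n\<ge>M. dist (y m) (y n) < \<epsilon>"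
    proof (intro exI[of _ N] allI impI)
      fix m n assume "m \<ge> N" "n \<ge> N"
      then show "dist (y m) (y n) < \<epsilon>"
        by (intro dist_triangle_half_l[OF *[of m] *[of n]])
    qed
  qed
  then obtain Y where Y: "y \<longlonglongrightarrow> Y" using Cauchy_convergent_iff convergent_def by blast
  have "x - Y = 0"
  proof (rule max)
    fix e assume e: "e \<in> B"
    have lim: "(\<lambda>n. (x - y n) \<bullet> e) \<longlonglongrightarrow> (x - Y) \<bullet> e" by (intro tendsto_intros Y)
    have "\<bar>(x - y n) \<bullet> e\<bar> \<le> sqrt (1 / real (Suc n))" for n
    proof (cases "e \<in> G n")
      case True
      have "y n \<bullet> e = (\<Sum>e'\<in>G n. if e' = e then x \<bullet> e else 0)"
        unfolding y_def inner_sum_left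
      proof (rule sum.cong[OF refl])
        fix e' assume "e' \<in> G n"
        then have "e' \<bullet> e = (if e' = e then 1 else 0)" using G(2)[of n] on[of e' e] e by auto
        then show "(x \<bullet> e') *\<^sub>R e' \<bullet> e = (if e' = e then x \<bullet> e else 0)" by simp
      qed
      also have "\<dots> = x \<bullet> e" using True G(1) by simp
      finally show ?thesis by (simp add: inner_diff_left)
    next
      case False
      have "y n \<bullet> e = (\<Sum>e'\<in>G n. 0)"
        unfolding y_def inner_sum_left
      proof (rule sum.cong[OF refl])
        fix e' assume e': "e' \<in> G n"
        then have "e' \<bullet> e = 0" using G(2)[of n] on[of e' e] e False by auto
        then show "(x \<bullet> e') *\<^sub>R e' \<bullet> e = 0" by simp
      qed
      moreover have "(x \<bullet> e)\<^sup>2 + s (G n) \<le> S"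
        using sS[of "insert e (G n)"] e G False unfolding s_def by simp
      then have "(x \<bullet> e)\<^sup>2 \<le> 1 / real (Suc n)" using sG[of n] by linarith
      then have "\<bar>x \<bullet> e\<bar> \<le> sqrt (1 / real (Suc n))" by (rule real_le_rsqrt[of "\<bar>x \<bullet> e\<bar>", simplified])
      ultimately show ?thesis by (simp add: inner_diff_left)
    qed
    moreover have "(\<lambda>n. sqrt (1 / real (Suc n))) \<longlonglongrightarrow> 0"
      using tendsto_real_sqrt[OF LIMSEQ_inverse_real_of_nat] by (simp add: inverse_eq_divide)
    ultimately have "(\<lambda>n. (x - y n) \<bullet> e) \<longlonglongrightarrow> 0"
      by (intro Lim_null_comparison[of "\<lambda>n. (x - y n) \<bullet> e"]) auto
    then show "(x - Y) \<bullet> e = 0" using lim LIMSEQ_unique by blast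
  qed
  then have "y \<longlonglongrightarrow> x" using Y by simp
  then have "(\<lambda>n. (norm (x - y n))\<^sup>2) \<longlonglongrightarrow> (norm (x - x))\<^sup>2" by (intro tendsto_intros)
  moreover have "(norm (x - y n))\<^sup>2 \<ge> (norm x)\<^sup>2 - S" for n
    using bessel[of "G n" x] G on sS[OF G, of n] unfolding s_def y_def
    by (smt (verit) subsetD sum.cong)
  ultimately have "(norm x)\<^sup>2 - S \<le> (norm (x - x))\<^sup>2"
    by (meson LIMSEQ_le_const)
  moreover have "S \<le> (norm x)\<^sup>2"
    unfolding S_def using summ s_le unfolding s_def by (intro infsum_le_finite_sums) auto
  ultimately show ?thesis using hs by simp
qed

lemma parseval_inner:
  fixes x y :: "'h::{real_inner, complete_space}"
  assumes B: "orthonormal_basis B"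
  shows "((\<lambda>e. (e \<bullet> x) * (e \<bullet> y)) has_sum (x \<bullet> y)) B"
proof -
  have "((\<lambda>e. (1/4) * (((x + y) \<bullet> e)\<^sup>2 + - (((x - y) \<bullet> e)\<^sup>2)))
      has_sum ((1/4) * ((norm (x + y))\<^sup>2 + - ((norm (x - y))\<^sup>2)))) B"
    by (intro has_sum_cmult_right has_sum_add parseval[OF B] has_sum_uminusI)
  moreover have "(1/4) * (((x + y) \<bullet> e)\<^sup>2 + - (((x - y) \<bullet> e)\<^sup>2)) = (e \<bullet> x) * (e \<bullet> y)" for e
    by (simp add: inner_simps inner_commute power2_eq_square algebra_simps)
  moreover have "(1/4) * ((norm (x + y))\<^sup>2 + - ((norm (x - y))\<^sup>2)) = x \<bullet> y"
    by (simp add: power2_norm_eq_inner inner_simps inner_commute)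
  ultimately show ?thesis by simp
qed

lemma has_sum_sum_finite:
  fixes f :: "'i \<Rightarrow> 'b \<Rightarrow> 'c::topological_comm_monoid_add"
  assumes "\<And>i. i \<in> I \<Longrightarrow> (f i has_sum S i) B"
  shows "((\<lambda>x. \<Sum>i\<in>I. f i x) has_sum (\<Sum>i\<in>I. S i)) B"
  using assms by (induction I rule: infinite_finite_induct) (auto intro: has_sum_add)

text \<open>The sum depends on the Gram matrices only. Hence the Hilbert--Schmidt norm of a finite-rank operator
does not depend on the basis. The lemma is applied to the Hilbert space itself and to its complexification, seen
as a real space.\<close>

lemma finite_rank_hs:
  fixes a :: "'i \<Rightarrow> 'k::real_inner" and b :: "'i \<Rightarrow> 'h::{real_inner, complete_space}"
  assumes B: "orthonormal_basis B"
  shows "((\<lambda>e. (norm (\<Sum>i\<in>I. (e \<bullet> b i) *\<^sub>R a i))\<^sup>2) has_sum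
     (\<Sum>i\<in>I. \<Sum>l\<in>I. (a i \<bullet> a l) * (b i \<bullet> b l))) B"
proof -
  have *: "(norm (\<Sum>i\<in>I. (e \<bullet> b i) *\<^sub>R a i))\<^sup>2 =
      (\<Sum>i\<in>I. \<Sum>l\<in>I. (a i \<bullet> a l) * ((e \<bullet> b i) * (e \<bullet> b l)))" for e
    by (simp add: power2_norm_eq_inner inner_sum_left inner_sum_right sum_distrib_left
        inner_commute mult_ac)
  show ?thesis unfolding *
    by (intro has_sum_sum_finite has_sum_cmult_right parseval_inner[OF B])
qed

lemma hs_norm_finite_rank:
  fixes a b :: "'i \<Rightarrow> 'h::{real_inner, complete_space}"
  shows "(hs_norm (\<lambda>z. \<Sum>i\<in>I. (z \<bullet> b i) *\<^sub>R a i))\<^sup>2 =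
     (\<Sum>i\<in>I. \<Sum>l\<in>I. (a i \<bullet> a l) * (b i \<bullet> b l))"
proof -
  have B: "orthonormal_basis (SOME B :: 'h set. orthonormal_basis B)"
    by (rule someI_ex) (rule orthonormal_basis_exists)
  have "((\<lambda>e. (norm (\<Sum>i\<in>I. (e \<bullet> b i) *\<^sub>R a i))\<^sup>2) has_sum
     (\<Sum>i\<in>I. \<Sum>l\<in>I. (a i \<bullet> a l) * (b i \<bullet> b l))) (SOME B. orthonormal_basis B)"
    by (rule finite_rank_hs[OF B])
  from infsumI[OF this] infsum_nonneg[of "SOME B. orthonormal_basis B" "\<lambda>e. (norm (\<Sum>i\<in>I. (e \<bullet> b i) *\<^sub>R a i))\<^sup>2"]
  show ?thesis unfolding hs_norm_def by simp
qed

text \<open>The real inner product of the complexification is the real part of \<open>cinner\<close>, and multiplication by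
\<open>\<i>\<close> turns it into the imaginary part. So a complex basis together with its multiples by \<open>\<i>\<close> is a
real basis.\<close>

lemma real_basis_of_complex_basis:
  fixes B :: "'h::real_inner complexified set"
  assumes B: "corthonormal_basis B"
  shows "orthonormal_basis (B \<union> cscale \<i> ` B)" and "B \<inter> cscale \<i> ` B = {}" and "inj (cscale \<i> :: 'h complexified \<Rightarrow> _)"
proof -
  have on: "cinner e f = (if e = f then 1 else 0)" if "e \<in> B" "f \<in> B" for e f
    using B that unfolding corthonormal_basis_def by blast
  have re: "z \<bullet> w = Re (cinner z w)" "z \<bullet> cscale \<i> w = Im (cinner z w)"
    "cscale \<i> w \<bullet> z = Im (cinner z w)" "cscale \<i> z \<bullet> cscale \<i> w = Re (cinner z w)"
    for z w :: "'h complexified"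
    by (auto simp: cinner_def cscale_def inner_prod_def inner_commute)
  show inj: "inj (cscale \<i> :: 'h complexified \<Rightarrow> _)"
    by (rule injI) (auto simp: cscale_def prod_eq_iff)
  have *: "e \<bullet> cscale \<i> f = 0" "cscale \<i> f \<bullet> e = 0" "e \<bullet> f = (if e = f then 1 else 0)"
      "cscale \<i> e \<bullet> cscale \<i> f = (if e = f then 1 else 0)"
    if "e \<in> B" "f \<in> B" for e f
    using on[OF that] on[OF that(2,1)] re by auto
  show disj: "B \<inter> cscale \<i> ` B = {}"
    using * by (metis disjoint_iff imageE zero_neq_one)
  show "orthonormal_basis (B \<union> cscale \<i> ` B)"
    unfolding orthonormal_basis_def
  proof (intro conjI ballI allI impI)
    fix e f assume "e \<in> B \<union> cscale \<i> ` B" "f \<in> B \<union> cscale \<i> ` B"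
    then show "e \<bullet> f = (if e = f then 1 else 0)"
      using * disj injD[OF inj] by (elim UnE imageE) (auto simp: inj_eq[OF inj])
  next
    fix z assume z: "\<forall>e\<in>B \<union> cscale \<i> ` B. z \<bullet> e = 0"
    have "cinner z e = 0" if "e \<in> B" for e
      using z that re[of z e] by (auto simp: complex_eq_iff)
    then show "z = 0" using B unfolding corthonormal_basis_def by blast
  qed
qed

text \<open>A complex rank-one operator is the sum of two real ones, one for the real and one for the imaginary part
of its argument. The real Hilbert--Schmidt norm counts each basis vector \<open>e\<close> and also
\<open>\<i> e\<close>, with the same contribution, so it is twice the complex one.\<close>

lemma chs_norm_finite_rank:
  fixes a b :: "'i \<Rightarrow> 'h::{real_inner, complete_space}"
  shows "(chs_norm (\<lambda>z. \<Sum>i\<in>I. cscale (c i) (complexify (rank_one (a i) (b i)) z)))\<^sup>2 =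
     (\<Sum>i\<in>I. \<Sum>l\<in>I. Re (c i * cnj (c l)) * ((a i \<bullet> a l) * (b i \<bullet> b l)))"
    (is "(chs_norm ?A)\<^sup>2 = ?R")
proof (cases "finite I")
  case False then show ?thesis by (simp add: chs_norm_def)
next
  case I: True
  let ?B = "SOME B :: 'h complexified set. corthonormal_basis B"
  have B: "corthonormal_basis ?B"
    by (rule someI_ex) (rule corthonormal_basis_exists)
  note RB = real_basis_of_complex_basis[OF B]
  define a' where "a' j = cscale (c (fst j)) (if snd j then (a (fst j), 0) else (0, a (fst j)))" for j
  define b' where "b' j = (if snd j then (b (fst j), 0) else (0, b (fst j)))" for j
  have pairs: "(\<Sum>j\<in>I \<times> UNIV. f j) = (\<Sum>i\<in>I. f (i, True) + f (i, False))"
    for f :: "'i \<times> bool \<Rightarrow> 'c::comm_monoid_add"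
    using sum.cartesian_product[of "\<lambda>i b. f (i, b)" "UNIV :: bool set" I]
    by (simp add: UNIV_bool add.commute)
  have A: "?A z = (\<Sum>j\<in>I \<times> UNIV. (z \<bullet> b' j) *\<^sub>R a' j)" for z
    unfolding pairs by (rule sum.cong[OF refl])
      (simp add: a'_def b'_def complexify_def rank_one_def cscale_def inner_prod_def prod_eq_iff algebra_simps)
  have "((\<lambda>e. (norm (?A e))\<^sup>2) has_sum
     (\<Sum>i\<in>I \<times> UNIV. \<Sum>l\<in>I \<times> UNIV. (a' i \<bullet> a' l) * (b' i \<bullet> b' l))) (?B \<union> cscale \<i> ` ?B)"
    unfolding A by (rule finite_rank_hs[OF RB(1)])
  moreover have "(\<Sum>i\<in>I \<times> UNIV. \<Sum>l\<in>I \<times> UNIV. (a' i \<bullet> a' l) * (b' i \<bullet> b' l)) = 2 * ?R"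
    unfolding pairs sum_distrib_left by (intro sum.cong refl)
      (simp add: a'_def b'_def cscale_def inner_prod_def sum_distrib_left algebra_simps)
  ultimately have tot: "((\<lambda>e. (norm (?A e))\<^sup>2) has_sum 2 * ?R) (?B \<union> cscale \<i> ` ?B)" by simp
  have "(\<lambda>e. (norm (?A e))\<^sup>2) summable_on ?B"
    using summable_on_subset_banach[OF has_sum_imp_summable[OF tot]] by blast
  then have S: "((\<lambda>e. (norm (?A e))\<^sup>2) has_sum (\<Sum>\<^sub>\<infinity>e\<in>?B. (norm (?A e))\<^sup>2)) ?B" by simp
  have inv: "norm (?A (cscale \<i> e)) = norm (?A e)" for e
  proof -
    have "?A (cscale \<i> e) = cscale \<i> (?A e)"
      by (simp add: complexify_def rank_one_def cscale_def prod_eq_iff fst_sum snd_sum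
         sum.distrib sum_subtractf sum_negf algebra_simps inner_simps)
    then show ?thesis by (simp add: cscale_def norm_prod_def add.commute)
  qed
  have "((\<lambda>e. (norm (?A e))\<^sup>2) has_sum (\<Sum>\<^sub>\<infinity>e\<in>?B. (norm (?A e))\<^sup>2)) (cscale \<i> ` ?B)"
    using S inv by (subst has_sum_reindex) (auto intro: inj_on_subset[OF RB(3)] simp: o_def)
  from has_sum_Un_disjoint[OF S this RB(2)] tot
  have "2 * (\<Sum>\<^sub>\<infinity>e\<in>?B. (norm (?A e))\<^sup>2) = 2 * ?R" using has_sum_unique by fastforce
  moreover have "(\<Sum>\<^sub>\<infinity>e\<in>?B. (norm (?A e))\<^sup>2) \<ge> 0" by (intro infsum_nonneg) simp
  ultimately show ?thesis unfolding chs_norm_def by simp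
qed

section \<open>The statistic as a polynomial in inner products\<close>

lemma hs_norm_autocov_0:
  fixes u :: "int \<Rightarrow> 'h::{real_inner, complete_space}"
  shows "(hs_norm (autocov u n 0))\<^sup>2 =
    (1 / (real n)\<^sup>2) * (\<Sum>s\<in>{1..int n}. \<Sum>t\<in>{1..int n}. (u s \<bullet> u t)\<^sup>2)"
proof -
  have "autocov u n 0 = (\<lambda>z. \<Sum>t\<in>{1..int n}. (z \<bullet> u t) *\<^sub>R ((1 / real n) *\<^sub>R u t))"
    by (simp add: autocov_def autocov_nonneg_def rank_one_def scaleR_sum_right mult_ac)
  then have "(hs_norm (autocov u n 0))\<^sup>2 = (\<Sum>s\<in>{1..int n}. \<Sum>t\<in>{1..int n}.
      (((1 / real n) *\<^sub>R u s) \<bullet> ((1 / real n) *\<^sub>R u t)) * (u s \<bullet> u t))"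
    by (simp only: hs_norm_finite_rank)
  then show ?thesis
    by (simp add: sum_distrib_left power2_eq_square mult_ac)
qed

lemma autocov_eq_sum:
  fixes u :: "int \<Rightarrow> 'h::real_inner"
  shows "autocov u n j z = (1 / real n) *\<^sub>R (\<Sum>t\<in>{\<bar>j\<bar> + 1..int n}.
     rank_one (u (if 0 \<le> j then t else t + j)) (u (if 0 \<le> j then t - j else t)) z)"
proof (cases "0 \<le> j")
  case True then show ?thesis by (simp add: autocov_def autocov_nonneg_def)
next
  case False
  have "adjoint (autocov_nonneg u n (- j)) =
      (\<lambda>z. (1 / real n) *\<^sub>R (\<Sum>t = - j + 1..int n. rank_one (u (t + j)) (u t) z))"
    by (rule adjoint_unique)
      (simp add: autocov_nonneg_def rank_one_def inner_sum_left inner_sum_right inner_commute mult_ac)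
  then show ?thesis using False by (simp add: autocov_def)
qed

lemma integral_cos_int:
  "(LBINT \<omega>:{-pi..pi}. cos (of_int m * \<omega>)) = (if m = 0 then 2 * pi else 0)"
  and set_integrable_cos_int: "set_integrable lborel {-pi..pi} (\<lambda>\<omega>. cos (of_int m * \<omega>))"
proof -
  show "set_integrable lborel {-pi..pi} (\<lambda>\<omega>. cos (of_int m * \<omega>))"
    by (rule borel_integrable_atLeastAtMost') (intro continuous_intros)
  show "(LBINT \<omega>:{-pi..pi}. cos (of_int m * \<omega>)) = (if m = 0 then 2 * pi else 0)"
  proof (cases "m = 0")
    case True then show ?thesis by (simp add: set_lebesgue_integral_def)
  next
    case False
    have "has_bochner_integral lborel (\<lambda>x. cos (of_int m * x) * indicator {-pi..pi} x)
       (sin (of_int m * pi) / of_int m - sin (of_int m * (-pi)) / of_int m)"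
      using False by (intro has_bochner_integral_FTC_Icc_real)
        (auto intro!: derivative_eq_intros continuous_intros)
    then have "(\<integral>x. cos (of_int m * x) * indicator {-pi..pi} x \<partial>lborel) = 2 * sin (of_int m * pi) / of_int m"
      by (simp add: has_bochner_integral_integral_eq)
    moreover have "sin (of_int m * pi) = 0"
      using sin_zero_iff_int2 by blast
    ultimately show ?thesis using False by (simp add: set_lebesgue_integral_def mult.commute)
  qed
qed

text \<open>This is \<open>n\<^sup>2\<close> times the squared Hilbert--Schmidt norm of the sample autocovariance at lag \<open>j\<close>.\<close>

definition lag_sum :: "(int \<Rightarrow> 'h::real_inner) \<Rightarrow> nat \<Rightarrow> int \<Rightarrow> real" where
  "lag_sum u n j = (\<Sum>t\<in>{j + 1..int n}. \<Sum>s\<in>{j + 1..int n}.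
     (u t \<bullet> u s) * (u (t - j) \<bullet> u (s - j)))"

text \<open>Parseval's identity for the trigonometric polynomial \<open>\<omega> \<mapsto> F\<^sub>n(\<omega>) - C\<^sub>n(0) / (2\<pi>)\<close>. Subtracting
\<open>C\<^sub>n(0) / (2\<pi>)\<close> removes the lag \<open>0\<close>, since \<open>k 0 = 1\<close>; the lags \<open>j\<close> and \<open>-j\<close> contribute equally, since
passing to the adjoint preserves the Hilbert--Schmidt norm.\<close>

lemma Q_hat_sq_eq:
  fixes u :: "int \<Rightarrow> 'h::{real_inner, complete_space}"
  assumes k0: "k 0 = 1" and ksym: "\<And>x. k (- x) = k x"
  shows "Q_hat_sq k p u n = (2 / (real n)\<^sup>2) *
     (\<Sum>j = 1..n - 1. (k (real j / p))\<^sup>2 * lag_sum u n (int j))"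
proof -
  define J where "J = {j::int. \<bar>j\<bar> < int n} - {0}"
  have finJ: "finite J" unfolding J_def by (rule finite_subset[of _ "{- int n..int n}"]) auto
  have fin0: "finite {j::int. \<bar>j\<bar> < int n}" by (rule finite_subset[of _ "{- int n..int n}"]) auto
  define a where "a i = u (if 0 \<le> fst i then snd i else snd i + fst i)" for i
  define b where "b i = u (if 0 \<le> fst i then snd i - fst i else snd i)" for i
  define T where "T j = {\<bar>j\<bar> + 1..int n}" for j
  \<comment> \<open>the operator is a sum of complex multiples of rank-one operators, indexed by lag and time\<close>
  define I where "I = (SIGMA j:J. T j)"
  define r where "r j = k (of_int j / p) / (2 * pi * real n)" for j
  define c where "c \<omega> i = of_real (r (fst i)) * exp (- \<i> * of_int (fst i) * of_real \<omega>)"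
    for \<omega> and i :: "int \<times> int"
  have csum: "cscale g (\<Sum>x\<in>A. f x) = (\<Sum>x\<in>A. cscale g (f x))" for g A and f :: "int \<Rightarrow> 'h complexified"
    by (simp add: cscale_def prod_eq_iff fst_sum snd_sum scaleR_sum_right sum_subtractf sum.distrib)
  have csc: "s *\<^sub>R cscale g z = cscale (of_real s * g) z"
     "cscale g (s *\<^sub>R z) = cscale (of_real s * g) z" for s g and z :: "'h complexified"
    by (auto simp: cscale_def prod_eq_iff algebra_simps)
  have ab: "a (j, t) = u (if 0 \<le> j then t else t + j)" "b (j, t) = u (if 0 \<le> j then t - j else t)" for j t
    by (simp_all add: a_def b_def)
  have ac: "complexify (autocov u n j) z = (1 / real n) *\<^sub>R (\<Sum>t\<in>T j. complexify (rank_one (a (j,t)) (b (j,t))) z)"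
    for j z
    by (simp add: complexify_def autocov_eq_sum T_def ab fst_sum snd_sum prod_eq_iff)
  have spec: "spec_density k p u n \<omega> z - (1 / (2 * pi)) *\<^sub>R complexify (autocov u n 0) z =
      (\<Sum>i\<in>I. cscale (c \<omega> i) (complexify (rank_one (a i) (b i)) z))" for \<omega> z
  proof (cases "n = 0")
    case True then show ?thesis by (simp add: spec_density_def I_def J_def complexify_def autocov_eq_sum zero_prod_def)
  next
    case False
    then have z: "0 \<in> {j::int. \<bar>j\<bar> < int n}" by simp
    have c1: "cscale 1 z = z" for z :: "'h complexified" by (simp add: cscale_def)
    have "spec_density k p u n \<omega> z - (1 / (2 * pi)) *\<^sub>R complexify (autocov u n 0) z =
       (1 / (2 * pi)) *\<^sub>R (\<Sum>j\<in>J. cscale (of_real (k (of_int j / p)) * exp (- \<i> * of_int j * of_real \<omega>))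
          (complexify (autocov u n j) z))"
      unfolding spec_density_def sum.remove[OF fin0 z] J_def
      by (simp add: k0 c1 scaleR_add_right)
    also have "\<dots> = (\<Sum>j\<in>J. \<Sum>t\<in>T j. cscale (c \<omega> (j,t)) (complexify (rank_one (a (j,t)) (b (j,t))) z))"
      by (simp add: ac csc csum scaleR_sum_right c_def r_def field_simps)
    also have "\<dots> = (\<Sum>i\<in>I. cscale (c \<omega> i) (complexify (rank_one (a i) (b i)) z))"
      unfolding I_def using finJ by (subst sum.Sigma) (auto simp: T_def)
    finally show ?thesis .
  qed
  define K where "K i l = (a i \<bullet> a l) * (b i \<bullet> b l)" for i l
  have I_sum: "(\<Sum>i\<in>I. f i) = (\<Sum>j\<in>J. \<Sum>t\<in>T j. f (j, t))" for f :: "int \<times> int \<Rightarrow> real"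
    unfolding I_def using finJ by (subst sum.Sigma) (auto simp: T_def)
  have Re: "Re (c \<omega> i * cnj (c \<omega> l)) = r (fst i) * r (fst l) * cos (of_int (fst i - fst l) * \<omega>)" for \<omega> i l
  proof -
    have e: "exp (- \<i> * of_int x * complex_of_real \<omega>) = cis (- of_int x * \<omega>)" for x
      by (simp add: cis_conv_exp mult_ac)
    then have "c \<omega> i * cnj (c \<omega> l) = of_real (r (fst i) * r (fst l)) * cis (- of_int (fst i - fst l) * \<omega>)"
      unfolding c_def complex_cnj_mult e cis_cnj complex_cnj_complex_of_real
      by (simp add: cis_mult algebra_simps)
    moreover have "Re (of_real x * cis (- y)) = x * cos y" for x y by simp
    ultimately show ?thesis by (simp only: mult_minus_left)
  qed
  have "(LBINT \<omega>:{-pi..pi}. (chs_norm (\<lambda>z. spec_density k p u n \<omega> z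
                      - (1 / (2 * pi)) *\<^sub>R complexify (autocov u n 0) z))\<^sup>2) =
     (LBINT \<omega>:{-pi..pi}. (\<Sum>i\<in>I. \<Sum>l\<in>I. r (fst i) * r (fst l) * K i l * cos (of_int (fst i - fst l) * \<omega>)))"
    unfolding spec chs_norm_finite_rank Re K_def by (simp add: mult_ac)
  also have "\<dots> = (\<Sum>i\<in>I. \<Sum>l\<in>I. r (fst i) * r (fst l) * K i l * (LBINT \<omega>:{-pi..pi}. cos (of_int (fst i - fst l) * \<omega>)))"
    using set_integrable_cos_int unfolding set_lebesgue_integral_def set_integrable_def
    by (simp add: sum_distrib_left mult.left_commute[of "indicator _ _"] del: of_int_diff)
  also have "\<dots> = (\<Sum>i\<in>I. \<Sum>l\<in>I. if fst l = fst i then 2 * pi * ((r (fst i))\<^sup>2 * K i l) else 0)"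
    unfolding integral_cos_int by (intro sum.cong refl) (auto simp: power2_eq_square)
  also have "\<dots> = (\<Sum>j\<in>J. \<Sum>t\<in>T j. \<Sum>j'\<in>J. \<Sum>s\<in>T j'. if j' = j then 2 * pi * ((r j)\<^sup>2 * K (j,t) (j',s)) else 0)"
    by (simp add: I_sum cong: if_cong)
  also have "\<dots> = (\<Sum>j\<in>J. \<Sum>t\<in>T j. \<Sum>j'\<in>J. if j' = j then (\<Sum>s\<in>T j'. 2 * pi * ((r j)\<^sup>2 * K (j,t) (j',s))) else 0)"
    by (intro sum.cong refl) auto
  also have "\<dots> = (\<Sum>j\<in>J. \<Sum>t\<in>T j. \<Sum>s\<in>T j. 2 * pi * ((r j)\<^sup>2 * K (j,t) (j,s)))"
    using finJ by (simp add: sum.delta)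
  also have "\<dots> = (\<Sum>j\<in>J. 2 * pi * (r j)\<^sup>2 * lag_sum u n \<bar>j\<bar>)"
    unfolding lag_sum_def sum_distrib_left T_def
    by (intro sum.cong refl) (auto simp: K_def a_def b_def)
  also have "\<dots> = (\<Sum>j\<in>int ` {1..n-1} \<union> (\<lambda>j. - int j) ` {1..n-1}. 2 * pi * (r j)\<^sup>2 * lag_sum u n \<bar>j\<bar>)"
  proof (rule sum.cong[OF _ refl])
    show "J = int ` {1..n - 1} \<union> (\<lambda>j. - int j) ` {1..n - 1}" (is "J = ?R")
    proof
      show "?R \<subseteq> J" by (auto simp: J_def)
      show "J \<subseteq> ?R"
      proof
        fix j assume "j \<in> J"
        then have "nat \<bar>j\<bar> \<in> {1..n-1}" "j = int (nat \<bar>j\<bar>) \<or> j = - int (nat \<bar>j\<bar>)" by (auto simp: J_def)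
        then show "j \<in> ?R" by blast
      qed
    qed
  qed
  also have "\<dots> = 2 * (\<Sum>j = 1..n-1. 2 * pi * (r (int j))\<^sup>2 * lag_sum u n (int j))"
  proof -
    have "r (- j) = r j" for j using ksym[of "of_int j / p"] by (simp add: r_def)
    then show ?thesis
      by (subst sum.union_disjoint) (auto simp: sum.reindex inj_on_def o_def)
  qed
  also have "\<dots> = 2 * (\<Sum>j = 1..n-1. (k (real j / p))\<^sup>2 * lag_sum u n (int j)) / (2 * pi * (real n)\<^sup>2)"
    by (simp add: r_def sum_distrib_left sum_divide_distrib power_divide power_mult_distrib power2_eq_square mult_ac)
  finally show ?thesis unfolding Q_hat_sq_def by simp
qed

section \<open>Resampling\<close>

text \<open>The integrals of approximating simple functions form a Cauchy sequence, so completeness yields the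
integral. Through this lemma the vanishing mean of the process becomes a statement about a genuine
integral, from which \<open>expectation_bounded_linear_u\<close> is derived.\<close>

lemma (in finite_measure) has_bochner_integral_complete:
  fixes f :: "'a \<Rightarrow> 'b::{real_normed_vector, complete_space, second_countable_topology}"
  assumes f [measurable]: "f \<in> borel_measurable M" and int: "integrable M (\<lambda>x. norm (f x))"
  shows "\<exists>x. has_bochner_integral M f x"
proof -
  from borel_measurable_implies_sequence_metric[OF f, of 0] obtain s where
    s: "\<And>i. simple_function M (s i)" "\<And>x. x \<in> space M \<Longrightarrow> (\<lambda>i. s i x) \<longlonglongrightarrow> f x"
       "\<And>i x. x \<in> space M \<Longrightarrow> dist (s i x) 0 \<le> 2 * dist (f x) 0" by blast
  have [measurable]: "s i \<in> borel_measurable M" for i using s(1) by (rule borel_measurable_simple_function)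
  have sb: "Bochner_Integration.simple_bochner_integrable M (s i)" for i
    using s(1) by (intro simple_bochner_integrable.intros) (auto simp: emeasure_eq_measure)
  define e where "e i = (\<integral>x. norm (f x - s i x) \<partial>M)" for i
  have bd: "norm (f x - s i x) \<le> 3 * norm (f x)" if "x \<in> space M" for x i
    using s(3)[OF that, of i] norm_triangle_ineq4[of "f x" "s i x"] by simp
  have inte: "integrable M (\<lambda>x. norm (f x - s i x))" for i
    by (rule Bochner_Integration.integrable_bound[of _ "\<lambda>x. 3 * norm (f x)"]) (use int bd in auto)
  have e0: "e \<longlonglongrightarrow> 0"
  proof -
    have "e \<longlonglongrightarrow> (\<integral>x. 0 \<partial>M)" unfolding e_def
    proof (rule integral_dominated_convergence[where w = "\<lambda>x. 3 * norm (f x)"])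
      show "AE x in M. (\<lambda>i. norm (f x - s i x)) \<longlonglongrightarrow> 0"
      proof (rule AE_I2)
        fix x assume "x \<in> space M"
        from tendsto_norm[OF tendsto_diff[OF tendsto_const s(2)[OF this], of "f x"]]
        show "(\<lambda>i. norm (f x - s i x)) \<longlonglongrightarrow> 0" by simp
      qed
    qed (use int bd in auto)
    then show ?thesis by simp
  qed
  have nn: "(\<integral>\<^sup>+x. ennreal (norm (f x - s i x)) \<partial>M) = ennreal (e i)" for i
    unfolding e_def by (rule nn_integral_eq_integral) (use inte in auto)
  have nonneg: "e i \<ge> 0" for i unfolding e_def by simp
  define S where "S i = Bochner_Integration.simple_bochner_integral M (s i)" for i
  have diff: "norm (S i - S l) \<le> e i + e l" for i l
    using simple_bochner_integral_bounded[OF f sb sb, of i l] nonneg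
    unfolding S_def nn by (simp flip: ennreal_plus)
  have "Cauchy S"
  proof (rule metric_CauchyI)
    fix \<epsilon> :: real assume "\<epsilon> > 0"
    then have "\<forall>\<^sub>F i in sequentially. e i < \<epsilon> / 2" using e0 by (intro order_tendstoD(2)) auto
    then obtain N where N: "\<And>i. i \<ge> N \<Longrightarrow> e i < \<epsilon> / 2" unfolding eventually_sequentially by blast
    have "dist (S m) (S n) < \<epsilon>" if "m \<ge> N" "n \<ge> N" for m n
      using diff[of m n] N[OF that(1)] N[OF that(2)] by (simp add: dist_norm)
    then show "\<exists>N. \<forall>m\<ge>N. \<forall>n\<ge>N. dist (S m) (S n) < \<epsilon>" by blast
  qed
  then obtain x where "S \<longlonglongrightarrow> x" using Cauchy_convergent_iff convergent_def by blast
  moreover have "(\<lambda>i. \<integral>\<^sup>+x. ennreal (norm (f x - s i x)) \<partial>M) \<longlonglongrightarrow> 0"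
    unfolding nn using tendsto_ennrealI[OF e0] by simp
  ultimately show ?thesis using sb f unfolding S_def by (blast intro: has_bochner_integral.intros)
qed

locale iid_process = prob_space M for M :: "'a measure" +
  fixes u :: "int \<Rightarrow> 'a \<Rightarrow> 'h::{real_inner, complete_space, second_countable_topology}"
  assumes indep: "indep_vars (\<lambda>_. borel) u UNIV"
    and ident_distr: "\<And>t. distr M borel (u t) = distr M borel (u 0)"
    and mean_zero: "\<And>t. integral\<^sup>L M (u t) = 0"
    and fourth_moment: "\<And>t. integrable M (\<lambda>x. (norm (u t x)) ^ 4)"
begin

abbreviation paths :: "(int \<Rightarrow> 'h) measure" where
  "paths \<equiv> PiM UNIV (\<lambda>_. borel)"

definition path :: "'a \<Rightarrow> int \<Rightarrow> 'h" where
  "path \<omega> t = u t \<omega>"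

lemma u_measurable [measurable]: "u t \<in> borel_measurable M"
  using indep unfolding indep_vars_def by simp

lemma path_measurable [measurable]: "path \<in> measurable M paths"
  unfolding path_def by (rule measurable_PiM_single') (auto simp: space_PiM)

text \<open>The path of \<open>fst \<omega>\<close> with the coordinate \<open>r\<close> replaced by an independent copy, taken from \<open>snd \<omega>\<close>.\<close>

definition resample :: "int \<Rightarrow> 'a \<times> 'a \<Rightarrow> int \<Rightarrow> 'h" where
  "resample r \<omega> = (path (fst \<omega>))(r := u r (snd \<omega>))"

lemma resample_measurable [measurable]: "resample r \<in> measurable (M \<Otimes>\<^sub>M M) paths"
  unfolding resample_def path_def fun_upd_def
  by (rule measurable_PiM_single') (auto simp: space_PiM)

lemma distr_resample: "distr (M \<Otimes>\<^sub>M M) paths (resample r) = distr M paths path"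
proof -
  define A where "A = UNIV - {r}"
  define X where "X \<omega> = restrict (\<lambda>i. u i \<omega>) {r}" for \<omega>
  define Y where "Y \<omega> = restrict (\<lambda>i. u i \<omega>) A" for \<omega>
  let ?P = "PiM {r} (\<lambda>_. borel) :: (int \<Rightarrow> 'h) measure" and ?Q = "PiM A (\<lambda>_. borel) :: (int \<Rightarrow> 'h) measure"
  have ind: "indep_var ?Q Y ?P X" unfolding X_def Y_def
    by (rule indep_var_restrict[OF indep]) (auto simp: A_def)
  have X [measurable]: "X \<in> measurable M ?P" and Y [measurable]: "Y \<in> measurable M ?Q"
    using indep_var_rv1[OF ind] indep_var_rv2[OF ind] by auto
  define m where "m z = merge A {r} z" for z :: "(int \<Rightarrow> 'h) \<times> (int \<Rightarrow> 'h)"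
  have "A \<union> {r} = UNIV" by (auto simp: A_def)
  then have m [measurable]: "m \<in> measurable (?Q \<Otimes>\<^sub>M ?P) paths"
    unfolding m_def using measurable_merge[of A "{r}" "\<lambda>_. borel"] by simp
  have mXY: "m (Y \<omega>, X \<omega>') = resample r (\<omega>, \<omega>')" for \<omega> \<omega>'
    by (auto simp: m_def merge_def X_def Y_def A_def resample_def path_def)
  have m1: "m (Y \<omega>, X \<omega>) = path \<omega>" for \<omega>
    by (auto simp: m_def merge_def X_def Y_def A_def path_def)
  have "distr M paths path = distr (distr M (?Q \<Otimes>\<^sub>M ?P) (\<lambda>\<omega>. (Y \<omega>, X \<omega>))) paths m"
    by (subst distr_distr) (auto simp: o_def m1)
  also have "distr M (?Q \<Otimes>\<^sub>M ?P) (\<lambda>\<omega>. (Y \<omega>, X \<omega>)) = distr M ?Q Y \<Otimes>\<^sub>M distr M ?P X"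
    using ind unfolding indep_var_distribution_eq by simp
  also have "\<dots> = distr (M \<Otimes>\<^sub>M M) (?Q \<Otimes>\<^sub>M ?P) (\<lambda>(\<omega>, \<omega>'). (Y \<omega>, X \<omega>'))"
    by (rule pair_measure_distr) (auto intro!: prob_space_imp_sigma_finite prob_space_distr)
  also have "distr \<dots> paths m = distr (M \<Otimes>\<^sub>M M) paths (resample r)"
    by (subst distr_distr) (auto simp: o_def mXY split_def)
  finally show ?thesis by simp
qed

text \<open>\<open>F'\<close> is the conditional expectation of \<open>F\<close> given all coordinates except the one at \<open>r\<close>. As the coordinates
are independent, a path and its resampled version have the same law, and Fubini's theorem applies.\<close>

lemma expectation_resample:
  fixes F :: "(int \<Rightarrow> 'h) \<Rightarrow> 'b::{banach, second_countable_topology}"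
  assumes F [measurable]: "F \<in> borel_measurable paths"
    and int: "integrable M (\<lambda>\<omega>. F (path \<omega>))"
    and F': "\<And>v. (\<integral>\<omega>. F (v(r := u r \<omega>)) \<partial>M) = F' v"
  shows "(\<integral>\<omega>. F (path \<omega>) \<partial>M) = (\<integral>\<omega>. F' (path \<omega>) \<partial>M)"
    and "integrable M (\<lambda>\<omega>. F' (path \<omega>))"
proof -
  interpret MM: pair_prob_space M M by unfold_locales
  have "integrable (distr M paths path) F" using int by (subst integrable_distr_eq) auto
  then have "integrable (M \<Otimes>\<^sub>M M) (\<lambda>z. F (resample r z))"
    unfolding distr_resample[of r, symmetric] by (subst (asm) integrable_distr_eq) auto
  from MM.integrable_fst'[OF this]
  show "integrable M (\<lambda>\<omega>. F' (path \<omega>))" by (simp add: resample_def F')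
  from MM.integral_fst'[OF \<open>integrable (M \<Otimes>\<^sub>M M) (\<lambda>z. F (resample r z))\<close>]
  have "(\<integral>\<omega>. \<integral>\<omega>'. F (resample r (\<omega>, \<omega>')) \<partial>M \<partial>M) = (\<integral>z. F (resample r z) \<partial>(M \<Otimes>\<^sub>M M))"
    by simp
  also have "\<dots> = (\<integral>v. F v \<partial>(distr M paths path))"
    unfolding distr_resample[of r, symmetric] by (subst integral_distr) auto
  also have "\<dots> = (\<integral>\<omega>. F (path \<omega>) \<partial>M)" by (subst integral_distr) auto
  finally show "(\<integral>\<omega>. F (path \<omega>) \<partial>M) = (\<integral>\<omega>. F' (path \<omega>) \<partial>M)"
    by (simp add: resample_def F')
qed

lemma expectation_resample_zero:
  fixes F :: "(int \<Rightarrow> 'h) \<Rightarrow> 'b::{banach, second_countable_topology}"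
  assumes F: "F \<in> borel_measurable paths"
    and F': "\<And>v. (\<integral>\<omega>. F (v(r := u r \<omega>)) \<partial>M) = 0"
  shows "(\<integral>\<omega>. F (path \<omega>) \<partial>M) = 0"
proof (cases "integrable M (\<lambda>\<omega>. F (path \<omega>))")
  case True
  from expectation_resample(1)[OF F True F'] show ?thesis by simp
qed (simp add: not_integrable_integral_eq)

section \<open>Moments\<close>

definition m4 :: real where "m4 = (\<integral>\<omega>. (norm (u 0 \<omega>)) ^ 4 \<partial>M)"

lemma expectation_u:
  fixes f :: "'h \<Rightarrow> 'b::{banach, second_countable_topology}"
  assumes [measurable]: "f \<in> borel_measurable borel"
  shows "(\<integral>\<omega>. f (u t \<omega>) \<partial>M) = (\<integral>\<omega>. f (u 0 \<omega>) \<partial>M)"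
proof -
  have "(\<integral>\<omega>. f (u t \<omega>) \<partial>M) = (\<integral>x. f x \<partial>distr M borel (u t))" by (subst integral_distr) auto
  also have "\<dots> = (\<integral>\<omega>. f (u 0 \<omega>) \<partial>M)" unfolding ident_distr[of t] by (subst integral_distr) auto
  finally show ?thesis .
qed

lemma moment4: "(\<integral>\<omega>. (norm (u t \<omega>)) ^ 4 \<partial>M) = m4"
  unfolding m4_def by (rule expectation_u[of "\<lambda>x. norm x ^ 4"]) simp

lemma power_le_one_plus: "(x::real) \<ge> 0 \<Longrightarrow> i \<le> l \<Longrightarrow> x ^ i \<le> 1 + x ^ l"
  by (metis add_increasing add_increasing2 le_numeral_extra(4) linorder_le_cases one_le_power power_increasing power_le_one zero_le_one zero_le_power)

lemma integrable_norm_power: "i \<le> 4 \<Longrightarrow> integrable M (\<lambda>\<omega>. (norm (u t \<omega>)) ^ i)"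
  by (rule Bochner_Integration.integrable_bound[of _ "\<lambda>\<omega>. 1 + (norm (u t \<omega>)) ^ 4"])
    (auto simp: fourth_moment power_le_one_plus)

lemma expectation_bounded_linear_u:
  fixes T :: "'h \<Rightarrow> real"
  assumes T: "bounded_linear T"
  shows "(\<integral>\<omega>. T (u t \<omega>) \<partial>M) = 0"
proof -
  have "integrable M (\<lambda>\<omega>. norm (u t \<omega>))" using integrable_norm_power[of 1 t] by simp
  from has_bochner_integral_complete[OF u_measurable this] obtain x where x: "has_bochner_integral M (u t) x"
    by blast
  then have "x = 0" using mean_zero[of t] has_bochner_integral_integral_eq by metis
  with x have "has_bochner_integral M (\<lambda>\<omega>. T (u t \<omega>)) (T 0)"
    by (intro has_bochner_integral_bounded_linear[OF T]) simp
  then show ?thesis by (simp add: has_bochner_integral_integral_eq bounded_linear.linear[OF T] linear_0)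
qed

lemma m4_nonneg: "m4 \<ge> 0" unfolding m4_def by simp

lemma second_moment_le: "(\<integral>\<omega>. (norm (u t \<omega>))\<^sup>2 \<partial>M)\<^sup>2 \<le> m4"
proof -
  let ?m = "\<integral>\<omega>. (norm (u t \<omega>))\<^sup>2 \<partial>M"
  have "0 \<le> (\<integral>\<omega>. ((norm (u t \<omega>))\<^sup>2 - ?m)\<^sup>2 \<partial>M)" by simp
  also have "(\<lambda>\<omega>. ((norm (u t \<omega>))\<^sup>2 - ?m)\<^sup>2) = (\<lambda>\<omega>. (norm (u t \<omega>)) ^ 4 - 2 * ?m * (norm (u t \<omega>))\<^sup>2 + ?m\<^sup>2)"
    by (auto simp: power2_eq_square numeral_eq_Suc algebra_simps)
  also have "(\<integral>\<omega>. (norm (u t \<omega>)) ^ 4 - 2 * ?m * (norm (u t \<omega>))\<^sup>2 + ?m\<^sup>2 \<partial>M) = m4 - 2 * ?m * ?m + ?m\<^sup>2"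
    using integrable_norm_power[of 2 t] fourth_moment[of t] by (simp add: moment4 prob_space)
  finally show ?thesis by (simp add: power2_eq_square)
qed

lemma product_moment:
  assumes "finite I" and f [measurable]: "\<And>i. i \<in> I \<Longrightarrow> f i \<in> borel_measurable borel"
    and int: "\<And>i. i \<in> I \<Longrightarrow> integrable M (\<lambda>\<omega>. f i (u i \<omega>) :: real)"
  shows "integrable M (\<lambda>\<omega>. \<Prod>i\<in>I. f i (u i \<omega>))"
    and "(\<integral>\<omega>. (\<Prod>i\<in>I. f i (u i \<omega>)) \<partial>M) = (\<Prod>i\<in>I. \<integral>\<omega>. f i (u i \<omega>) \<partial>M)"
proof -
  have "indep_vars (\<lambda>_. borel) (\<lambda>i \<omega>. f i (u i \<omega>)) I"
    using indep_vars_compose2[OF indep_vars_subset[OF indep subset_UNIV[of I]], of f "\<lambda>_. borel"] f by auto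
  then show "integrable M (\<lambda>\<omega>. \<Prod>i\<in>I. f i (u i \<omega>))"
    and "(\<integral>\<omega>. (\<Prod>i\<in>I. f i (u i \<omega>)) \<partial>M) = (\<Prod>i\<in>I. \<integral>\<omega>. f i (u i \<omega>) \<partial>M)"
    using assms(1) int by (auto intro!: indep_vars_integrable indep_vars_lebesgue_integral)
qed

end

section \<open>Square-integrable random variables\<close>

context prob_space begin

definition sq_integrable :: "('a \<Rightarrow> real) \<Rightarrow> bool" where
  "sq_integrable X \<longleftrightarrow> X \<in> borel_measurable M \<and> integrable M (\<lambda>\<omega>. (X \<omega>)\<^sup>2)"

lemma sq_integrable_mult:
  assumes "sq_integrable X" "sq_integrable Y"
  shows "integrable M (\<lambda>\<omega>. X \<omega> * Y \<omega>)"
proof (rule Bochner_Integration.integrable_bound)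
  show "integrable M (\<lambda>\<omega>. (X \<omega>)\<^sup>2 + (Y \<omega>)\<^sup>2)" using assms by (simp add: sq_integrable_def)
  show "(\<lambda>\<omega>. X \<omega> * Y \<omega>) \<in> borel_measurable M" using assms unfolding sq_integrable_def by (blast intro: borel_measurable_times)
  have "\<bar>x * y\<bar> \<le> x\<^sup>2 + y\<^sup>2" for x y :: real
  proof -
    have "2 * \<bar>x * y\<bar> \<le> x\<^sup>2 + y\<^sup>2" using sum_squares_bound[of "\<bar>x\<bar>" "\<bar>y\<bar>"] by (simp add: abs_mult)
    then show ?thesis using abs_ge_zero[of "x * y"] by linarith
  qed
  then show "AE \<omega> in M. norm (X \<omega> * Y \<omega>) \<le> norm ((X \<omega>)\<^sup>2 + (Y \<omega>)\<^sup>2)" by simp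
qed

lemma sq_integrable_integrable: "sq_integrable X \<Longrightarrow> integrable M X"
  using sq_integrable_mult[of X "\<lambda>_. 1"] by (simp add: sq_integrable_def)

lemma sq_integrable_add:
  assumes "sq_integrable X" "sq_integrable Y"
  shows "sq_integrable (\<lambda>\<omega>. X \<omega> + Y \<omega>)"
  using assms sq_integrable_mult[OF assms]
  unfolding sq_integrable_def by (intro conjI) (simp_all add: power2_sum mult.assoc borel_measurable_add)

lemma sq_integrable_cmult: "sq_integrable X \<Longrightarrow> sq_integrable (\<lambda>\<omega>. c * X \<omega>)"
  unfolding sq_integrable_def by (simp add: power_mult_distrib borel_measurable_times)

lemma sq_integrable_const [simp]: "sq_integrable (\<lambda>\<omega>. c)"
  by (simp add: sq_integrable_def)

lemma sq_integrable_diff: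
  assumes "sq_integrable X" "sq_integrable Y"
  shows "sq_integrable (\<lambda>\<omega>. X \<omega> - Y \<omega>)"
  using sq_integrable_add[OF assms(1) sq_integrable_cmult[OF assms(2), of "-1"]] by simp

lemma sq_integrable_sum:
  "(\<And>i. i \<in> I \<Longrightarrow> sq_integrable (X i)) \<Longrightarrow> sq_integrable (\<lambda>\<omega>. \<Sum>i\<in>I. X i \<omega>)"
  by (induction I rule: infinite_finite_induct) (auto intro: sq_integrable_add)

lemma expectation_sum_square:
  assumes "\<And>i. i \<in> I \<Longrightarrow> sq_integrable (X i)"
  shows "expectation (\<lambda>\<omega>. (\<Sum>i\<in>I. X i \<omega>)\<^sup>2) = (\<Sum>i\<in>I. \<Sum>l\<in>I. expectation (\<lambda>\<omega>. X i \<omega> * X l \<omega>))"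
  using assms by (simp add: power2_eq_square sum_product sq_integrable_mult)

text \<open>\<open>R\<close> is a symmetric relation that contains all correlated pairs. Bounding a correlated product by half the
sum of the squares charges each square at most \<open>m\<close> times.\<close>

lemma second_moment_sum_le:
  assumes fin: "finite I" and sq: "\<And>i. i \<in> I \<Longrightarrow> sq_integrable (X i)"
    and sym: "\<And>i l. R i l \<longleftrightarrow> R l i"
    and orth: "\<And>i l. i \<in> I \<Longrightarrow> l \<in> I \<Longrightarrow> \<not> R i l \<Longrightarrow> expectation (\<lambda>\<omega>. X i \<omega> * X l \<omega>) = 0"
    and card: "\<And>i. i \<in> I \<Longrightarrow> card {l \<in> I. R i l} \<le> m"
  shows "expectation (\<lambda>\<omega>. (\<Sum>i\<in>I. X i \<omega>)\<^sup>2) \<le> real m * (\<Sum>i\<in>I. expectation (\<lambda>\<omega>. (X i \<omega>)\<^sup>2))"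
proof -
  define a where "a i = expectation (\<lambda>\<omega>. (X i \<omega>)\<^sup>2)" for i
  have a: "a i \<ge> 0" for i unfolding a_def by simp
  have le: "expectation (\<lambda>\<omega>. X i \<omega> * X l \<omega>) \<le> (if R i l then (a i + a l) / 2 else 0)" if "i \<in> I" "l \<in> I" for i l
  proof (cases "R i l")
    case True
    have "expectation (\<lambda>\<omega>. X i \<omega> * X l \<omega>) \<le> expectation (\<lambda>\<omega>. ((X i \<omega>)\<^sup>2 + (X l \<omega>)\<^sup>2) / 2)"
    proof (rule integral_mono)
      show "X i \<omega> * X l \<omega> \<le> ((X i \<omega>)\<^sup>2 + (X l \<omega>)\<^sup>2) / 2" for \<omega>
        using sum_squares_bound[of "X i \<omega>" "X l \<omega>"] by simp
    qed (use sq that in \<open>auto simp: sq_integrable_mult sq_integrable_def\<close>)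
    also have "\<dots> = (a i + a l) / 2" using sq that by (simp add: a_def sq_integrable_def)
    finally show ?thesis using True by simp
  qed (use orth that in simp)
  have cnt: "(\<Sum>l\<in>I. if R i l then c else 0) \<le> real m * c" if "i \<in> I" "c \<ge> 0" for i and c :: real
  proof -
    have "(\<Sum>l\<in>I. if R i l then c else 0) = real (card {l \<in> I. R i l}) * c"
      using fin by (simp add: sum.If_cases Int_def)
    also have "\<dots> \<le> real m * c" using card[OF that(1)] that(2) by (intro mult_right_mono) auto
    finally show ?thesis .
  qed
  have "expectation (\<lambda>\<omega>. (\<Sum>i\<in>I. X i \<omega>)\<^sup>2) \<le> (\<Sum>i\<in>I. \<Sum>l\<in>I. if R i l then (a i + a l) / 2 else 0)"
    using expectation_sum_square[of I X, OF sq] by (simp add: sum_mono le)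
  also have "\<dots> = (\<Sum>i\<in>I. \<Sum>l\<in>I. (if R i l then a i / 2 else 0)) + (\<Sum>i\<in>I. \<Sum>l\<in>I. (if R i l then a l / 2 else 0))"
    unfolding sum.distrib[symmetric] by (intro sum.cong refl) (simp add: field_simps)
  also have "(\<Sum>i\<in>I. \<Sum>l\<in>I. (if R i l then a l / 2 else 0)) = (\<Sum>i\<in>I. \<Sum>l\<in>I. (if R i l then a i / 2 else 0))"
    by (subst sum.swap) (simp add: sym)
  also have "(\<Sum>i\<in>I. \<Sum>l\<in>I. (if R i l then a i / 2 else 0)) \<le> (\<Sum>i\<in>I. real m * (a i / 2))"
    using a by (intro sum_mono cnt) auto
  finally show ?thesis unfolding a_def[symmetric] by (simp add: sum_distrib_left)
qed

lemma cauchy_schwarz_expectation: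
  assumes X: "sq_integrable X" and Y: "sq_integrable Y"
  shows "expectation (\<lambda>\<omega>. \<bar>X \<omega> * Y \<omega>\<bar>) \<le> sqrt (expectation (\<lambda>\<omega>. (X \<omega>)\<^sup>2)) * sqrt (expectation (\<lambda>\<omega>. (Y \<omega>)\<^sup>2))"
proof -
  define a b where "a = sqrt (expectation (\<lambda>\<omega>. (X \<omega>)\<^sup>2))" and "b = sqrt (expectation (\<lambda>\<omega>. (Y \<omega>)\<^sup>2))"
  have [measurable]: "X \<in> borel_measurable M" "Y \<in> borel_measurable M" using X Y by (auto simp: sq_integrable_def)
  have int: "integrable M (\<lambda>\<omega>. (X \<omega>)\<^sup>2)" "integrable M (\<lambda>\<omega>. (Y \<omega>)\<^sup>2)" using X Y by (auto simp: sq_integrable_def)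
  have a2: "expectation (\<lambda>\<omega>. (X \<omega>)\<^sup>2) = a\<^sup>2" and b2: "expectation (\<lambda>\<omega>. (Y \<omega>)\<^sup>2) = b\<^sup>2"
    by (simp_all add: a_def b_def)
  show ?thesis
  proof (cases "a = 0 \<or> b = 0")
    case True
    then have "(AE \<omega> in M. (X \<omega>)\<^sup>2 = 0) \<or> (AE \<omega> in M. (Y \<omega>)\<^sup>2 = 0)"
      using integral_nonneg_eq_0_iff_AE[OF int(1)] integral_nonneg_eq_0_iff_AE[OF int(2)] a2 b2 by auto
    then have "AE \<omega> in M. \<bar>X \<omega> * Y \<omega>\<bar> = 0" by (auto elim: AE_mp)
    then have "expectation (\<lambda>\<omega>. \<bar>X \<omega> * Y \<omega>\<bar>) = 0" by (intro integral_eq_zero_AE) auto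
    then show ?thesis by (simp add: a_def b_def)
  next
    case False
    have pos: "a > 0" "b > 0" using False by (auto simp: a_def b_def less_le)
    have le: "\<bar>x * y\<bar> \<le> (b / a * x\<^sup>2 + a / b * y\<^sup>2) / 2" for x y :: real
    proof -
      have "2 * (sqrt (b/a) * \<bar>x\<bar>) * (sqrt (a/b) * \<bar>y\<bar>) \<le> (sqrt (b/a) * \<bar>x\<bar>)\<^sup>2 + (sqrt (a/b) * \<bar>y\<bar>)\<^sup>2"
        by (rule sum_squares_bound)
      moreover have "sqrt (b/a) * sqrt (a/b) = 1" using pos by (simp flip: real_sqrt_mult)
      ultimately show ?thesis using pos
        by (simp add: power_mult_distrib abs_mult)
          (metis (no_types, opaque_lifting) mult.assoc mult.left_commute mult.right_neutral)
    qed
    have "expectation (\<lambda>\<omega>. \<bar>X \<omega> * Y \<omega>\<bar>) \<le> expectation (\<lambda>\<omega>. (b / a * (X \<omega>)\<^sup>2 + a / b * (Y \<omega>)\<^sup>2) / 2)"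
      using le int sq_integrable_mult[OF X Y] by (intro integral_mono) auto
    also have "\<dots> = (b / a * a\<^sup>2 + a / b * b\<^sup>2) / 2" using int a2 b2 by simp
    also have "\<dots> = a * b" using pos by (simp add: field_simps power2_eq_square)
    finally show ?thesis by (simp add: a_def b_def)
  qed
qed

lemma expectation_abs_le_sqrt:
  assumes X: "sq_integrable X"
  shows "expectation (\<lambda>\<omega>. \<bar>X \<omega>\<bar>) \<le> sqrt (expectation (\<lambda>\<omega>. (X \<omega>)\<^sup>2))"
  using cauchy_schwarz_expectation[OF X sq_integrable_const[of 1]] by (simp add: prob_space)

section \<open>Fourth moments\<close>

definition quart_integrable :: "('a \<Rightarrow> real) \<Rightarrow> bool" where
  "quart_integrable X \<longleftrightarrow> X \<in> borel_measurable M \<and> integrable M (\<lambda>\<omega>. (X \<omega>) ^ 4)"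

lemma quart_integrable_square: "quart_integrable X \<Longrightarrow> sq_integrable (\<lambda>\<omega>. (X \<omega>)\<^sup>2)"
  unfolding quart_integrable_def sq_integrable_def by (simp add: borel_measurable_power flip: power_mult)

lemma quart_integrable_mult:
  assumes "quart_integrable X" "quart_integrable Y"
  shows "sq_integrable (\<lambda>\<omega>. X \<omega> * Y \<omega>)"
  using sq_integrable_mult[OF quart_integrable_square[OF assms(1)] quart_integrable_square[OF assms(2)]] assms
  unfolding sq_integrable_def quart_integrable_def by (simp add: power_mult_distrib borel_measurable_times)

lemma quart_integrable_mult4:
  assumes "quart_integrable X" "quart_integrable Y" "quart_integrable Z" "quart_integrable W"
  shows "integrable M (\<lambda>\<omega>. X \<omega> * Y \<omega> * Z \<omega> * W \<omega>)"
  using sq_integrable_mult[OF quart_integrable_mult[OF assms(1,2)] quart_integrable_mult[OF assms(3,4)]]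
  by (simp add: mult.assoc)

lemma quart_integrable_sq: "quart_integrable X \<Longrightarrow> sq_integrable X"
  using quart_integrable_mult[of X "\<lambda>_. 1"] by (simp add: quart_integrable_def)

lemma quart_integrable_const [simp]: "quart_integrable (\<lambda>_. c)"
  by (simp add: quart_integrable_def)

lemma quart_integrable_cmult: "quart_integrable X \<Longrightarrow> quart_integrable (\<lambda>\<omega>. c * X \<omega>)"
  unfolding quart_integrable_def by (simp add: power_mult_distrib borel_measurable_times)

lemma quart_integrable_add:
  assumes X: "quart_integrable X" and Y: "quart_integrable Y"
  shows "quart_integrable (\<lambda>\<omega>. X \<omega> + Y \<omega>)"
proof -
  have [measurable]: "X \<in> borel_measurable M" "Y \<in> borel_measurable M"
    using X Y by (auto simp: quart_integrable_def)
  have "sq_integrable (\<lambda>\<omega>. ((X \<omega>)\<^sup>2 + (Y \<omega>)\<^sup>2) + 2 * (X \<omega> * Y \<omega>))"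
    using X Y by (intro sq_integrable_add sq_integrable_cmult quart_integrable_mult quart_integrable_square)
  then have "sq_integrable (\<lambda>\<omega>. (X \<omega> + Y \<omega>)\<^sup>2)" by (simp add: power2_sum mult.assoc)
  then show ?thesis by (simp add: sq_integrable_def quart_integrable_def flip: power_mult)
qed

lemma quart_integrable_sum:
  "(\<And>i. i \<in> I \<Longrightarrow> quart_integrable (X i)) \<Longrightarrow> quart_integrable (\<lambda>\<omega>. \<Sum>i\<in>I. X i \<omega>)"
  by (induction I rule: infinite_finite_induct) (auto intro: quart_integrable_add)

text \<open>Under the hypothesis only the products \<open>X\<^sub>a\<^sup>2 X\<^sub>b\<^sup>2\<close> survive in the expansion of the fourth power. The
factor \<open>3\<close> is the number of pairings of four factors, as for independent symmetric variables. The
hypothesis asks for less than independence; below it holds both for sums over times and for sums over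
lags.\<close>

lemma fourth_moment_sum_le_aux:
  assumes "finite I" and q: "\<And>i. i \<in> I \<Longrightarrow> quart_integrable (X i)"
    and zero: "\<And>a b c d. \<lbrakk>a \<in> I; b \<in> I; c \<in> I; d \<in> I; a \<notin> {b, c, d}\<rbrakk> \<Longrightarrow>
       expectation (\<lambda>\<omega>. X a \<omega> * X b \<omega> * X c \<omega> * X d \<omega>) = 0"
  shows "expectation (\<lambda>\<omega>. (\<Sum>i\<in>I. X i \<omega>) ^ 4) \<le>
     3 * (\<Sum>i\<in>I. \<Sum>l\<in>I. expectation (\<lambda>\<omega>. (X i \<omega>)\<^sup>2 * (X l \<omega>)\<^sup>2))"
  using assms
proof (induction I rule: finite_induct)
  case empty then show ?case by simp
next
  case (insert z J)
  define A where "A \<omega> = (\<Sum>i\<in>J. X i \<omega>)" for \<omega>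
  have qz: "quart_integrable (X z)" and qJ: "\<And>i. i \<in> J \<Longrightarrow> quart_integrable (X i)" using insert.prems(1) by auto
  have qA: "quart_integrable A" unfolding A_def using qJ by (rule quart_integrable_sum)
  note i4 = quart_integrable_mult4
  \<comment> \<open>the new index \<open>z\<close> occurs once\<close>
  have e1: "expectation (\<lambda>\<omega>. A \<omega> * A \<omega> * A \<omega> * X z \<omega>) = 0"
  proof -
    have "expectation (\<lambda>\<omega>. A \<omega> * A \<omega> * A \<omega> * X z \<omega>) =
       (\<Sum>a\<in>J. \<Sum>b\<in>J. \<Sum>c\<in>J. expectation (\<lambda>\<omega>. X z \<omega> * X a \<omega> * X b \<omega> * X c \<omega>))"
      unfolding A_def using qz qJ i4
      by (simp add: sum_distrib_left sum_distrib_right mult_ac)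
    also have "\<dots> = 0"
      using insert.hyps by (intro sum.neutral ballI insert.prems(2)) auto
    finally show ?thesis .
  qed
  \<comment> \<open>an old index occurs once\<close>
  have e3: "expectation (\<lambda>\<omega>. A \<omega> * X z \<omega> * X z \<omega> * X z \<omega>) = 0"
  proof -
    have "expectation (\<lambda>\<omega>. A \<omega> * X z \<omega> * X z \<omega> * X z \<omega>) =
       (\<Sum>a\<in>J. expectation (\<lambda>\<omega>. X a \<omega> * X z \<omega> * X z \<omega> * X z \<omega>))"
      unfolding A_def using qz qJ i4
      by (simp add: sum_distrib_right)
    also have "\<dots> = 0"
      using insert.hyps by (intro sum.neutral ballI insert.prems(2)) auto
    finally show ?thesis .
  qed
  have e2: "expectation (\<lambda>\<omega>. A \<omega> * A \<omega> * X z \<omega> * X z \<omega>) =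
      (\<Sum>a\<in>J. expectation (\<lambda>\<omega>. (X a \<omega>)\<^sup>2 * (X z \<omega>)\<^sup>2))"
  proof -
    have "expectation (\<lambda>\<omega>. A \<omega> * A \<omega> * X z \<omega> * X z \<omega>) =
       (\<Sum>a\<in>J. \<Sum>b\<in>J. expectation (\<lambda>\<omega>. X a \<omega> * X b \<omega> * X z \<omega> * X z \<omega>))"
      unfolding A_def using qz qJ i4
      by (simp add: sum_distrib_left sum_distrib_right mult_ac)
    also have "\<dots> = (\<Sum>a\<in>J. \<Sum>b\<in>J. if a = b then expectation (\<lambda>\<omega>. (X a \<omega>)\<^sup>2 * (X z \<omega>)\<^sup>2) else 0)"
    proof (intro sum.cong refl)
      fix a b assume "a \<in> J" "b \<in> J"
      then show "expectation (\<lambda>\<omega>. X a \<omega> * X b \<omega> * X z \<omega> * X z \<omega>) =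
         (if a = b then expectation (\<lambda>\<omega>. (X a \<omega>)\<^sup>2 * (X z \<omega>)\<^sup>2) else 0)"
        using insert.hyps insert.prems(2)[of a b z z] by (auto simp: power2_eq_square mult.assoc)
    qed
    also have "\<dots> = (\<Sum>a\<in>J. expectation (\<lambda>\<omega>. (X a \<omega>)\<^sup>2 * (X z \<omega>)\<^sup>2))"
      using insert.hyps by simp
    finally show ?thesis .
  qed
  have "expectation (\<lambda>\<omega>. (\<Sum>i\<in>insert z J. X i \<omega>) ^ 4) =
     expectation (\<lambda>\<omega>. A \<omega> * A \<omega> * A \<omega> * A \<omega> + 4 * (A \<omega> * A \<omega> * A \<omega> * X z \<omega>)
       + 6 * (A \<omega> * A \<omega> * X z \<omega> * X z \<omega>) + 4 * (A \<omega> * X z \<omega> * X z \<omega> * X z \<omega>)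
       + X z \<omega> * X z \<omega> * X z \<omega> * X z \<omega>)"
    using insert.hyps by (simp add: A_def[symmetric] numeral_eq_Suc algebra_simps)
  also have "\<dots> = expectation (\<lambda>\<omega>. A \<omega> * A \<omega> * A \<omega> * A \<omega>)
       + 4 * expectation (\<lambda>\<omega>. A \<omega> * A \<omega> * A \<omega> * X z \<omega>)
       + 6 * expectation (\<lambda>\<omega>. A \<omega> * A \<omega> * X z \<omega> * X z \<omega>)
       + 4 * expectation (\<lambda>\<omega>. A \<omega> * X z \<omega> * X z \<omega> * X z \<omega>)
       + expectation (\<lambda>\<omega>. X z \<omega> * X z \<omega> * X z \<omega> * X z \<omega>)"
    using qA qz i4 by simp
  also have "\<dots> = expectation (\<lambda>\<omega>. A \<omega> * A \<omega> * A \<omega> * A \<omega>)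
       + 6 * (\<Sum>a\<in>J. expectation (\<lambda>\<omega>. (X a \<omega>)\<^sup>2 * (X z \<omega>)\<^sup>2))
       + expectation (\<lambda>\<omega>. X z \<omega> * X z \<omega> * X z \<omega> * X z \<omega>)"
    unfolding e1 e2 e3 by simp
  also have "expectation (\<lambda>\<omega>. A \<omega> * A \<omega> * A \<omega> * A \<omega>) = expectation (\<lambda>\<omega>. (\<Sum>i\<in>J. X i \<omega>) ^ 4)"
    by (simp add: A_def numeral_eq_Suc mult_ac)
  also have "\<dots> \<le> 3 * (\<Sum>i\<in>J. \<Sum>l\<in>J. expectation (\<lambda>\<omega>. (X i \<omega>)\<^sup>2 * (X l \<omega>)\<^sup>2))"
    using insert.prems by (intro insert.IH) auto
  also have "expectation (\<lambda>\<omega>. X z \<omega> * X z \<omega> * X z \<omega> * X z \<omega>) = expectation (\<lambda>\<omega>. (X z \<omega>)\<^sup>2 * (X z \<omega>)\<^sup>2)"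
    by (simp add: power2_eq_square mult_ac)
  also have "expectation (\<lambda>\<omega>. (X z \<omega>)\<^sup>2 * (X z \<omega>)\<^sup>2) \<le> 3 * expectation (\<lambda>\<omega>. (X z \<omega>)\<^sup>2 * (X z \<omega>)\<^sup>2)"
    using Bochner_Integration.integral_nonneg[of M "\<lambda>\<omega>. (X z \<omega>)\<^sup>2 * (X z \<omega>)\<^sup>2"] by simp
  finally show ?case using insert.hyps
    by (simp add: sum.distrib mult.commute algebra_simps)
qed

lemma fourth_moment_sum_le:
  assumes fin: "finite I" and q: "\<And>i. i \<in> I \<Longrightarrow> quart_integrable (X i)"
    and zero: "\<And>a b c d. \<lbrakk>a \<in> I; b \<in> I; c \<in> I; d \<in> I; a \<notin> {b, c, d}\<rbrakk> \<Longrightarrow>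
       expectation (\<lambda>\<omega>. X a \<omega> * X b \<omega> * X c \<omega> * X d \<omega>) = 0"
    and B: "\<And>i. i \<in> I \<Longrightarrow> expectation (\<lambda>\<omega>. (X i \<omega>) ^ 4) \<le> (B i)\<^sup>2" "\<And>i. i \<in> I \<Longrightarrow> B i \<ge> 0"
  shows "expectation (\<lambda>\<omega>. (\<Sum>i\<in>I. X i \<omega>) ^ 4) \<le> 3 * (\<Sum>i\<in>I. B i)\<^sup>2"
proof -
  have "(\<Sum>i\<in>I. \<Sum>l\<in>I. expectation (\<lambda>\<omega>. (X i \<omega>)\<^sup>2 * (X l \<omega>)\<^sup>2)) \<le> (\<Sum>i\<in>I. \<Sum>l\<in>I. B i * B l)"
  proof (intro sum_mono)
    fix i l assume il: "i \<in> I" "l \<in> I"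
    have sq: "sqrt (expectation (\<lambda>\<omega>. ((X i \<omega>)\<^sup>2)\<^sup>2)) \<le> B i" if "i \<in> I" for i
      using B(1)[OF that] B(2)[OF that] by (intro real_le_lsqrt) (auto simp flip: power_mult)
    have "expectation (\<lambda>\<omega>. (X i \<omega>)\<^sup>2 * (X l \<omega>)\<^sup>2) \<le>
       sqrt (expectation (\<lambda>\<omega>. ((X i \<omega>)\<^sup>2)\<^sup>2)) * sqrt (expectation (\<lambda>\<omega>. ((X l \<omega>)\<^sup>2)\<^sup>2))"
      using cauchy_schwarz_expectation[OF quart_integrable_square quart_integrable_square, OF q q, OF il]
      by simp
    also have "\<dots> \<le> B i * B l" using sq il B(2) by (intro mult_mono) auto
    finally show "expectation (\<lambda>\<omega>. (X i \<omega>)\<^sup>2 * (X l \<omega>)\<^sup>2) \<le> B i * B l" .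
  qed
  moreover have "expectation (\<lambda>\<omega>. (\<Sum>i\<in>I. X i \<omega>) ^ 4) \<le>
     3 * (\<Sum>i\<in>I. \<Sum>l\<in>I. expectation (\<lambda>\<omega>. (X i \<omega>)\<^sup>2 * (X l \<omega>)\<^sup>2))"
    by (rule fourth_moment_sum_le_aux[OF fin]) (fact q, rule zero)
  ultimately show ?thesis
    by (simp only: power2_eq_square[of "sum B I"] sum_product)
qed

end

context iid_process begin

section \<open>Degenerate kernels\<close>

text \<open>A kernel is degenerate if it vanishes when either argument is integrated with respect to the law of
the process. The inner product and the covariance form are the two instances; the second one appears
when conditional variances are computed.\<close>

definition degenerate_kernel :: "real \<Rightarrow> ('h \<Rightarrow> 'h \<Rightarrow> real) \<Rightarrow> bool" where
  "degenerate_kernel b g \<longleftrightarrow> case_prod g \<in> borel_measurable (borel \<Otimes>\<^sub>M borel) \<and> 0 \<le> b \<and>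
     (\<forall>x y. \<bar>g x y\<bar> \<le> b * norm x * norm y) \<and>
     (\<forall>t y. (\<integral>\<omega>. g (u t \<omega>) y \<partial>M) = 0 \<and> (\<integral>\<omega>. g y (u t \<omega>) \<partial>M) = 0)"

definition sigma2 :: real where "sigma2 = (\<integral>\<omega>. (norm (u 0 \<omega>))\<^sup>2 \<partial>M)"

text \<open>The bilinear form \<open>\<langle>C x, y\<rangle>\<close> of the covariance operator \<open>C\<close>.\<close>

definition cov :: "'h \<Rightarrow> 'h \<Rightarrow> real" where
  "cov x y = (\<integral>\<omega>. (u 0 \<omega> \<bullet> x) * (u 0 \<omega> \<bullet> y) \<partial>M)"

lemma sigma2_nonneg: "sigma2 \<ge> 0" by (simp add: sigma2_def)

lemma moment2: "(\<integral>\<omega>. (norm (u t \<omega>))\<^sup>2 \<partial>M) = sigma2"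
  unfolding sigma2_def by (rule expectation_u[of "\<lambda>x. (norm x)\<^sup>2"]) simp

lemma sigma2_le: "sigma2\<^sup>2 \<le> m4"
  using second_moment_le[of 0] by (simp add: sigma2_def)

lemma inner_degenerate: "degenerate_kernel 1 (\<bullet>)"
  unfolding degenerate_kernel_def
  using expectation_bounded_linear_u[OF bounded_linear_inner_left]
    expectation_bounded_linear_u[OF bounded_linear_inner_right]
  by (auto simp: Cauchy_Schwarz_ineq2)

lemma cov_integrable: "integrable M (\<lambda>\<omega>. (u t \<omega> \<bullet> x) * (u t \<omega> \<bullet> y))"
proof (rule Bochner_Integration.integrable_bound)
  show "integrable M (\<lambda>\<omega>. (norm x * norm y) * (norm (u t \<omega>))\<^sup>2)"
    using integrable_norm_power[of 2 t] by simp
  show "AE \<omega> in M. norm ((u t \<omega> \<bullet> x) * (u t \<omega> \<bullet> y)) \<le> norm ((norm x * norm y) * (norm (u t \<omega>))\<^sup>2)"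
  proof (rule AE_I2)
    fix \<omega>
    have "\<bar>u t \<omega> \<bullet> x\<bar> * \<bar>u t \<omega> \<bullet> y\<bar> \<le> (norm (u t \<omega>) * norm x) * (norm (u t \<omega>) * norm y)"
      by (intro mult_mono Cauchy_Schwarz_ineq2) auto
    then show "norm ((u t \<omega> \<bullet> x) * (u t \<omega> \<bullet> y)) \<le> norm ((norm x * norm y) * (norm (u t \<omega>))\<^sup>2)"
      by (simp add: abs_mult power2_eq_square mult_ac)
  qed
qed simp

lemma cov_eq: "(\<integral>\<omega>. (u t \<omega> \<bullet> x) * (u t \<omega> \<bullet> y) \<partial>M) = cov x y"
  unfolding cov_def by (rule expectation_u[of "\<lambda>z. (z \<bullet> x) * (z \<bullet> y)"]) simp

lemma cov_commute: "cov x y = cov y x" by (simp add: cov_def mult.commute)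

lemma cov_bound: "\<bar>cov x y\<bar> \<le> sigma2 * norm x * norm y"
proof -
  have "\<bar>cov x y\<bar> \<le> (\<integral>\<omega>. \<bar>(u 0 \<omega> \<bullet> x) * (u 0 \<omega> \<bullet> y)\<bar> \<partial>M)"
    unfolding cov_def by (rule integral_abs_bound)
  also have "\<dots> \<le> (\<integral>\<omega>. (norm x * norm y) * (norm (u 0 \<omega>))\<^sup>2 \<partial>M)"
  proof (rule integral_mono)
    show "integrable M (\<lambda>\<omega>. \<bar>(u 0 \<omega> \<bullet> x) * (u 0 \<omega> \<bullet> y)\<bar>)" using cov_integrable by simp
    show "integrable M (\<lambda>\<omega>. (norm x * norm y) * (norm (u 0 \<omega>))\<^sup>2)"
      using integrable_norm_power[of 2 0] by simp
    fix \<omega>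
    have "\<bar>u 0 \<omega> \<bullet> x\<bar> * \<bar>u 0 \<omega> \<bullet> y\<bar> \<le> (norm (u 0 \<omega>) * norm x) * (norm (u 0 \<omega>) * norm y)"
      by (intro mult_mono Cauchy_Schwarz_ineq2) auto
    then show "\<bar>(u 0 \<omega> \<bullet> x) * (u 0 \<omega> \<bullet> y)\<bar> \<le> (norm x * norm y) * (norm (u 0 \<omega>))\<^sup>2"
      by (simp add: abs_mult power2_eq_square mult_ac)
  qed
  also have "\<dots> = sigma2 * norm x * norm y" by (simp add: sigma2_def)
  finally show ?thesis .
qed

lemma bounded_linear_cov: "bounded_linear (\<lambda>x. cov x y)"
proof
  fix x x' show "cov (x + x') y = cov x y + cov x' y"
    unfolding cov_def using cov_integrable by (simp add: inner_add_right distrib_right)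
next
  fix r x show "cov (r *\<^sub>R x) y = r *\<^sub>R cov x y"
    unfolding cov_def by (simp add: mult.assoc)
next
  show "\<exists>K. \<forall>x. norm (cov x y) \<le> norm x * K"
    using cov_bound[of _ y] by (intro exI[of _ "sigma2 * norm y"]) (simp add: mult_ac)
qed

lemma cov_measurable [measurable]: "case_prod cov \<in> borel_measurable (borel \<Otimes>\<^sub>M borel)"
  unfolding cov_def split_def by (rule borel_measurable_lebesgue_integral) simp

lemma cov_degenerate: "degenerate_kernel sigma2 cov"
  unfolding degenerate_kernel_def
  using expectation_bounded_linear_u[OF bounded_linear_cov] cov_bound sigma2_nonneg cov_measurable
  by (simp add: cov_commute)

lemma kernel_measurable [measurable]:
  assumes "degenerate_kernel b g"
  shows "(\<lambda>v. g (v t) (v s)) \<in> borel_measurable paths"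
proof -
  have "case_prod g \<in> borel_measurable (borel \<Otimes>\<^sub>M borel)" using assms by (simp add: degenerate_kernel_def)
  then have "(\<lambda>v. case_prod g (v t, v s)) \<in> borel_measurable paths" by measurable
  then show ?thesis by simp
qed

lemma kernel_integrable:
  assumes "degenerate_kernel b g"
  shows "integrable M (\<lambda>\<omega>. g (u t \<omega>) y)" and "integrable M (\<lambda>\<omega>. g y (u t \<omega>))"
proof -
  have g: "case_prod g \<in> borel_measurable (borel \<Otimes>\<^sub>M borel)" and bd: "\<And>x y. \<bar>g x y\<bar> \<le> b * norm x * norm y" and b: "b \<ge> 0"
    using assms by (auto simp: degenerate_kernel_def)
  have "(\<lambda>\<omega>. case_prod g (u t \<omega>, y)) \<in> borel_measurable M" "(\<lambda>\<omega>. case_prod g (y, u t \<omega>)) \<in> borel_measurable M"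
    using g by measurable
  then have m: "(\<lambda>\<omega>. g (u t \<omega>) y) \<in> borel_measurable M" "(\<lambda>\<omega>. g y (u t \<omega>)) \<in> borel_measurable M" by simp_all
  have int: "integrable M (\<lambda>\<omega>. (b * norm y) * norm (u t \<omega>))" using integrable_norm_power[of 1 t] by simp
  have le: "\<bar>g (u t \<omega>) y\<bar> \<le> (b * norm y) * norm (u t \<omega>)" "\<bar>g y (u t \<omega>)\<bar> \<le> (b * norm y) * norm (u t \<omega>)" for \<omega>
    using bd[of "u t \<omega>" y] bd[of y "u t \<omega>"] by (simp_all add: mult_ac)
  show "integrable M (\<lambda>\<omega>. g (u t \<omega>) y)" "integrable M (\<lambda>\<omega>. g y (u t \<omega>))"
    using le b by (auto intro!: Bochner_Integration.integrable_bound[OF int] m AE_I2 simp: abs_mult)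
qed

section \<open>Lagged products\<close>

definition lagged :: "('h \<Rightarrow> 'h \<Rightarrow> real) \<Rightarrow> int \<Rightarrow> int \<Rightarrow> int \<Rightarrow> (int \<Rightarrow> 'h) \<Rightarrow> real" where
  "lagged g t s j v = g (v t) (v s) * g (v (t - j)) (v (s - j))"

lemma lagged_measurable [measurable]:
  "degenerate_kernel b g \<Longrightarrow> lagged g t s j \<in> borel_measurable paths"
  unfolding lagged_def by measurable

lemma path_compose_measurable [measurable (raw)]:
  "F \<in> borel_measurable paths \<Longrightarrow> (\<lambda>\<omega>. F (path \<omega>)) \<in> borel_measurable M"
  by (rule measurable_compose[OF path_measurable])

text \<open>An index that occurs in exactly one of the four positions and does not influence \<open>H\<close> carries a variable
that can be integrated out first, and this gives zero by degeneracy. All orthogonality and martingale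
statements below are instances.\<close>

lemma lagged_isolated_zero:
  fixes H :: "(int \<Rightarrow> 'h) \<Rightarrow> 'b::{banach, second_countable_topology}"
  assumes g: "degenerate_kernel b g" and H [measurable]: "H \<in> borel_measurable paths"
    and H_indep: "\<And>v x. H (v(r := x)) = H v"
    and iso: "r = t \<and> r \<notin> {s, t - j, s - j} \<or> r = s \<and> r \<notin> {t, t - j, s - j} \<or>
      r = t - j \<and> r \<notin> {t, s, s - j} \<or> r = s - j \<and> r \<notin> {t, s, t - j}"
  shows "(\<integral>\<omega>. lagged g t s j (path \<omega>) *\<^sub>R H (path \<omega>) \<partial>M) = 0"
proof (rule expectation_resample_zero[where F = "\<lambda>v. lagged g t s j v *\<^sub>R H v"])
  show "(\<lambda>v. lagged g t s j v *\<^sub>R H v) \<in> borel_measurable paths"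
    using g by measurable
  fix v
  have z: "(\<integral>\<omega>. g (u i \<omega>) y \<partial>M) = 0" "(\<integral>\<omega>. g y (u i \<omega>) \<partial>M) = 0" for i y
    using g by (auto simp: degenerate_kernel_def)
  have int: "integrable M (\<lambda>\<omega>. lagged g t s j (v(r := u r \<omega>)))"
    using iso by (elim disjE) (auto simp: lagged_def kernel_integrable[OF g])
  have "(\<integral>\<omega>. lagged g t s j (v(r := u r \<omega>)) \<partial>M) = 0"
    using iso by (elim disjE) (auto simp: lagged_def z)
  moreover have "(\<integral>\<omega>. lagged g t s j (v(r := u r \<omega>)) *\<^sub>R H (v(r := u r \<omega>)) \<partial>M) =
      (\<integral>\<omega>. lagged g t s j (v(r := u r \<omega>)) \<partial>M) *\<^sub>R H v" 
    unfolding H_indep by (rule integral_scaleR_left) (rule int)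
  ultimately show "(\<integral>\<omega>. lagged g t s j (v(r := u r \<omega>)) *\<^sub>R H (v(r := u r \<omega>)) \<partial>M) = 0" by simp
qed

lemma lagged_upd: "r \<notin> {t, s, t - j, s - j} \<Longrightarrow> lagged g t s j (v(r := x)) = lagged g t s j v"
  by (auto simp: lagged_def)

text \<open>The indices \<open>s\<close> and \<open>t - j\<close> may coincide. Then the square contains the fourth power of the norm of one variable, which is
still integrable, and \<open>sigma2\<^sup>2 \<le> m4\<close> gives the same bound in both cases.\<close>

lemma lagged_moment2:
  assumes g: "degenerate_kernel b g" and st: "s < t" and j: "j \<ge> 1"
  shows "sq_integrable (\<lambda>\<omega>. lagged g t s j (path \<omega>))"
    and "(\<integral>\<omega>. (lagged g t s j (path \<omega>))\<^sup>2 \<partial>M) \<le> b ^ 4 * m4\<^sup>2"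
proof -
  define N where "N i = norm (u t i) * norm (u s i) * norm (u (t - j) i) * norm (u (s - j) i)" for i
  have bd: "\<bar>lagged g t s j (path \<omega>)\<bar> \<le> b\<^sup>2 * N \<omega>" for \<omega>
  proof -
    have "\<bar>g (path \<omega> t) (path \<omega> s)\<bar> * \<bar>g (path \<omega> (t - j)) (path \<omega> (s - j))\<bar> \<le>
       (b * norm (path \<omega> t) * norm (path \<omega> s)) * (b * norm (path \<omega> (t - j)) * norm (path \<omega> (s - j)))"
      using g by (intro mult_mono) (auto simp: degenerate_kernel_def)
    then show ?thesis by (simp add: lagged_def N_def path_def abs_mult power2_eq_square mult_ac)
  qed
  have bd2: "(lagged g t s j (path \<omega>))\<^sup>2 \<le> b ^ 4 * (N \<omega>)\<^sup>2" for \<omega>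
    using power_mono[OF bd[of \<omega>], of 2] by (simp add: power_mult_distrib flip: power_mult)
  have N2: "integrable M (\<lambda>\<omega>. (N \<omega>)\<^sup>2) \<and> (\<integral>\<omega>. (N \<omega>)\<^sup>2 \<partial>M) \<le> m4\<^sup>2"
  proof (cases "s = t - j")
    case False
    let ?I = "{t, s, t - j, s - j}"
    have "(N \<omega>)\<^sup>2 = (\<Prod>i\<in>?I. (norm (u i \<omega>))\<^sup>2)" for \<omega>
      using False st j by (simp add: N_def power_mult_distrib)
    then have eq: "(\<lambda>\<omega>. (N \<omega>)\<^sup>2) = (\<lambda>\<omega>. \<Prod>i\<in>?I. (norm (u i \<omega>))\<^sup>2)" by (rule ext)
    have "(\<integral>\<omega>. (N \<omega>)\<^sup>2 \<partial>M) = (\<Prod>i\<in>?I. sigma2)"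
      unfolding eq using integrable_norm_power
      by (subst product_moment(2)[where f = "\<lambda>i x. (norm x)\<^sup>2"]) (auto simp: moment2)
    also have "\<dots> = (sigma2\<^sup>2)\<^sup>2" using False st j by (simp add: power2_eq_square)
    also have "\<dots> \<le> m4\<^sup>2" using sigma2_le by (intro power_mono) auto
    finally show ?thesis
      unfolding eq using integrable_norm_power product_moment(1)[of ?I "\<lambda>i x. (norm x)\<^sup>2"] by auto
  next
    case True
    let ?I = "{t, s, s - j}" and ?f = "\<lambda>i x. if i = s then norm x ^ 4 else (norm x)\<^sup>2"
    have "(N \<omega>)\<^sup>2 = (\<Prod>i\<in>?I. ?f i (u i \<omega>))" for \<omega>
      using True st j by (simp add: N_def power_mult_distrib numeral_eq_Suc)
    then have eq: "(\<lambda>\<omega>. (N \<omega>)\<^sup>2) = (\<lambda>\<omega>. \<Prod>i\<in>?I. ?f i (u i \<omega>))" by (rule ext)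
    have int: "integrable M (\<lambda>\<omega>. ?f i (u i \<omega>))" for i
      by (cases "i = s") (auto intro: integrable_norm_power)
    have "(\<integral>\<omega>. (N \<omega>)\<^sup>2 \<partial>M) = (\<Prod>i\<in>?I. if i = s then m4 else sigma2)"
      unfolding eq using int
      by (subst product_moment(2)[where f = ?f]) (auto simp: moment2 moment4 intro!: prod.cong)
    also have "\<dots> = sigma2\<^sup>2 * m4" using True st j by (simp add: power2_eq_square)
    also have "\<dots> \<le> m4\<^sup>2" using sigma2_le m4_nonneg by (simp add: power2_eq_square mult_right_mono)
    finally show ?thesis
      unfolding eq using int product_moment(1)[of ?I ?f] by auto
  qed
  have [measurable]: "(\<lambda>\<omega>. lagged g t s j (path \<omega>)) \<in> borel_measurable M" using g by measurable
  have int: "integrable M (\<lambda>\<omega>. b ^ 4 * (N \<omega>)\<^sup>2)" using N2 by simp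
  then have int2: "integrable M (\<lambda>\<omega>. (lagged g t s j (path \<omega>))\<^sup>2)"
    by (rule Bochner_Integration.integrable_bound) (use bd2 in \<open>auto intro: order_trans[OF _ abs_ge_self]\<close>)
  then show "sq_integrable (\<lambda>\<omega>. lagged g t s j (path \<omega>))" by (simp add: sq_integrable_def)
  have "(\<integral>\<omega>. (lagged g t s j (path \<omega>))\<^sup>2 \<partial>M) \<le> (\<integral>\<omega>. b ^ 4 * (N \<omega>)\<^sup>2 \<partial>M)"
    using int int2 bd2 by (intro integral_mono) auto
  also have "\<dots> \<le> b ^ 4 * m4\<^sup>2" using N2 by (simp add: mult_left_mono)
  finally show "(\<integral>\<omega>. (lagged g t s j (path \<omega>))\<^sup>2 \<partial>M) \<le> b ^ 4 * m4\<^sup>2" .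
qed

text \<open>With a gap between \<open>s\<close> and \<open>t - j\<close> the four indices are distinct, so four moments of the process suffice for
four moments of the product.\<close>

lemma lagged_moment4:
  assumes g: "degenerate_kernel b g" and st: "s < t - j" and j: "j \<ge> 1"
  shows "quart_integrable (\<lambda>\<omega>. lagged g t s j (path \<omega>))"
    and "(\<integral>\<omega>. (lagged g t s j (path \<omega>)) ^ 4 \<partial>M) \<le> (b ^ 4 * m4\<^sup>2)\<^sup>2"
proof -
  let ?I = "{t, s, t - j, s - j}"
  define N where "N \<omega> = (\<Prod>i\<in>?I. norm (u i \<omega>) ^ 4)" for \<omega>
  have bd: "(lagged g t s j (path \<omega>)) ^ 4 \<le> b ^ 8 * N \<omega>" for \<omega>
  proof -
    have "\<bar>g (path \<omega> t) (path \<omega> s)\<bar> * \<bar>g (path \<omega> (t - j)) (path \<omega> (s - j))\<bar> \<le>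
       (b * norm (path \<omega> t) * norm (path \<omega> s)) * (b * norm (path \<omega> (t - j)) * norm (path \<omega> (s - j)))"
      using g by (intro mult_mono) (auto simp: degenerate_kernel_def)
    then have "\<bar>lagged g t s j (path \<omega>)\<bar> ^ 4 \<le> ((b * norm (path \<omega> t) * norm (path \<omega> s)) * (b * norm (path \<omega> (t - j)) * norm (path \<omega> (s - j)))) ^ 4"
      unfolding lagged_def abs_mult by (intro power_mono) auto
    also have "\<dots> = b ^ 8 * N \<omega>"
      using st j by (simp add: N_def path_def power_mult_distrib mult_ac flip: power_add)
    finally show ?thesis by (simp add: power_even_abs)
  qed
  have int: "integrable M N" and "(\<integral>\<omega>. N \<omega> \<partial>M) = (\<Prod>i\<in>?I. m4)"
    unfolding N_def using fourth_moment product_moment[of ?I "\<lambda>i x. norm x ^ 4"] by (auto simp: moment4)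
  then have eN: "(\<integral>\<omega>. N \<omega> \<partial>M) = m4 ^ 4" using st j by (simp add: power4_eq_xxxx mult_ac)
  have [measurable]: "(\<lambda>\<omega>. lagged g t s j (path \<omega>)) \<in> borel_measurable M" using g by measurable
  have int1: "integrable M (\<lambda>\<omega>. b ^ 8 * N \<omega>)" using int by simp
  then have int2: "integrable M (\<lambda>\<omega>. (lagged g t s j (path \<omega>)) ^ 4)"
    by (rule Bochner_Integration.integrable_bound) (use bd in \<open>auto intro: order_trans[OF _ abs_ge_self]\<close>)
  then show "quart_integrable (\<lambda>\<omega>. lagged g t s j (path \<omega>))" by (simp add: quart_integrable_def)
  have "(\<integral>\<omega>. (lagged g t s j (path \<omega>)) ^ 4 \<partial>M) \<le> (\<integral>\<omega>. b ^ 8 * N \<omega> \<partial>M)"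
    using int1 int2 bd by (intro integral_mono) auto
  also have "\<dots> = (b ^ 4 * m4\<^sup>2)\<^sup>2" using eN by (simp add: power_mult_distrib flip: power_mult)
  finally show "(\<integral>\<omega>. (lagged g t s j (path \<omega>)) ^ 4 \<partial>M) \<le> (b ^ 4 * m4\<^sup>2)\<^sup>2" .
qed

text \<open>If the largest indices \<open>t\<close>, \<open>t'\<close> or the smallest ones \<open>s - j\<close>, \<open>s' - j'\<close> differ, the extreme one is isolated.
Otherwise the two middle pairs \<open>{s, t - j}\<close> and \<open>{s', t' - j'}\<close> have the same sum, and they either agree as sets,
which is excluded by the hypotheses, or one of them contains an isolated index.\<close>

lemma lagged_orthogonal:
  assumes g: "degenerate_kernel b g" and *: "s < t" "j \<ge> 1" "s' < t'" "j' \<ge> 1"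
    and ne: "(t', s', j') \<noteq> (t, s, j)" "(t', s', j') \<noteq> (t, t - j, t - s)"
  shows "(\<integral>\<omega>. lagged g t s j (path \<omega>) * lagged g t' s' j' (path \<omega>) \<partial>M) = 0"
proof -
  have mm: "lagged g a b' c \<in> borel_measurable paths" for a b' c using g by measurable
  have iso1: ?thesis if "r \<notin> {t', s', t' - j', s' - j'}"
     "r = t \<and> r \<notin> {s, t - j, s - j} \<or> r = s \<and> r \<notin> {t, t - j, s - j} \<or>
      r = t - j \<and> r \<notin> {t, s, s - j} \<or> r = s - j \<and> r \<notin> {t, s, t - j}" for r
    using lagged_isolated_zero[OF g mm lagged_upd[OF that(1)] that(2)] by simp
  have iso2: ?thesis if "r \<notin> {t, s, t - j, s - j}"
     "r = t' \<and> r \<notin> {s', t' - j', s' - j'} \<or> r = s' \<and> r \<notin> {t', t' - j', s' - j'} \<or>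
      r = t' - j' \<and> r \<notin> {t', s', s' - j'} \<or> r = s' - j' \<and> r \<notin> {t', s', t' - j'}" for r
    using lagged_isolated_zero[OF g mm lagged_upd[OF that(1)] that(2)] by (simp add: mult.commute)
  consider "t' < t" | "t < t'" | "t' = t" "s - j < s' - j'" | "t' = t" "s' - j' < s - j"
    | "t' = t" "s' - j' = s - j" by linarith
  then show ?thesis
  proof cases
    case 1 then show ?thesis using * by (intro iso1[of t]) auto
  next
    case 2 then show ?thesis using * by (intro iso2[of t']) auto
  next
    case 3 then show ?thesis using * by (intro iso1[of "s - j"]) auto
  next
    case 4 then show ?thesis using * by (intro iso2[of "s' - j'"]) auto
  next
    case 5
    have "s' \<noteq> s" "s' \<noteq> t - j" using ne 5 by auto
    show ?thesis
    proof (cases "s = t' - j'")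
      case True then show ?thesis using * 5 \<open>s' \<noteq> s\<close> \<open>s' \<noteq> t - j\<close> by (intro iso2[of s']) auto
    next
      case False
      show ?thesis
      proof (cases "s' = t' - j'")
        case True
        then show ?thesis using * 5 \<open>s' \<noteq> s\<close> \<open>s' \<noteq> t - j\<close> False by (intro iso1[of s]) auto
      next
        case False
        then show ?thesis using * 5 \<open>s' \<noteq> s\<close> \<open>s' \<noteq> t - j\<close> by (intro iso2[of s']) auto
      qed
    qed
  qed
qed

text \<open>Each product is correlated with at most one other, its image under the involution
\<open>(t, s, j) \<mapsto> (t, t - j, t - s)\<close>.\<close>

lemma lagged_sum_variance:
  assumes g: "degenerate_kernel b g" and fin: "finite I"
    and I: "\<And>t s j. (t, s, j) \<in> I \<Longrightarrow> s < t \<and> j \<ge> 1"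
  shows "sq_integrable (\<lambda>\<omega>. \<Sum>(t, s, j)\<in>I. a (t, s, j) * lagged g t s j (path \<omega>))"
    and "(\<integral>\<omega>. (\<Sum>(t, s, j)\<in>I. a (t, s, j) * lagged g t s j (path \<omega>))\<^sup>2 \<partial>M) \<le>
       2 * (b ^ 4 * m4\<^sup>2) * (\<Sum>i\<in>I. (a i)\<^sup>2)"
proof -
  define X where "X = (\<lambda>(t, s, j) \<omega>. a (t, s, j) * lagged g t s j (path \<omega>))"
  define R where "R i l \<longleftrightarrow> l = i \<or> l = (case i of (t, s, j) \<Rightarrow> (t, t - j, t - s))" for i l :: "int \<times> int \<times> int"
  have sq: "sq_integrable (X i)" if "i \<in> I" for i
    using I that lagged_moment2(1)[OF g] by (cases i) (auto simp: X_def intro!: sq_integrable_cmult)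
  have X: "(\<Sum>(t, s, j)\<in>I. a (t, s, j) * lagged g t s j (path \<omega>)) = (\<Sum>i\<in>I. X i \<omega>)" for \<omega>
    by (simp add: X_def split_def)
  show "sq_integrable (\<lambda>\<omega>. \<Sum>(t, s, j)\<in>I. a (t, s, j) * lagged g t s j (path \<omega>))"
    unfolding X using sq by (rule sq_integrable_sum)
  have "expectation (\<lambda>\<omega>. (\<Sum>i\<in>I. X i \<omega>)\<^sup>2) \<le> real 2 * (\<Sum>i\<in>I. expectation (\<lambda>\<omega>. (X i \<omega>)\<^sup>2))"
  proof (rule second_moment_sum_le[OF fin sq, where R = R])
    fix i l show "R i l \<longleftrightarrow> R l i" by (cases i; cases l) (auto simp: R_def)
  next
    fix i l assume il: "i \<in> I" "l \<in> I" "\<not> R i l"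
    obtain t s j t' s' j' where eq: "i = (t, s, j)" "l = (t', s', j')" by (cases i; cases l)
    have "(\<integral>\<omega>. lagged g t s j (path \<omega>) * lagged g t' s' j' (path \<omega>) \<partial>M) = 0"
      using I il unfolding eq R_def by (intro lagged_orthogonal[OF g]) auto
    moreover have "X i \<omega> * X l \<omega> = (a i * a l) * (lagged g t s j (path \<omega>) * lagged g t' s' j' (path \<omega>))" for \<omega>
      by (simp add: X_def eq)
    ultimately show "expectation (\<lambda>\<omega>. X i \<omega> * X l \<omega>) = 0" by simp
  next
    fix i
    have "card {l \<in> I. R i l} \<le> card {i, (case i of (t, s, j) \<Rightarrow> (t, t - j, t - s))}"
      by (intro card_mono) (auto simp: R_def)
    also have "\<dots> \<le> 2" by (simp add: card_insert_if)
    finally show "card {l \<in> I. R i l} \<le> 2" .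
  qed
  also have "(\<Sum>i\<in>I. expectation (\<lambda>\<omega>. (X i \<omega>)\<^sup>2)) \<le> (\<Sum>i\<in>I. (b ^ 4 * m4\<^sup>2) * (a i)\<^sup>2)"
  proof (rule sum_mono)
    fix i assume "i \<in> I"
    obtain t s j where i: "i = (t, s, j)" by (cases i)
    have "(\<integral>\<omega>. (lagged g t s j (path \<omega>))\<^sup>2 \<partial>M) \<le> b ^ 4 * m4\<^sup>2"
      using I \<open>i \<in> I\<close> unfolding i by (intro lagged_moment2[OF g]) auto
    then show "expectation (\<lambda>\<omega>. (X i \<omega>)\<^sup>2) \<le> (b ^ 4 * m4\<^sup>2) * (a i)\<^sup>2"
      by (simp add: X_def i power_mult_distrib mult.commute mult_left_mono)
  qed
  finally show "(\<integral>\<omega>. (\<Sum>(t, s, j)\<in>I. a (t, s, j) * lagged g t s j (path \<omega>))\<^sup>2 \<partial>M) \<le>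
       2 * (b ^ 4 * m4\<^sup>2) * (\<Sum>i\<in>I. (a i)\<^sup>2)"
    unfolding X by (simp add: sum_distrib_left mult_ac)
qed

section \<open>The diagonal\<close>

text \<open>The summands at \<open>s\<close> and \<open>s'\<close> share a variable only if \<open>s'\<close> is one of \<open>s\<close>, \<open>s - j\<close>, \<open>s + j\<close>.\<close>

lemma diagonal_variance:
  fixes f :: "'h \<Rightarrow> real"
  assumes f [measurable]: "f \<in> borel_measurable borel" and bd: "\<And>x. \<bar>f x\<bar> \<le> b * (norm x)\<^sup>2" and b: "b \<ge> 0"
    and j: "j \<ge> 1" and fin: "finite S" and \<mu>: "(\<integral>\<omega>. f (u 0 \<omega>) \<partial>M) = \<mu>"
  shows "sq_integrable (\<lambda>\<omega>. \<Sum>s\<in>S. (f (u s \<omega>) * f (u (s - j) \<omega>) - \<mu>\<^sup>2))"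
    and "(\<integral>\<omega>. (\<Sum>s\<in>S. (f (u s \<omega>) * f (u (s - j) \<omega>) - \<mu>\<^sup>2))\<^sup>2 \<partial>M) \<le> 3 * real (card S) * (b ^ 4 * m4\<^sup>2)"
proof -
  have fsq: "sq_integrable (\<lambda>\<omega>. f (u i \<omega>)) \<and> (\<integral>\<omega>. (f (u i \<omega>))\<^sup>2 \<partial>M) \<le> b\<^sup>2 * m4" for i
  proof -
    have le: "(f (u i \<omega>))\<^sup>2 \<le> b\<^sup>2 * norm (u i \<omega>) ^ 4" for \<omega>
      using power_mono[OF bd[of "u i \<omega>"], of 2] by (simp add: power_mult_distrib flip: power_mult)
    have int1: "integrable M (\<lambda>\<omega>. b\<^sup>2 * norm (u i \<omega>) ^ 4)" using fourth_moment by simp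
    then have int: "integrable M (\<lambda>\<omega>. (f (u i \<omega>))\<^sup>2)"
      by (rule Bochner_Integration.integrable_bound) (use le in \<open>auto intro: order_trans[OF _ abs_ge_self]\<close>)
    have "(\<integral>\<omega>. (f (u i \<omega>))\<^sup>2 \<partial>M) \<le> (\<integral>\<omega>. b\<^sup>2 * norm (u i \<omega>) ^ 4 \<partial>M)"
      using int1 int le by (intro integral_mono) auto
    then show ?thesis using int by (simp add: sq_integrable_def moment4)
  qed
  have f1: "integrable M (\<lambda>\<omega>. f (u i \<omega>))" for i using fsq sq_integrable_integrable by blast
  have mu: "(\<integral>\<omega>. f (u i \<omega>) \<partial>M) = \<mu>" for i using expectation_u[OF f, of i] \<mu> by simp
  define X where "X s \<omega> = f (u s \<omega>) * f (u (s - j) \<omega>) - \<mu>\<^sup>2" for s \<omega>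
  define Y where "Y s \<omega> = f (u s \<omega>) * f (u (s - j) \<omega>)" for s \<omega>
  have prod2: "integrable M (\<lambda>\<omega>. h (u r \<omega>) * h (u s \<omega>))" 
     "(\<integral>\<omega>. h (u r \<omega>) * h (u s \<omega>) \<partial>M) = (\<integral>\<omega>. h (u r \<omega>) \<partial>M) * (\<integral>\<omega>. h (u s \<omega>) \<partial>M)"
    if "r \<noteq> s" "h \<in> borel_measurable borel" "\<And>i. integrable M (\<lambda>\<omega>. h (u i \<omega>))" for h :: "'h \<Rightarrow> real" and r s
    using product_moment[of "{r, s}" "\<lambda>_. h"] that by auto
  have Y2: "(Y s \<omega>)\<^sup>2 = (f (u s \<omega>))\<^sup>2 * (f (u (s - j) \<omega>))\<^sup>2" for s \<omega> by (simp add: Y_def power_mult_distrib)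
  have fsq': "integrable M (\<lambda>\<omega>. (f (u i \<omega>))\<^sup>2)" for i using fsq by (auto simp: sq_integrable_def)
  have [measurable]: "Y s \<in> borel_measurable M" for s unfolding Y_def[abs_def] by measurable
  have sqY: "sq_integrable (Y s)" for s
    unfolding sq_integrable_def Y2 using prod2(1)[of s "s - j" "\<lambda>x. (f x)\<^sup>2"] j fsq'
    by auto
  have EY: "expectation (Y s) = \<mu>\<^sup>2" for s
    unfolding Y_def using prod2(2)[of s "s - j" f] j f1 by (simp add: mu power2_eq_square)
  have sqX: "sq_integrable (X s)" for s
    using sq_integrable_diff[OF sqY[of s] sq_integrable_const[of "\<mu>\<^sup>2"]] by (simp add: X_def[abs_def] Y_def)
  show "sq_integrable (\<lambda>\<omega>. \<Sum>s\<in>S. (f (u s \<omega>) * f (u (s - j) \<omega>) - \<mu>\<^sup>2))"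
    using sq_integrable_sum[of S X] sqX by (simp add: X_def)
  have "expectation (\<lambda>\<omega>. (\<Sum>s\<in>S. X s \<omega>)\<^sup>2) \<le> real 3 * (\<Sum>s\<in>S. expectation (\<lambda>\<omega>. (X s \<omega>)\<^sup>2))"
  proof (rule second_moment_sum_le[OF fin sqX, where R = "\<lambda>s s'. s' \<in> {s, s - j, s + j}"])
    fix s s' assume "s' \<notin> {s, s - j, s + j}"
    then have n: "s \<noteq> s'" "s \<noteq> s' - j" "s - j \<noteq> s'" "s - j \<noteq> s' - j" "s \<noteq> s - j" "s' \<noteq> s' - j" using j by auto
    have "expectation (\<lambda>\<omega>. Y s \<omega> * Y s' \<omega>) = expectation (\<lambda>\<omega>. \<Prod>i\<in>{s, s - j, s', s' - j}. f (u i \<omega>))"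
      using n by (simp add: Y_def mult.assoc)
    also have "\<dots> = \<mu>\<^sup>2 * \<mu>\<^sup>2"
      using n f1 by (subst product_moment(2)) (auto simp: mu power2_eq_square)
    finally have "expectation (\<lambda>\<omega>. Y s \<omega> * Y s' \<omega>) = \<mu>\<^sup>2 * \<mu>\<^sup>2" .
    moreover have "X s \<omega> * X s' \<omega> = Y s \<omega> * Y s' \<omega> - \<mu>\<^sup>2 * Y s \<omega> - \<mu>\<^sup>2 * Y s' \<omega> + \<mu>\<^sup>2 * \<mu>\<^sup>2" for \<omega>
      by (simp add: X_def Y_def algebra_simps)
    ultimately show "expectation (\<lambda>\<omega>. X s \<omega> * X s' \<omega>) = 0"
      using sq_integrable_mult[OF sqY[of s] sqY[of s']] sq_integrable_integrable[OF sqY] EY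
      by (simp add: prob_space)
  next
    fix s
    have "card {l \<in> S. l \<in> {s, s - j, s + j}} \<le> card {s, s - j, s + j}" by (intro card_mono) auto
    also have "\<dots> \<le> 3" by (simp add: card_insert_if)
    finally show "card {l \<in> S. l \<in> {s, s - j, s + j}} \<le> 3" .
  qed auto
  also have "(\<Sum>s\<in>S. expectation (\<lambda>\<omega>. (X s \<omega>)\<^sup>2)) \<le> (\<Sum>s\<in>S. b ^ 4 * m4\<^sup>2)"
  proof (rule sum_mono)
    fix s
    have "(X s \<omega>)\<^sup>2 = (Y s \<omega>)\<^sup>2 - 2 * \<mu>\<^sup>2 * Y s \<omega> + \<mu>\<^sup>2 * \<mu>\<^sup>2" for \<omega>
      by (simp add: X_def Y_def power2_eq_square algebra_simps)
    then have "expectation (\<lambda>\<omega>. (X s \<omega>)\<^sup>2) = expectation (\<lambda>\<omega>. (Y s \<omega>)\<^sup>2) - \<mu>\<^sup>2 * \<mu>\<^sup>2"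
      using sqY[of s] sq_integrable_integrable[OF sqY[of s]] EY[of s] by (simp add: sq_integrable_def prob_space)
    also have "\<dots> \<le> expectation (\<lambda>\<omega>. (Y s \<omega>)\<^sup>2)" by simp
    also have "\<dots> = expectation (\<lambda>\<omega>. (f (u s \<omega>))\<^sup>2) * expectation (\<lambda>\<omega>. (f (u (s - j) \<omega>))\<^sup>2)"
      unfolding Y2 using prod2(2)[of s "s - j" "\<lambda>x. (f x)\<^sup>2"] j fsq' by simp
    also have "\<dots> \<le> (b\<^sup>2 * m4) * (b\<^sup>2 * m4)" using fsq m4_nonneg by (intro mult_mono) auto
    also have "\<dots> = b ^ 4 * m4\<^sup>2" by (simp add: power2_eq_square power4_eq_xxxx mult_ac)
    finally show "expectation (\<lambda>\<omega>. (X s \<omega>)\<^sup>2) \<le> b ^ 4 * m4\<^sup>2" .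
  qed
  finally show "(\<integral>\<omega>. (\<Sum>s\<in>S. (f (u s \<omega>) * f (u (s - j) \<omega>) - \<mu>\<^sup>2))\<^sup>2 \<partial>M) \<le> 3 * real (card S) * (b ^ 4 * m4\<^sup>2)"
    by (simp add: X_def)
qed

section \<open>Martingale increments\<close>

text \<open>The squared Hilbert--Schmidt norm of the covariance operator: \<open>kappa = E \<langle>C u, u\<rangle> = tr C\<^sup>2\<close>.\<close>

definition kappa :: real where "kappa = (\<integral>\<omega>. cov (u 0 \<omega>) (u 0 \<omega>) \<partial>M)"

text \<open>A time that is larger or smaller than the three others is isolated, through \<open>u\<^sub>s\<close> in the first case and
through \<open>u\<^sub>s\<^sub>-\<^sub>j\<close> in the second. If \<open>a\<close> differs from \<open>b\<close>, \<open>c\<close>, \<open>d\<close>, one of the four times is such an extreme: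
either \<open>a\<close> itself, or the single one on one side of \<open>a\<close>.\<close>

lemma lagged_row_fourth_moment:
  assumes g: "degenerate_kernel b g" and j: "j \<ge> 1" and fin: "finite S" and S: "\<And>s. s \<in> S \<Longrightarrow> s < t - j"
  shows "quart_integrable (\<lambda>\<omega>. \<Sum>s\<in>S. lagged g t s j (path \<omega>))"
    and "(\<integral>\<omega>. (\<Sum>s\<in>S. lagged g t s j (path \<omega>)) ^ 4 \<partial>M) \<le> 3 * (real (card S))\<^sup>2 * (b ^ 4 * m4\<^sup>2)\<^sup>2"
proof -
  let ?X = "\<lambda>s \<omega>. lagged g t s j (path \<omega>)"
  have q: "quart_integrable (?X s)" if "s \<in> S" for s using lagged_moment4(1)[OF g S[OF that] j] .
  show "quart_integrable (\<lambda>\<omega>. \<Sum>s\<in>S. ?X s \<omega>)" using q by (rule quart_integrable_sum)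
  have mm [measurable]: "lagged g a b' c \<in> borel_measurable paths" for a b' c using g by measurable
  have ext: "expectation (\<lambda>\<omega>. ?X a \<omega> * ?X b \<omega> * ?X c \<omega> * ?X d \<omega>) = 0"
    if "a \<in> S" "b \<in> S" "c \<in> S" "d \<in> S" "(b < a \<and> c < a \<and> d < a) \<or> (a < b \<and> a < c \<and> a < d)" for a b c d
  proof -
    define r where "r = (if b < a then a else a - j)"
    have r: "r \<notin> {t, i, t - j, i - j}" if "i \<in> {b, c, d}" for i
      using that \<open>_ \<or> _\<close> S[of a] S[of i] \<open>a \<in> S\<close> \<open>b \<in> S\<close> \<open>c \<in> S\<close> \<open>d \<in> S\<close> j by (auto simp: r_def)
    have "(\<integral>\<omega>. lagged g t a j (path \<omega>) *\<^sub>R (lagged g t b j (path \<omega>) * lagged g t c j (path \<omega>) * lagged g t d j (path \<omega>)) \<partial>M) = 0"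
    proof (rule lagged_isolated_zero[OF g, where r = r])
      show "r = t \<and> r \<notin> {a, t - j, a - j} \<or> r = a \<and> r \<notin> {t, t - j, a - j} \<or>
        r = t - j \<and> r \<notin> {t, a, a - j} \<or> r = a - j \<and> r \<notin> {t, a, t - j}"
        using S[OF \<open>a \<in> S\<close>] j by (auto simp: r_def)
    next
      fix v x
      have "lagged g t i j (v(r := x)) = lagged g t i j v" if "i \<in> {b, c, d}" for i
        using lagged_upd[OF r[OF that]] .
      then show "lagged g t b j (v(r := x)) * lagged g t c j (v(r := x)) * lagged g t d j (v(r := x)) =
        lagged g t b j v * lagged g t c j v * lagged g t d j v" by simp
    qed measurable
    then show ?thesis by (simp add: mult.assoc)
  qed
  have zero: "expectation (\<lambda>\<omega>. ?X a \<omega> * ?X b \<omega> * ?X c \<omega> * ?X d \<omega>) = 0"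
    if I: "a \<in> S" "b \<in> S" "c \<in> S" "d \<in> S" and ne: "a \<notin> {b, c, d}" for a b c d
  proof -
    have perm: "expectation (\<lambda>\<omega>. ?X a \<omega> * ?X b \<omega> * ?X c \<omega> * ?X d \<omega>) = expectation (\<lambda>\<omega>. ?X b \<omega> * ?X a \<omega> * ?X c \<omega> * ?X d \<omega>)"
      "expectation (\<lambda>\<omega>. ?X a \<omega> * ?X b \<omega> * ?X c \<omega> * ?X d \<omega>) = expectation (\<lambda>\<omega>. ?X c \<omega> * ?X a \<omega> * ?X b \<omega> * ?X d \<omega>)"
      "expectation (\<lambda>\<omega>. ?X a \<omega> * ?X b \<omega> * ?X c \<omega> * ?X d \<omega>) = expectation (\<lambda>\<omega>. ?X d \<omega> * ?X a \<omega> * ?X b \<omega> * ?X c \<omega>)"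
      by (simp_all add: mult_ac)
    have "b < a \<or> a < b" "c < a \<or> a < c" "d < a \<or> a < d" using ne by auto
    then consider "(b < a \<and> c < a \<and> d < a) \<or> (a < b \<and> a < c \<and> a < d)"
      | "(a < b \<and> c < b \<and> d < b) \<or> (b < a \<and> b < c \<and> b < d)"
      | "(a < c \<and> b < c \<and> d < c) \<or> (c < a \<and> c < b \<and> c < d)"
      | "(a < d \<and> b < d \<and> c < d) \<or> (d < a \<and> d < b \<and> d < c)"
      by (elim disjE) (meson order.strict_trans)+
    then show ?thesis
    proof cases
      case 1 then show ?thesis using I by (intro ext) auto
    next
      case 2 then show ?thesis using I unfolding perm(1) by (intro ext) auto
    next
      case 3 then show ?thesis using I unfolding perm(2) by (intro ext) auto
    next
      case 4 then show ?thesis using I unfolding perm(3) by (intro ext) auto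
    qed
  qed
  have "expectation (\<lambda>\<omega>. (\<Sum>s\<in>S. ?X s \<omega>) ^ 4) \<le> 3 * (\<Sum>s\<in>S. b ^ 4 * m4\<^sup>2)\<^sup>2"
    using q by (intro fourth_moment_sum_le fin zero) (auto intro: lagged_moment4(2)[OF g S j])
  then show "(\<integral>\<omega>. (\<Sum>s\<in>S. lagged g t s j (path \<omega>)) ^ 4 \<partial>M) \<le> 3 * (real (card S))\<^sup>2 * (b ^ 4 * m4\<^sup>2)\<^sup>2"
    by (simp add: power_mult_distrib mult_ac)
qed

text \<open>The martingale difference \<open>\<Sum>\<^sub>j w\<^sub>j \<langle>u\<^sub>t, S\<^sub>j u\<^sub>t\<^sub>-\<^sub>j\<rangle>\<close>. The range of \<open>s\<close> leaves a gap of length \<open>q\<close> below \<open>t\<close>, so that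
every \<open>t - j\<close> exceeds every \<open>s\<close>. It also excludes \<open>s \<le> q\<close>, which makes the range independent of \<open>j\<close>.\<close>

definition increment :: "(int \<Rightarrow> real) \<Rightarrow> int \<Rightarrow> int \<Rightarrow> (int \<Rightarrow> 'h) \<Rightarrow> real" where
  "increment w q t v = (\<Sum>j\<in>{1..q}. \<Sum>s\<in>{q + 1..t - q - 1}. w j * lagged (\<bullet>) t s j v)"

lemma lagged_inner_measurable [measurable]: "lagged (\<bullet>) t s j \<in> borel_measurable paths"
  by (rule lagged_measurable[OF inner_degenerate])

lemma lagged_cov_measurable [measurable]: "lagged cov t s j \<in> borel_measurable paths"
  by (rule lagged_measurable[OF cov_degenerate])

lemma increment_measurable [measurable]: "increment w q t \<in> borel_measurable paths"
  unfolding increment_def by measurable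

lemma increment_upd: "r > t \<Longrightarrow> increment w q t (v(r := x)) = increment w q t v"
  unfolding increment_def by (intro sum.cong refl) (auto simp: lagged_upd)

text \<open>\<open>fourth_moment_sum_le\<close> is used twice: over the times \<open>s\<close> for a fixed lag, and over the lags, where a
lag \<open>a\<close> that occurs only once isolates the index \<open>t - a\<close>, which lies in the gap.\<close>

lemma increment_fourth_moment:
  shows "quart_integrable (\<lambda>\<omega>. increment w q t (path \<omega>))"
    and "(\<integral>\<omega>. (increment w q t (path \<omega>)) ^ 4 \<partial>M) \<le> 9 * m4 ^ 4 * (real (nat t) * (\<Sum>j\<in>{1..q}. (w j)\<^sup>2))\<^sup>2"
proof -
  let ?S = "{q + 1..t - q - 1}"
  define X where "X j \<omega> = w j * (\<Sum>s\<in>?S. lagged (\<bullet>) t s j (path \<omega>))" for j \<omega>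
  have inc: "increment w q t (path \<omega>) = (\<Sum>j\<in>{1..q}. X j \<omega>)" for \<omega>
    by (simp add: increment_def X_def sum_distrib_left)
  have q: "quart_integrable (X j)" if "j \<in> {1..q}" for j
    unfolding X_def using that by (intro quart_integrable_cmult lagged_row_fourth_moment[OF inner_degenerate]) auto
  show "quart_integrable (\<lambda>\<omega>. increment w q t (path \<omega>))"
    unfolding inc using q by (rule quart_integrable_sum)
  have "expectation (\<lambda>\<omega>. (\<Sum>j\<in>{1..q}. X j \<omega>) ^ 4) \<le> 3 * (\<Sum>j\<in>{1..q}. (w j)\<^sup>2 * (sqrt 3 * real (nat t) * m4\<^sup>2))\<^sup>2"
  proof (rule fourth_moment_sum_le)
    fix a b c d assume I: "a \<in> {1..q}" "b \<in> {1..q}" "c \<in> {1..q}" "d \<in> {1..q}" and ne: "a \<notin> {b, c, d}"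
    define H where "H v = (\<Prod>i\<in>{0,1,2::nat}. (\<Sum>s\<in>?S. lagged (\<bullet>) t s ([b,c,d] ! i) v))" for v
    have H [measurable]: "H \<in> borel_measurable paths" unfolding H_def by measurable
    have z: "expectation (\<lambda>\<omega>. lagged (\<bullet>) t s a (path \<omega>) *\<^sub>R H (path \<omega>)) = 0" if "s \<in> ?S" for s
    proof (rule lagged_isolated_zero[OF inner_degenerate H, where r = "t - a"])
      fix v x
      have "(\<Sum>s\<in>?S. lagged (\<bullet>) t s i (v(t - a := x))) = (\<Sum>s\<in>?S. lagged (\<bullet>) t s i v)" if "i \<in> {b, c, d}" for i
        using that I ne by (intro sum.cong refl lagged_upd) auto
      then show "H (v(t - a := x)) = H v" unfolding H_def by simp
    qed (use that I in auto)
    have eq: "X a \<omega> * X b \<omega> * X c \<omega> * X d \<omega> =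
       (w a * w b * w c * w d) * (\<Sum>s\<in>?S. lagged (\<bullet>) t s a (path \<omega>) *\<^sub>R H (path \<omega>))" for \<omega>
      by (simp add: X_def H_def sum_distrib_right[symmetric] mult_ac)
    have int: "integrable M (\<lambda>\<omega>. lagged (\<bullet>) t s a (path \<omega>) *\<^sub>R H (path \<omega>))" if "s \<in> ?S" for s
    proof -
      have "integrable M (\<lambda>\<omega>. lagged (\<bullet>) t s a (path \<omega>) * (\<Sum>s\<in>?S. lagged (\<bullet>) t s b (path \<omega>)) *
          (\<Sum>s\<in>?S. lagged (\<bullet>) t s c (path \<omega>)) * (\<Sum>s\<in>?S. lagged (\<bullet>) t s d (path \<omega>)))"
        using that I by (intro quart_integrable_mult4 lagged_row_fourth_moment[OF inner_degenerate]
            lagged_moment4[OF inner_degenerate]) auto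
      then show ?thesis by (simp add: H_def mult_ac)
    qed
    show "expectation (\<lambda>\<omega>. X a \<omega> * X b \<omega> * X c \<omega> * X d \<omega>) = 0"
      unfolding eq using int z by simp
  next
    fix j assume j: "j \<in> {1..q}"
    have "real (card ?S) \<le> real (nat t)" using j by (auto intro: nat_mono)
    then have c: "(real (card ?S))\<^sup>2 \<le> (real (nat t))\<^sup>2" by (intro power_mono) auto
    have "expectation (\<lambda>\<omega>. (\<Sum>s\<in>?S. lagged (\<bullet>) t s j (path \<omega>)) ^ 4) \<le> 3 * (real (card ?S))\<^sup>2 * (m4\<^sup>2)\<^sup>2"
      using lagged_row_fourth_moment(2)[OF inner_degenerate, of j ?S t] j by simp
    also have "\<dots> \<le> 3 * (real (nat t))\<^sup>2 * (m4\<^sup>2)\<^sup>2" using c by (intro mult_right_mono mult_left_mono) auto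
    finally have "(w j) ^ 4 * expectation (\<lambda>\<omega>. (\<Sum>s\<in>?S. lagged (\<bullet>) t s j (path \<omega>)) ^ 4) \<le>
        (w j) ^ 4 * (3 * (real (nat t))\<^sup>2 * (m4\<^sup>2)\<^sup>2)" by (intro mult_left_mono) auto
    then show "expectation (\<lambda>\<omega>. X j \<omega> ^ 4) \<le> ((w j)\<^sup>2 * (sqrt 3 * real (nat t) * m4\<^sup>2))\<^sup>2"
      by (simp add: X_def power_mult_distrib flip: power_mult)
  qed (use q in auto)
  also have "\<dots> = 9 * m4 ^ 4 * (real (nat t) * (\<Sum>j\<in>{1..q}. (w j)\<^sup>2))\<^sup>2"
    by (simp add: sum_distrib_right[symmetric] power_mult_distrib flip: power_mult)
  finally show "(\<integral>\<omega>. (increment w q t (path \<omega>)) ^ 4 \<partial>M) \<le> 9 * m4 ^ 4 * (real (nat t) * (\<Sum>j\<in>{1..q}. (w j)\<^sup>2))\<^sup>2"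
    unfolding inc .
qed

text \<open>The increment is linear in \<open>u\<^sub>t\<close>, on which \<open>h\<close> does not depend.\<close>

lemma increment_martingale:
  fixes h :: "(int \<Rightarrow> 'h) \<Rightarrow> complex"
  assumes h [measurable]: "h \<in> borel_measurable paths" and hb: "\<And>v. norm (h v) \<le> 1"
    and h_upd: "\<And>v x. h (v(t := x)) = h v"
  shows "(\<integral>\<omega>. of_real (increment w q t (path \<omega>)) * h (path \<omega>) \<partial>M) = 0"
proof -
  have int: "integrable M (\<lambda>\<omega>. lagged (\<bullet>) t s j (path \<omega>) *\<^sub>R h (path \<omega>))"
    if "j \<in> {1..q}" "s \<in> {q+1..t-q-1}" for j s
  proof (rule Bochner_Integration.integrable_bound)
    show "integrable M (\<lambda>\<omega>. lagged (\<bullet>) t s j (path \<omega>))"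
      using that by (intro sq_integrable_integrable lagged_moment2[OF inner_degenerate]) auto
    show "AE \<omega> in M. norm (lagged (\<bullet>) t s j (path \<omega>) *\<^sub>R h (path \<omega>)) \<le> norm (lagged (\<bullet>) t s j (path \<omega>))"
      using hb by (auto intro!: mult_left_le)
  qed measurable
  define F where "F j s \<omega> = lagged (\<bullet>) t s j (path \<omega>) *\<^sub>R h (path \<omega>)" for j s \<omega>
  have "of_real (increment w q t (path \<omega>)) * h (path \<omega>) =
      (\<Sum>j\<in>{1..q}. \<Sum>s\<in>{q+1..t-q-1}. w j *\<^sub>R F j s \<omega>)" for \<omega>
    by (simp add: increment_def F_def sum_distrib_right scaleR_conv_of_real mult.assoc)
  moreover have "(\<integral>\<omega>. F j s \<omega> \<partial>M) = 0" if "j \<in> {1..q}" "s \<in> {q+1..t-q-1}" for j s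
    unfolding F_def using that by (intro lagged_isolated_zero[OF inner_degenerate h h_upd]) auto
  moreover have "(\<integral>\<omega>. (\<Sum>j\<in>J. \<Sum>s\<in>S. w j *\<^sub>R F j s \<omega>) \<partial>M) = (\<Sum>j\<in>J. \<Sum>s\<in>S. w j *\<^sub>R (\<integral>\<omega>. F j s \<omega> \<partial>M))"
    if "\<And>j s. j \<in> J \<Longrightarrow> s \<in> S \<Longrightarrow> integrable M (F j s)" for J S
    using that by simp
  ultimately show ?thesis using int unfolding F_def[symmetric] by (simp del: atLeastAtMost_iff)
qed

end

section \<open>The conditional variance of an increment\<close>

lemma sum_Sigma_Times:
  assumes "finite A" "\<And>a. a \<in> A \<Longrightarrow> finite (B a)" "finite C"
  shows "(\<Sum>i\<in>(SIGMA a:A. B a \<times> C). f i) = (\<Sum>a\<in>A. \<Sum>b\<in>B a. \<Sum>c\<in>C. f (a, b, c))"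
proof -
  have "(\<Sum>a\<in>A. \<Sum>b\<in>B a. \<Sum>c\<in>C. f (a, b, c)) = (\<Sum>a\<in>A. \<Sum>i\<in>B a \<times> C. f (a, i))"
    by (simp add: sum.cartesian_product split_def)
  also have "\<dots> = (\<Sum>i\<in>(SIGMA a:A. B a \<times> C). f i)"
    using assms by (subst sum.Sigma) auto
  finally show ?thesis by simp
qed

lemma sum_symmetric_split:
  fixes g :: "int \<Rightarrow> int \<Rightarrow> real"
  assumes "finite S" "\<And>s r. g s r = g r s"
  shows "(\<Sum>s\<in>S. \<Sum>r\<in>S. g s r) = (\<Sum>s\<in>S. g s s) + 2 * (\<Sum>s\<in>S. \<Sum>r\<in>{r\<in>S. r < s}. g s r)"
proof -
  have 1: "(\<Sum>r\<in>S. g s r) = g s s + (\<Sum>r\<in>S. if r < s then g s r else 0) + (\<Sum>r\<in>S. if s < r then g s r else 0)"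
    if "s \<in> S" for s
  proof -
    have "(\<Sum>r\<in>S. g s r) = (\<Sum>r\<in>S. (if r = s then g s s else 0) + (if r < s then g s r else 0) + (if s < r then g s r else 0))"
      by (intro sum.cong refl) auto
    then show ?thesis using assms(1) that by (simp add: sum.distrib)
  qed
  have "(\<Sum>s\<in>S. \<Sum>r\<in>S. g s r) = (\<Sum>s\<in>S. g s s) + (\<Sum>s\<in>S. \<Sum>r\<in>S. if r < s then g s r else 0)
      + (\<Sum>s\<in>S. \<Sum>r\<in>S. if s < r then g s r else 0)"
    by (simp add: 1 sum.distrib)
  also have "(\<Sum>s\<in>S. \<Sum>r\<in>S. if s < r then g s r else 0) = (\<Sum>s\<in>S. \<Sum>r\<in>S. if r < s then g s r else 0)"
    using assms(2) by (subst sum.swap) (intro sum.cong refl, auto)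
  finally show ?thesis using assms(1) by (simp add: sum.inter_filter)
qed

context iid_process begin

text \<open>The conditional expectation of \<open>(increment w q t)\<^sup>2\<close> given the variables before \<open>t - q\<close>. Expanding the square,
products of different lags vanish, and integrating \<open>u\<^sub>t\<close> and \<open>u\<^sub>t\<^sub>-\<^sub>j\<close> turns each inner product pair into the
covariance form; compare \<open>increment_condvar\<close>.\<close>

definition condvar :: "(int \<Rightarrow> real) \<Rightarrow> int \<Rightarrow> int \<Rightarrow> (int \<Rightarrow> 'h) \<Rightarrow> real" where
  "condvar w q t v = (\<Sum>j\<in>{1..q}. (w j)\<^sup>2 *
     (\<Sum>s\<in>{q + 1..t - q - 1}. \<Sum>r\<in>{q + 1..t - q - 1}. lagged cov s r j v))"

lemma condvar_measurable [measurable]: "condvar w q t \<in> borel_measurable paths"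
  unfolding condvar_def by measurable

text \<open>For different lags the index \<open>t - j\<close> is isolated. For equal lags \<open>u\<^sub>t\<close> and \<open>u\<^sub>t\<^sub>-\<^sub>j\<close> are integrated out one after
the other.\<close>

lemma lagged_product_projection:
  fixes h :: "(int \<Rightarrow> 'h) \<Rightarrow> complex"
  assumes h [measurable]: "h \<in> borel_measurable paths" and hb: "\<And>v. norm (h v) \<le> 1"
    and h_upd: "\<And>r v x. r \<ge> t - q \<Longrightarrow> h (v(r := x)) = h v"
    and j: "j \<in> {1..q}" "j' \<in> {1..q}" and s: "s \<in> {q + 1..t - q - 1}" "s' \<in> {q + 1..t - q - 1}"
  shows "integrable M (\<lambda>\<omega>. (lagged (\<bullet>) t s j (path \<omega>) * lagged (\<bullet>) t s' j' (path \<omega>)) *\<^sub>R h (path \<omega>))" (is ?I1)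
    and "integrable M (\<lambda>\<omega>. lagged cov s s' j (path \<omega>) *\<^sub>R h (path \<omega>))" (is ?I2)
    and "(\<integral>\<omega>. (lagged (\<bullet>) t s j (path \<omega>) * lagged (\<bullet>) t s' j' (path \<omega>)) *\<^sub>R h (path \<omega>) \<partial>M) =
      (if j' = j then (\<integral>\<omega>. lagged cov s s' j (path \<omega>) *\<^sub>R h (path \<omega>) \<partial>M) else 0)"
proof -
  note deg = inner_degenerate
  have sq: "sq_integrable (\<lambda>\<omega>. lagged (\<bullet>) t a b (path \<omega>))"
    if "b \<in> {1..q}" "a \<in> {q + 1..t - q - 1}" for a b
    using that by (intro lagged_moment2[OF deg]) auto
  have int: "integrable M (\<lambda>\<omega>. (lagged (\<bullet>) t a b (path \<omega>) * lagged (\<bullet>) t a' b' (path \<omega>)) *\<^sub>R h (path \<omega>))"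
    if "b \<in> {1..q}" "a \<in> {q + 1..t - q - 1}" "b' \<in> {1..q}" "a' \<in> {q + 1..t - q - 1}" for a b a' b'
  proof (rule Bochner_Integration.integrable_bound)
    show "integrable M (\<lambda>\<omega>. lagged (\<bullet>) t a b (path \<omega>) * lagged (\<bullet>) t a' b' (path \<omega>))"
      using that by (intro sq_integrable_mult sq)
    show "AE \<omega> in M. norm ((lagged (\<bullet>) t a b (path \<omega>) * lagged (\<bullet>) t a' b' (path \<omega>)) *\<^sub>R h (path \<omega>))
       \<le> norm (lagged (\<bullet>) t a b (path \<omega>) * lagged (\<bullet>) t a' b' (path \<omega>))"
      using hb by (auto intro!: mult_left_le)
  qed measurable
  show ?I1 using int j s by blast
  define F0 where "F0 v = (lagged (\<bullet>) t s j v * lagged (\<bullet>) t s' j v) *\<^sub>R h v" for v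
  define F1 where "F1 v = cov (v s) (v s') *\<^sub>R (((v (t - j) \<bullet> v (s - j)) * (v (t - j) \<bullet> v (s' - j))) *\<^sub>R h v)" for v
  have F1 [measurable]: "F1 \<in> borel_measurable paths"
    using kernel_measurable[OF cov_degenerate, of s s'] unfolding F1_def by measurable
  have F01: "(\<integral>\<omega>. F0 (v(t := u t \<omega>)) \<partial>M) = F1 v" for v
  proof -
    have "F0 (v(t := u t \<omega>)) = ((u t \<omega> \<bullet> v s) * (u t \<omega> \<bullet> v s')) *\<^sub>R (((v (t - j) \<bullet> v (s - j)) * (v (t - j) \<bullet> v (s' - j))) *\<^sub>R h v)" for \<omega>
      using j s h_upd[of t v] by (simp add: F0_def lagged_def mult_ac)
    then show ?thesis using cov_integrable[of t "v s" "v s'"] by (simp add: F1_def cov_eq del: scaleR_scaleR)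
  qed
  have F0: "F0 \<in> borel_measurable paths" unfolding F0_def by measurable
  have "integrable M (\<lambda>\<omega>. F0 (path \<omega>))" unfolding F0_def using int j s by blast
  note 1 = expectation_resample[where r = t, OF F0 this F01]
  have F12: "(\<integral>\<omega>. F1 (v(t - j := u (t - j) \<omega>)) \<partial>M) = lagged cov s s' j v *\<^sub>R h v" for v
  proof -
    have "F1 (v(t - j := u (t - j) \<omega>)) = ((u (t - j) \<omega> \<bullet> v (s - j)) * (u (t - j) \<omega> \<bullet> v (s' - j))) *\<^sub>R (cov (v s) (v s') *\<^sub>R h v)" for \<omega>
      using j s h_upd[of "t - j" v] by (simp add: F1_def mult_ac)
    then show ?thesis using cov_integrable[of "t - j" "v (s - j)" "v (s' - j)"]
      by (simp add: lagged_def cov_eq del: scaleR_scaleR) (simp add: mult.commute)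
  qed
  note 2 = expectation_resample[where r = "t - j", OF F1 1(2) F12]
  from 2(2) show ?I2 .
  show "(\<integral>\<omega>. (lagged (\<bullet>) t s j (path \<omega>) * lagged (\<bullet>) t s' j' (path \<omega>)) *\<^sub>R h (path \<omega>) \<partial>M) =
      (if j' = j then (\<integral>\<omega>. lagged cov s s' j (path \<omega>) *\<^sub>R h (path \<omega>) \<partial>M) else 0)"
  proof (cases "j' = j")
    case True
    then show ?thesis using 1(1) 2(1) by (simp add: F0_def)
  next
    case False
    have "(\<integral>\<omega>. lagged (\<bullet>) t s j (path \<omega>) *\<^sub>R (lagged (\<bullet>) t s' j' (path \<omega>) *\<^sub>R h (path \<omega>)) \<partial>M) = 0"
    proof (rule lagged_isolated_zero[OF deg, where r = "t - j"])
      fix v x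
      have "lagged (\<bullet>) t s' j' (v(t - j := x)) = lagged (\<bullet>) t s' j' v"
        using False j s by (intro lagged_upd) auto
      then show "lagged (\<bullet>) t s' j' (v(t - j := x)) *\<^sub>R h (v(t - j := x)) = lagged (\<bullet>) t s' j' v *\<^sub>R h v"
        using h_upd[of "t - j" v x] j by simp
    qed (use j s in auto)
    then show ?thesis using False by simp
  qed
qed

lemma increment_condvar:
  fixes h :: "(int \<Rightarrow> 'h) \<Rightarrow> complex"
  assumes h: "h \<in> borel_measurable paths" and hb: "\<And>v. norm (h v) \<le> 1"
    and h_upd: "\<And>r v x. r \<ge> t - q \<Longrightarrow> h (v(r := x)) = h v"
  shows "(\<integral>\<omega>. of_real ((increment w q t (path \<omega>))\<^sup>2) * h (path \<omega>) \<partial>M) =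
     (\<integral>\<omega>. of_real (condvar w q t (path \<omega>)) * h (path \<omega>) \<partial>M)"
proof -
  let ?S = "{q + 1..t - q - 1}" and ?J = "{1..q}"
  define A where "A j s j' s' \<omega> = (lagged (\<bullet>) t s j (path \<omega>) * lagged (\<bullet>) t s' j' (path \<omega>)) *\<^sub>R h (path \<omega>)" for j s j' s' \<omega>
  define C where "C j s s' \<omega> = lagged cov s s' j (path \<omega>) *\<^sub>R h (path \<omega>)" for j s s' \<omega>
  have A: "integrable M (A j s j' s')" and C: "integrable M (C j s s')"
    and AC: "(\<integral>\<omega>. A j s j' s' \<omega> \<partial>M) = (if j' = j then (\<integral>\<omega>. C j s s' \<omega> \<partial>M) else 0)"
    if "j \<in> ?J" "j' \<in> ?J" "s \<in> ?S" "s' \<in> ?S" for j s j' s'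
    unfolding A_def C_def using lagged_product_projection[OF h hb h_upd that] by auto
  have "of_real ((increment w q t (path \<omega>))\<^sup>2) * h (path \<omega>) =
     (\<Sum>j\<in>?J. \<Sum>j'\<in>?J. \<Sum>s\<in>?S. \<Sum>s'\<in>?S. (w j * w j') *\<^sub>R A j s j' s' \<omega>)" for \<omega>
    unfolding increment_def power2_eq_square sum_product A_def
    by (simp add: sum_distrib_right sum_distrib_left scaleR_conv_of_real mult_ac)
  moreover have "(\<integral>\<omega>. (\<Sum>j\<in>J. \<Sum>j'\<in>J. \<Sum>s\<in>S. \<Sum>s'\<in>S. (w j * w j') *\<^sub>R A j s j' s' \<omega>) \<partial>M) =
      (\<Sum>j\<in>J. \<Sum>j'\<in>J. \<Sum>s\<in>S. \<Sum>s'\<in>S. (w j * w j') *\<^sub>R (\<integral>\<omega>. A j s j' s' \<omega> \<partial>M))"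
    if "\<And>j j' s s'. j \<in> J \<Longrightarrow> j' \<in> J \<Longrightarrow> s \<in> S \<Longrightarrow> s' \<in> S \<Longrightarrow> integrable M (A j s j' s')" for J S
    using that by simp
  ultimately have "(\<integral>\<omega>. of_real ((increment w q t (path \<omega>))\<^sup>2) * h (path \<omega>) \<partial>M) =
     (\<Sum>j\<in>?J. \<Sum>j'\<in>?J. \<Sum>s\<in>?S. \<Sum>s'\<in>?S. (w j * w j') *\<^sub>R (\<integral>\<omega>. A j s j' s' \<omega> \<partial>M))"
    using A by presburger
  also have "\<dots> = (\<Sum>j\<in>?J. \<Sum>j'\<in>?J. if j' = j then (\<Sum>s\<in>?S. \<Sum>s'\<in>?S. (w j)\<^sup>2 *\<^sub>R (\<integral>\<omega>. C j s s' \<omega> \<partial>M)) else 0)"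
    by (intro sum.cong refl) (auto simp: AC power2_eq_square)
  also have "\<dots> = (\<Sum>j\<in>?J. \<Sum>s\<in>?S. \<Sum>s'\<in>?S. (w j)\<^sup>2 *\<^sub>R (\<integral>\<omega>. C j s s' \<omega> \<partial>M))"
    by simp
  also have "\<dots> = (\<integral>\<omega>. (\<Sum>j\<in>?J. \<Sum>s\<in>?S. \<Sum>s'\<in>?S. (w j)\<^sup>2 *\<^sub>R C j s s' \<omega>) \<partial>M)"
  proof -
    have C': "integrable M (C j s s')" if "j \<in> ?J" "s \<in> ?S" "s' \<in> ?S" for j s s'
      using C[OF that(1) that] .
    have X: "(\<integral>\<omega>. (\<Sum>j\<in>J. \<Sum>s\<in>S. \<Sum>s'\<in>S. (w j)\<^sup>2 *\<^sub>R C j s s' \<omega>) \<partial>M) =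
      (\<Sum>j\<in>J. \<Sum>s\<in>S. \<Sum>s'\<in>S. (w j)\<^sup>2 *\<^sub>R (\<integral>\<omega>. C j s s' \<omega> \<partial>M))"
    if "\<And>j s s'. j \<in> J \<Longrightarrow> s \<in> S \<Longrightarrow> s' \<in> S \<Longrightarrow> integrable M (C j s s')" for J S
    using that by simp
    show ?thesis by (rule X[symmetric]) (rule C')
  qed
  also have "\<dots> = (\<integral>\<omega>. of_real (condvar w q t (path \<omega>)) * h (path \<omega>) \<partial>M)"
    unfolding condvar_def C_def
    by (simp add: sum_distrib_right sum_distrib_left scaleR_conv_of_real mult.assoc)
  finally show ?thesis .
qed

text \<open>The diagonal \<open>s = r\<close> is handled by \<open>diagonal_variance\<close>. The rest is a sum of lagged products for the degenerate kernel
\<open>cov\<close>, so \<open>lagged_sum_variance\<close> applies. Relative to the mean \<open>N W kappa\<^sup>2\<close> the two errors are of order \<open>1/\<surd>N\<close> and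
\<open>1/\<surd>W\<close>.\<close>

lemma condvar_concentration:
  fixes w :: "int \<Rightarrow> real" and q t :: int
  assumes w: "\<And>j. j \<in> {1..q} \<Longrightarrow> \<bar>w j\<bar> \<le> 1"
  defines "N \<equiv> real (card {q + 1..t - q - 1})" and "W \<equiv> (\<Sum>j\<in>{1..q}. (w j)\<^sup>2)" and "B \<equiv> sigma2 ^ 4 * m4\<^sup>2"
  shows "integrable M (\<lambda>\<omega>. condvar w q t (path \<omega>))"
    and "(\<integral>\<omega>. \<bar>condvar w q t (path \<omega>) - N * W * kappa\<^sup>2\<bar> \<partial>M) \<le> W * sqrt (3 * N * B) + 2 * sqrt (2 * B * (N\<^sup>2 * W))"
proof -
  let ?S = "{q + 1..t - q - 1}" and ?J = "{1..q}"
  define f where "f x = cov x x" for x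
  have f [measurable]: "f \<in> borel_measurable borel"
  proof -
    have "(\<lambda>x. case_prod cov (x, x)) \<in> borel_measurable borel" by measurable
    then show ?thesis by (simp add: f_def[abs_def])
  qed
  define D where "D j \<omega> = (\<Sum>s\<in>?S. (f (u s \<omega>) * f (u (s - j) \<omega>) - kappa\<^sup>2))" for j \<omega>
  have D: "sq_integrable (D j)" "(\<integral>\<omega>. \<bar>D j \<omega>\<bar> \<partial>M) \<le> sqrt (3 * N * B)" if "j \<in> ?J" for j
  proof -
    note dv = diagonal_variance[OF f, of sigma2 j ?S kappa]
    have bd: "\<bar>f x\<bar> \<le> sigma2 * (norm x)\<^sup>2" for x
      using cov_bound[of x x] by (simp add: f_def power2_eq_square mult.assoc)
    show D1: "sq_integrable (D j)" unfolding D_def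
      using that bd by (intro dv(1)) (auto simp: sigma2_nonneg kappa_def f_def)
    have "(\<integral>\<omega>. (D j \<omega>)\<^sup>2 \<partial>M) \<le> 3 * N * B" unfolding D_def N_def B_def
      using that bd by (intro dv(2)) (auto simp: sigma2_nonneg kappa_def f_def)
    then show "(\<integral>\<omega>. \<bar>D j \<omega>\<bar> \<partial>M) \<le> sqrt (3 * N * B)"
      using expectation_abs_le_sqrt[OF D1] real_sqrt_le_mono order_trans by blast
  qed
  define I where "I = (SIGMA s:?S. {r \<in> ?S. r < s} \<times> ?J)"
  define R where "R \<omega> = (\<Sum>(s, r, j)\<in>I. (\<lambda>(s, r, j). (w j)\<^sup>2) (s, r, j) * lagged cov s r j (path \<omega>))" for \<omega>
  have finI: "finite I" by (rule finite_subset[of _ "?S \<times> ?S \<times> ?J"]) (auto simp: I_def)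
  have I: "r < s \<and> j \<ge> 1" if "(s, r, j) \<in> I" for s r j using that by (auto simp: I_def)
  note lv = lagged_sum_variance[OF cov_degenerate finI I, of "\<lambda>(s, r, j). (w j)\<^sup>2", folded R_def]
  have R1: "sq_integrable R" using lv(1) unfolding R_def[abs_def] by simp
  have W4: "(\<Sum>j\<in>?J. ((w j)\<^sup>2)\<^sup>2) \<le> W" unfolding W_def
  proof (rule sum_mono)
    fix j assume "j \<in> ?J"
    then have "(w j)\<^sup>2 \<le> 1" using w abs_square_le_1 by blast
    then show "((w j)\<^sup>2)\<^sup>2 \<le> (w j)\<^sup>2"
      unfolding power2_eq_square[of "(w j)\<^sup>2"] by (rule mult_left_le) simp
  qed
  have "(\<integral>\<omega>. (R \<omega>)\<^sup>2 \<partial>M) \<le> 2 * B * (\<Sum>i\<in>I. ((\<lambda>(s, r, j). (w j)\<^sup>2) i)\<^sup>2)"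
    using lv(2) unfolding R_def B_def .
  also have "(\<Sum>i\<in>I. ((\<lambda>(s, r, j). (w j)\<^sup>2) i)\<^sup>2) = (\<Sum>s\<in>?S. \<Sum>r\<in>{r \<in> ?S. r < s}. \<Sum>j\<in>?J. ((w j)\<^sup>2)\<^sup>2)"
    unfolding I_def by (subst sum_Sigma_Times) (simp_all del: atLeastAtMost_iff)
  also have "\<dots> \<le> (\<Sum>s\<in>?S. \<Sum>r\<in>?S. W)"
  proof -
    have "W \<ge> 0" unfolding W_def by (intro sum_nonneg) simp
    then have "(\<Sum>r\<in>{r \<in> ?S. r < s}. \<Sum>j\<in>?J. ((w j)\<^sup>2)\<^sup>2) \<le> (\<Sum>r\<in>?S. W)" for s
      using W4 by (intro order_trans[OF sum_mono[OF W4] sum_mono2]) auto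
    then show ?thesis by (rule sum_mono)
  qed
  also have "\<dots> = N\<^sup>2 * W" by (simp add: N_def power2_eq_square del: card_atLeastAtMost_int)
  finally have "(\<integral>\<omega>. (R \<omega>)\<^sup>2 \<partial>M) \<le> 2 * B * (N\<^sup>2 * W)"
    using sigma2_nonneg by (simp add: B_def mult_left_mono)
  then have R2: "(\<integral>\<omega>. \<bar>R \<omega>\<bar> \<partial>M) \<le> sqrt (2 * B * (N\<^sup>2 * W))"
    using expectation_abs_le_sqrt[OF R1] real_sqrt_le_mono order_trans by blast
  have eq: "condvar w q t (path \<omega>) - N * W * kappa\<^sup>2 = (\<Sum>j\<in>?J. (w j)\<^sup>2 * D j \<omega>) + 2 * R \<omega>" for \<omega>
  proof -
    have "(\<Sum>s\<in>?S. \<Sum>r\<in>?S. lagged cov s r j (path \<omega>)) = D j \<omega> + N * kappa\<^sup>2 +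
        2 * (\<Sum>s\<in>?S. \<Sum>r\<in>{r \<in> ?S. r < s}. lagged cov s r j (path \<omega>))" for j
      by (subst sum_symmetric_split)
        (auto simp: lagged_def cov_commute D_def f_def path_def N_def sum_subtractf)
    then have "condvar w q t (path \<omega>) = (\<Sum>j\<in>?J. (w j)\<^sup>2 * D j \<omega>) + N * W * kappa\<^sup>2 +
        2 * (\<Sum>j\<in>?J. \<Sum>s\<in>?S. \<Sum>r\<in>{r \<in> ?S. r < s}. (w j)\<^sup>2 * lagged cov s r j (path \<omega>))"
      unfolding condvar_def W_def
      by (simp add: sum.distrib distrib_left sum_distrib_left sum_distrib_right mult_ac)
    also have "(\<Sum>j\<in>?J. \<Sum>s\<in>?S. \<Sum>r\<in>{r \<in> ?S. r < s}. (w j)\<^sup>2 * lagged cov s r j (path \<omega>)) = R \<omega>"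
    proof -
      have "R \<omega> = (\<Sum>s\<in>?S. \<Sum>r\<in>{r \<in> ?S. r < s}. \<Sum>j\<in>?J. (w j)\<^sup>2 * lagged cov s r j (path \<omega>))"
        unfolding I_def R_def by (subst sum_Sigma_Times) (simp_all del: atLeastAtMost_iff)
      also have "\<dots> = (\<Sum>s\<in>?S. \<Sum>j\<in>?J. \<Sum>r\<in>{r \<in> ?S. r < s}. (w j)\<^sup>2 * lagged cov s r j (path \<omega>))"
        by (intro sum.cong refl sum.swap)
      also have "\<dots> = (\<Sum>j\<in>?J. \<Sum>s\<in>?S. \<Sum>r\<in>{r \<in> ?S. r < s}. (w j)\<^sup>2 * lagged cov s r j (path \<omega>))"
        by (rule sum.swap)
      finally show ?thesis by simp
    qed
    finally show ?thesis by simp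
  qed
  have sqD: "sq_integrable (\<lambda>\<omega>. \<Sum>j\<in>?J. (w j)\<^sup>2 * D j \<omega>)"
    by (intro sq_integrable_sum sq_integrable_cmult D(1))
  have "sq_integrable (\<lambda>\<omega>. condvar w q t (path \<omega>) - N * W * kappa\<^sup>2)"
    unfolding eq by (intro sq_integrable_add sqD sq_integrable_cmult R1)
  from sq_integrable_integrable[OF sq_integrable_add[OF this sq_integrable_const[of "N * W * kappa\<^sup>2"]]]
  show "integrable M (\<lambda>\<omega>. condvar w q t (path \<omega>))" by simp
  have "(\<integral>\<omega>. \<bar>condvar w q t (path \<omega>) - N * W * kappa\<^sup>2\<bar> \<partial>M) \<le>
      (\<integral>\<omega>. (\<Sum>j\<in>?J. (w j)\<^sup>2 * \<bar>D j \<omega>\<bar>) + 2 * \<bar>R \<omega>\<bar> \<partial>M)"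
  proof (rule integral_mono)
    show "integrable M (\<lambda>\<omega>. \<bar>condvar w q t (path \<omega>) - N * W * kappa\<^sup>2\<bar>)"
      using \<open>sq_integrable (\<lambda>\<omega>. condvar w q t (path \<omega>) - N * W * kappa\<^sup>2)\<close> sq_integrable_integrable by auto
    show "integrable M (\<lambda>\<omega>. (\<Sum>j\<in>?J. (w j)\<^sup>2 * \<bar>D j \<omega>\<bar>) + 2 * \<bar>R \<omega>\<bar>)"
      using D(1) R1 sq_integrable_integrable by (intro Bochner_Integration.integrable_add Bochner_Integration.integrable_sum) auto
    show "\<bar>condvar w q t (path \<omega>) - N * W * kappa\<^sup>2\<bar> \<le> (\<Sum>j\<in>?J. (w j)\<^sup>2 * \<bar>D j \<omega>\<bar>) + 2 * \<bar>R \<omega>\<bar>" for \<omega>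
    proof -
      have "\<bar>\<Sum>j\<in>?J. (w j)\<^sup>2 * D j \<omega>\<bar> \<le> (\<Sum>j\<in>?J. (w j)\<^sup>2 * \<bar>D j \<omega>\<bar>)"
        using sum_abs[of "\<lambda>j. (w j)\<^sup>2 * D j \<omega>" ?J] by (simp add: abs_mult)
      then show ?thesis unfolding eq by linarith
    qed
  qed
  also have "\<dots> = (\<Sum>j\<in>?J. (w j)\<^sup>2 * (\<integral>\<omega>. \<bar>D j \<omega>\<bar> \<partial>M)) + 2 * (\<integral>\<omega>. \<bar>R \<omega>\<bar> \<partial>M)"
  proof -
    have "integrable M (\<lambda>\<omega>. \<bar>R \<omega>\<bar>)" using R1 sq_integrable_integrable by auto
    moreover have "integrable M (\<lambda>\<omega>. (w j)\<^sup>2 * \<bar>D j \<omega>\<bar>)" if "j \<in> ?J" for j using D(1)[OF that] sq_integrable_integrable by auto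
    ultimately show ?thesis by (simp del: atLeastAtMost_iff)
  qed
  also have "\<dots> \<le> (\<Sum>j\<in>?J. (w j)\<^sup>2 * sqrt (3 * N * B)) + 2 * sqrt (2 * B * (N\<^sup>2 * W))"
    using D(2) R2 by (intro add_mono sum_mono mult_left_mono) auto
  also have "\<dots> = W * sqrt (3 * N * B) + 2 * sqrt (2 * B * (N\<^sup>2 * W))"
    by (simp add: W_def sum_distrib_right)
  finally show "(\<integral>\<omega>. \<bar>condvar w q t (path \<omega>) - N * W * kappa\<^sup>2\<bar> \<partial>M) \<le> W * sqrt (3 * N * B) + 2 * sqrt (2 * B * (N\<^sup>2 * W))" .
qed

end

section \<open>Characteristic functions of sums with nearly deterministic conditional variance\<close>

lemma exp_minus_quadratic: "x \<ge> 0 \<Longrightarrow> \<bar>exp (- x) - (1 - x)\<bar> \<le> x\<^sup>2 / (2::real)"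
proof -
  assume x: "x \<ge> 0"
  have "1 - x \<le> exp (- x)" using exp_ge_add_one_self[of "-x"] by simp
  moreover have "exp (- x) \<le> 1 - x + x\<^sup>2 / 2"
  proof (cases "x = 0")
    case False
    then obtain t where t: "\<bar>t\<bar> \<le> \<bar>- x\<bar>" "exp (- x) = (\<Sum>m<3. (- x) ^ m / fact m) + exp t / fact 3 * (- x) ^ 3"
      using Maclaurin_exp_le[of "- x" 3] by blast
    have "exp t / fact 3 * (- x) ^ 3 \<le> 0" using x by (simp add: power3_eq_cube mult_nonneg_nonpos)
    then show ?thesis using t(2) by (simp add: numeral_eq_Suc)
  qed simp
  ultimately show ?thesis by simp
qed

lemma iexp_diff_le: "norm (iexp x - iexp y) \<le> \<bar>x - y\<bar>"
proof -
  have "norm (iexp x - iexp y) = norm (iexp y * (iexp (x - y) - 1))"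
    by (simp add: algebra_simps flip: exp_add)
  also have "\<dots> = norm (iexp (x - y) - 1)" by (simp add: norm_mult)
  also have "\<dots> \<le> \<bar>x - y\<bar>" using iexp_approx1[of "x - y" 0] by simp
  finally show ?thesis .
qed

context prob_space begin

text \<open>Expand \<open>exp(i \<theta> Z)\<close> to second order and \<open>exp(-\<theta>\<^sup>2 v / 2)\<close> to first order. The linear term vanishes by the
martingale property, and the terms of second order leave \<open>Z\<^sup>2 - v\<close>.\<close>

lemma char_increment_step:
  fixes h :: "'a \<Rightarrow> complex"
  assumes Z: "quart_integrable Z" and h [measurable]: "h \<in> borel_measurable M" and hb: "\<And>\<omega>. norm (h \<omega>) \<le> 1"
    and mart: "expectation (\<lambda>\<omega>. of_real (Z \<omega>) * h \<omega>) = 0" and v: "v \<ge> 0"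
  shows "norm (expectation (\<lambda>\<omega>. h \<omega> * iexp (\<theta> * Z \<omega>)) - of_real (exp (- \<theta>\<^sup>2 * v / 2)) * expectation h) \<le>
    \<theta>\<^sup>2 / 2 * norm (expectation (\<lambda>\<omega>. of_real ((Z \<omega>)\<^sup>2 - v) * h \<omega>)) + \<bar>\<theta>\<bar> ^ 3 / 6 * expectation (\<lambda>\<omega>. \<bar>Z \<omega>\<bar> ^ 3)
      + \<theta> ^ 4 * v\<^sup>2 / 8"
proof -
  have Zm [measurable]: "Z \<in> borel_measurable M" using Z by (simp add: quart_integrable_def)
  have Z2: "integrable M (\<lambda>\<omega>. (Z \<omega>)\<^sup>2)" using quart_integrable_sq[OF Z] by (simp add: sq_integrable_def)
  have Z1: "integrable M Z" using quart_integrable_sq[OF Z] by (rule sq_integrable_integrable)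
  have Z3: "integrable M (\<lambda>\<omega>. \<bar>Z \<omega>\<bar> ^ 3)"
  proof -
    have "integrable M (\<lambda>\<omega>. \<bar>Z \<omega> * Z \<omega> * Z \<omega> * 1\<bar>)" using Z by (intro integrable_abs quart_integrable_mult4) auto
    then show ?thesis by (simp add: power3_eq_cube abs_mult)
  qed
  have bnd: "integrable M (\<lambda>\<omega>. of_real (f \<omega>) * h \<omega>)" if "integrable M f" for f
  proof (rule Bochner_Integration.integrable_bound[OF that])
    show "(\<lambda>\<omega>. of_real (f \<omega>) * h \<omega>) \<in> borel_measurable M" using that by measurable
    show "AE \<omega> in M. norm (of_real (f \<omega>) * h \<omega>) \<le> norm (f \<omega>)"
      using hb by (auto simp: norm_mult intro!: mult_left_le)
  qed
  have hint: "integrable M h" using bnd[of "\<lambda>_. 1"] by simp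
  have eint: "integrable M (\<lambda>\<omega>. h \<omega> * iexp (\<theta> * Z \<omega>))"
    by (rule Bochner_Integration.integrable_bound[of M "\<lambda>_. 1::real"]) (use hb in \<open>auto simp: norm_mult\<close>)
  define D where "D \<omega> = h \<omega> * iexp (\<theta> * Z \<omega>) - of_real (exp (- \<theta>\<^sup>2 * v / 2)) * h \<omega> - \<i> * \<theta> * (of_real (Z \<omega>) * h \<omega>)
     + of_real (\<theta>\<^sup>2 / 2) * (of_real ((Z \<omega>)\<^sup>2 - v) * h \<omega>)" for \<omega>
  have i1: "integrable M (\<lambda>\<omega>. of_real (Z \<omega>) * h \<omega>)" using bnd[OF Z1] .
  have i2: "integrable M (\<lambda>\<omega>. of_real ((Z \<omega>)\<^sup>2 - v) * h \<omega>)" using Z2 by (intro bnd) auto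
  have Dint: "integrable M D" unfolding D_def using eint hint i1 i2 by simp
  have ED: "expectation D = expectation (\<lambda>\<omega>. h \<omega> * iexp (\<theta> * Z \<omega>)) - of_real (exp (- \<theta>\<^sup>2 * v / 2)) * expectation h
     + of_real (\<theta>\<^sup>2 / 2) * expectation (\<lambda>\<omega>. of_real ((Z \<omega>)\<^sup>2 - v) * h \<omega>)"
    unfolding D_def using eint hint i1 i2 mart by simp
  have Db: "norm (D \<omega>) \<le> \<bar>\<theta>\<bar> ^ 3 / 6 * \<bar>Z \<omega>\<bar> ^ 3 + \<theta> ^ 4 * v\<^sup>2 / 8" for \<omega>
  proof -
    have D: "D \<omega> = h \<omega> * ((iexp (\<theta> * Z \<omega>) - (\<Sum>k\<le>2. (\<i> * (\<theta> * Z \<omega>)) ^ k / fact k))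
       - of_real (exp (- (\<theta>\<^sup>2 * v / 2)) - (1 - \<theta>\<^sup>2 * v / 2)))"
      by (simp add: D_def numeral_eq_Suc field_simps of_real_exp)
    have "norm (D \<omega>) \<le> 1 * (norm (iexp (\<theta> * Z \<omega>) - (\<Sum>k\<le>2. (\<i> * (\<theta> * Z \<omega>)) ^ k / fact k))
       + norm (complex_of_real (exp (- (\<theta>\<^sup>2 * v / 2)) - (1 - \<theta>\<^sup>2 * v / 2))))"
      unfolding D norm_mult using hb by (intro mult_mono norm_triangle_ineq4) auto
    also have "\<dots> \<le> \<bar>\<theta> * Z \<omega>\<bar> ^ 3 / 6 + (\<theta>\<^sup>2 * v / 2)\<^sup>2 / 2"
      using iexp_approx1[of "\<theta> * Z \<omega>" 2] exp_minus_quadratic[of "\<theta>\<^sup>2 * v / 2"] v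
      unfolding norm_of_real by (intro order_trans[OF eq_refl[OF mult_1] add_mono]) (simp_all add: numeral_eq_Suc)
    also have "\<dots> = \<bar>\<theta>\<bar> ^ 3 / 6 * \<bar>Z \<omega>\<bar> ^ 3 + \<theta> ^ 4 * v\<^sup>2 / 8"
      by (simp add: power_mult_distrib abs_mult power_divide flip: power_mult)
    finally show ?thesis .
  qed
  have "norm (expectation D) \<le> expectation (\<lambda>\<omega>. norm (D \<omega>))" by (rule integral_norm_bound)
  also have "\<dots> \<le> expectation (\<lambda>\<omega>. \<bar>\<theta>\<bar> ^ 3 / 6 * \<bar>Z \<omega>\<bar> ^ 3 + \<theta> ^ 4 * v\<^sup>2 / 8)"
    using Dint Z3 Db by (intro integral_mono) auto
  also have "\<dots> = \<bar>\<theta>\<bar> ^ 3 / 6 * expectation (\<lambda>\<omega>. \<bar>Z \<omega>\<bar> ^ 3) + \<theta> ^ 4 * v\<^sup>2 / 8"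
    using Z3 by (simp add: prob_space)
  finally have *: "norm (expectation D) \<le> \<bar>\<theta>\<bar> ^ 3 / 6 * expectation (\<lambda>\<omega>. \<bar>Z \<omega>\<bar> ^ 3) + \<theta> ^ 4 * v\<^sup>2 / 8" .
  have "norm (expectation (\<lambda>\<omega>. h \<omega> * iexp (\<theta> * Z \<omega>)) - of_real (exp (- \<theta>\<^sup>2 * v / 2)) * expectation h) =
    norm (expectation D - of_real (\<theta>\<^sup>2 / 2) * expectation (\<lambda>\<omega>. of_real ((Z \<omega>)\<^sup>2 - v) * h \<omega>))"
    unfolding ED by simp
  also have "\<dots> \<le> norm (expectation D) + \<theta>\<^sup>2 / 2 * norm (expectation (\<lambda>\<omega>. of_real ((Z \<omega>)\<^sup>2 - v) * h \<omega>))"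
    by (rule order_trans[OF norm_triangle_ineq4]) (simp add: norm_mult norm_power)
  finally show ?thesis using * by linarith
qed

text \<open>The \<open>v i\<close> are constants, so the factors \<open>exp(-\<theta>\<^sup>2 v / 2) \<le> 1\<close> can be pulled out of the expectation and the errors of
the single steps simply add up.\<close>

lemma char_martingale_bound:
  fixes Z :: "nat \<Rightarrow> 'a \<Rightarrow> real" and v :: "nat \<Rightarrow> real" and \<theta> :: real
  defines "h i \<omega> \<equiv> iexp (\<theta> * (\<Sum>l<i. Z l \<omega>))"
  assumes Z: "\<And>i. i < n \<Longrightarrow> quart_integrable (Z i)"
    and mart: "\<And>i. i < n \<Longrightarrow> expectation (\<lambda>\<omega>. of_real (Z i \<omega>) * h i \<omega>) = 0" and v: "\<And>i. i < n \<Longrightarrow> v i \<ge> 0"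
    and err: "\<And>i. i < n \<Longrightarrow> \<theta>\<^sup>2 / 2 * norm (expectation (\<lambda>\<omega>. of_real ((Z i \<omega>)\<^sup>2 - v i) * h i \<omega>))
      + \<bar>\<theta>\<bar> ^ 3 / 6 * expectation (\<lambda>\<omega>. \<bar>Z i \<omega>\<bar> ^ 3) + \<theta> ^ 4 * (v i)\<^sup>2 / 8 \<le> \<epsilon>"
  shows "norm (expectation (\<lambda>\<omega>. iexp (\<theta> * (\<Sum>l<n. Z l \<omega>))) - of_real (exp (- \<theta>\<^sup>2 * (\<Sum>l<n. v l) / 2))) \<le> real n * \<epsilon>"
proof -
  have "norm (expectation (h m) - of_real (exp (- \<theta>\<^sup>2 * (\<Sum>l<m. v l) / 2))) \<le> real m * \<epsilon>" if "m \<le> n" for m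
    using that
  proof (induction m)
    case 0 then show ?case by (simp add: h_def prob_space)
  next
    case (Suc m)
    then have m: "m < n" by simp
    have [measurable]: "Z l \<in> borel_measurable M" if "l < m" for l using Z[of l] that m by (simp add: quart_integrable_def)
    have hm: "h m \<in> borel_measurable M" unfolding h_def using m by measurable
    have hS: "h (Suc m) \<omega> = h m \<omega> * iexp (\<theta> * Z m \<omega>)" for \<omega>
      by (simp add: h_def distrib_left exp_add)
    let ?e = "complex_of_real (exp (- \<theta>\<^sup>2 * v m / 2))"
    have 1: "norm (expectation (h (Suc m)) - ?e * expectation (h m)) \<le> \<epsilon>"
      unfolding hS using err[OF m]
      by (intro order_trans[OF char_increment_step[OF Z[OF m] hm _ mart[OF m] v[OF m]]]) (auto simp: h_def)
    have 2: "norm (?e * expectation (h m) - ?e * of_real (exp (- \<theta>\<^sup>2 * (\<Sum>l<m. v l) / 2))) \<le> 1 * (real m * \<epsilon>)"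
      unfolding right_diff_distrib[symmetric] norm_mult
      using Suc v[OF m] by (intro mult_mono) auto
    have 3: "?e * of_real (exp (- \<theta>\<^sup>2 * (\<Sum>l<m. v l) / 2)) = of_real (exp (- \<theta>\<^sup>2 * (\<Sum>l<Suc m. v l) / 2))"
      by (simp add: distrib_left add_divide_distrib flip: exp_add of_real_mult) 
    have "norm (expectation (h (Suc m)) - of_real (exp (- \<theta>\<^sup>2 * (\<Sum>l<Suc m. v l) / 2))) \<le>
       norm (expectation (h (Suc m)) - ?e * expectation (h m)) +
       norm (?e * expectation (h m) - ?e * of_real (exp (- \<theta>\<^sup>2 * (\<Sum>l<m. v l) / 2)))"
      unfolding 3[symmetric] by (rule norm_diff_triangle_le[OF order_refl order_refl])
    also have "\<dots> \<le> \<epsilon> + 1 * (real m * \<epsilon>)" by (intro add_mono 1 2)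
    finally show ?case by (simp add: algebra_simps)
  qed
  from this[of n] show ?thesis unfolding h_def[abs_def] by simp
qed

end

context iid_process begin

lemma kappa_nonneg: "kappa \<ge> 0"
  unfolding kappa_def cov_def by (intro Bochner_Integration.integral_nonneg) (simp flip: power2_eq_square)

lemma kappa_le: "kappa \<le> m4"
proof -
  have "kappa \<le> (\<integral>\<omega>. sigma2 * (norm (u 0 \<omega>))\<^sup>2 \<partial>M)" unfolding kappa_def
  proof (rule integral_mono)
    show "integrable M (\<lambda>\<omega>. sigma2 * (norm (u 0 \<omega>))\<^sup>2)" using integrable_norm_power[of 2 0] by simp
    have le: "\<bar>cov x x\<bar> \<le> sigma2 * (norm x)\<^sup>2" for x
      using cov_bound[of x x] by (simp add: power2_eq_square mult.assoc)
    then show "cov (u 0 \<omega>) (u 0 \<omega>) \<le> sigma2 * (norm (u 0 \<omega>))\<^sup>2" for \<omega>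
      using abs_ge_self order_trans by blast
    have "(\<lambda>\<omega>. case_prod cov (u 0 \<omega>, u 0 \<omega>)) \<in> borel_measurable M" by measurable
    then show "integrable M (\<lambda>\<omega>. cov (u 0 \<omega>) (u 0 \<omega>))"
      using le sigma2_nonneg
      by (intro Bochner_Integration.integrable_bound[OF \<open>integrable M (\<lambda>\<omega>. sigma2 * (norm (u 0 \<omega>))\<^sup>2)\<close>]) auto
  qed
  also have "\<dots> = sigma2\<^sup>2" by (simp add: sigma2_def power2_eq_square)
  also have "\<dots> \<le> m4" by (rule sigma2_le)
  finally show ?thesis .
qed

lemma increments_variance:
  assumes q: "q \<ge> 0" and A: "finite A" "\<And>t. t \<in> A \<Longrightarrow> t \<le> int n"
  shows "sq_integrable (\<lambda>\<omega>. \<Sum>t\<in>A. increment w q t (path \<omega>))"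
    and "(\<integral>\<omega>. (\<Sum>t\<in>A. increment w q t (path \<omega>))\<^sup>2 \<partial>M) \<le> 2 * m4\<^sup>2 * (real (card A) * real n * (\<Sum>j\<in>{1..q}. (w j)\<^sup>2))"
proof -
  define I where "I = (SIGMA t:A. {q + 1..t - q - 1} \<times> {1..q})"
  have eq: "(\<Sum>t\<in>A. increment w q t (path \<omega>)) = (\<Sum>(t, s, j)\<in>I. (\<lambda>(t, s, j). w j) (t, s, j) * lagged (\<bullet>) t s j (path \<omega>))" for \<omega>
  proof -
    have "increment w q t (path \<omega>) = (\<Sum>s\<in>{q + 1..t - q - 1}. \<Sum>j\<in>{1..q}. w j * lagged (\<bullet>) t s j (path \<omega>))" for t
      unfolding increment_def by (rule sum.swap)
    then show ?thesis unfolding I_def using A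
      by (subst sum_Sigma_Times) (simp_all del: atLeastAtMost_iff)
  qed
  have fin: "finite I" unfolding I_def using A by auto
  have I: "s < t \<and> j \<ge> 1" if "(t, s, j) \<in> I" for t s j using that by (auto simp: I_def)
  note lv = lagged_sum_variance[OF inner_degenerate fin I, of "\<lambda>(t, s, j). w j"]
  show "sq_integrable (\<lambda>\<omega>. \<Sum>t\<in>A. increment w q t (path \<omega>))" unfolding eq by (rule lv(1))
  have "(\<Sum>i\<in>I. ((\<lambda>(t, s, j). w j) i)\<^sup>2) = (\<Sum>t\<in>A. \<Sum>s\<in>{q + 1..t - q - 1}. \<Sum>j\<in>{1..q}. (w j)\<^sup>2)"
    unfolding I_def using A by (subst sum_Sigma_Times) (simp_all del: atLeastAtMost_iff)
  also have "\<dots> \<le> (\<Sum>t\<in>A. real n * (\<Sum>j\<in>{1..q}. (w j)\<^sup>2))"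
  proof (rule sum_mono)
    fix t assume "t \<in> A"
    then have "real (card {q + 1..t - q - 1}) \<le> real n" using A(2)[of t] q by auto
    then show "(\<Sum>s\<in>{q + 1..t - q - 1}. \<Sum>j\<in>{1..q}. (w j)\<^sup>2) \<le> real n * (\<Sum>j\<in>{1..q}. (w j)\<^sup>2)"
      by (simp add: mult_right_mono sum_nonneg)
  qed
  finally have X: "(\<Sum>i\<in>I. ((\<lambda>(t, s, j). w j) i)\<^sup>2) \<le> (\<Sum>t\<in>A. real n * (\<Sum>j\<in>{1..q}. (w j)\<^sup>2))" .
  show "(\<integral>\<omega>. (\<Sum>t\<in>A. increment w q t (path \<omega>))\<^sup>2 \<partial>M) \<le> 2 * m4\<^sup>2 * (real (card A) * real n * (\<Sum>j\<in>{1..q}. (w j)\<^sup>2))"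
    unfolding eq using mult_left_mono[OF X, of "2 * (1 ^ 4 * m4\<^sup>2)", simplified]
    by (intro order_trans[OF lv(2)]) (simp_all add: mult_ac)
qed

text \<open>The increments are scaled by \<open>lam\<close>, and \<open>V\<close> is the sum of their mean conditional variances; the summand for
\<open>t = i + 1\<close> is proportional to the number of times \<open>s\<close> available. \<open>\<beta>\<close> bounds the second moments of the scaled increments and
\<open>\<beta>\<^sup>2\<close> the fourth ones; in the application \<open>\<beta>\<close> is of order \<open>1/n\<close>.\<close>

lemma char_increments_bound:
  fixes w :: "int \<Rightarrow> real" and q n :: nat and lam \<theta> :: real
  assumes w: "\<And>j. j \<in> {1..int q} \<Longrightarrow> \<bar>w j\<bar> \<le> 1" 
  defines "W \<equiv> (\<Sum>j\<in>{1..int q}. (w j)\<^sup>2)"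
  defines "\<beta> \<equiv> 3 * m4\<^sup>2 * (lam\<^sup>2 * (real n * W))" and "B \<equiv> sigma2 ^ 4 * m4\<^sup>2"
    and "V \<equiv> lam\<^sup>2 * kappa\<^sup>2 * W * (\<Sum>i<n. real (card {int q + 1..int i + 1 - int q - 1}))"
  shows "norm (expectation (\<lambda>\<omega>. iexp (\<theta> * (lam * (\<Sum>t\<in>{1..int n}. increment w q t (path \<omega>))))) - of_real (exp (- \<theta>\<^sup>2 * V / 2))) \<le>
     real n * (\<theta>\<^sup>2 / 2 * (\<bar>\<theta>\<bar> * (sqrt (2 * m4\<^sup>2 * (lam\<^sup>2 * (real q * real n * W))) * sqrt (2 * \<beta>\<^sup>2))
         + lam\<^sup>2 * (W * sqrt (3 * real n * B) + 2 * sqrt (2 * B * ((real n)\<^sup>2 * W))))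
      + \<bar>\<theta>\<bar> ^ 3 / 6 * (sqrt \<beta> * \<beta>) + \<theta> ^ 4 * \<beta>\<^sup>2 / 8)"
proof -
  define N where "N i = real (card {int q + 1..int i + 1 - int q - 1})" for i
  define v where "v i = lam\<^sup>2 * (N i * W * kappa\<^sup>2)" for i
  define Z where "Z i \<omega> = lam * increment w q (int i + 1) (path \<omega>)" for i \<omega>
  have W0: "W \<ge> 0" unfolding W_def by (intro sum_nonneg) simp
  have beta0: "\<beta> \<ge> 0" unfolding \<beta>_def using W0 by simp
  have sumZ: "(\<Sum>l<i. Z l \<omega>) = lam * (\<Sum>t\<in>{1..int i}. increment w q t (path \<omega>))" for i \<omega>
  proof -
    have "{1..int i} = (\<lambda>l. int l + 1) ` {..<i}"
    proof (intro equalityI subsetI)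
      fix x assume "x \<in> {1..int i}"
      then have "x = int (nat (x - 1)) + 1" "nat (x - 1) < i" by auto
      then show "x \<in> (\<lambda>l. int l + 1) ` {..<i}" by blast
    qed auto
    then show ?thesis by (simp add: Z_def sum_distrib_left sum.reindex inj_on_def)
  qed
  have Zq: "quart_integrable (Z i)" for i
    unfolding Z_def by (intro quart_integrable_cmult increment_fourth_moment)
  have Z4: "expectation (\<lambda>\<omega>. Z i \<omega> ^ 4) \<le> \<beta>\<^sup>2" if "i < n" for i
  proof -
    have "expectation (\<lambda>\<omega>. Z i \<omega> ^ 4) = lam ^ 4 * expectation (\<lambda>\<omega>. increment w q (int i + 1) (path \<omega>) ^ 4)"
      by (simp add: Z_def power_mult_distrib)
    also have "\<dots> \<le> lam ^ 4 * (9 * m4 ^ 4 * (real (nat (int i + 1)) * W)\<^sup>2)"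
      unfolding W_def by (intro mult_left_mono increment_fourth_moment) auto
    also have "\<dots> \<le> lam ^ 4 * (9 * m4 ^ 4 * (real n * W)\<^sup>2)"
      using that W0 by (intro mult_left_mono power_mono mult_right_mono) auto
    also have "\<dots> = \<beta>\<^sup>2" by (simp add: \<beta>_def power_mult_distrib flip: power_mult)
    finally show ?thesis .
  qed
  have Z2: "expectation (\<lambda>\<omega>. (Z i \<omega>)\<^sup>2) \<le> \<beta>" if "i < n" for i
  proof -
    have "expectation (\<lambda>\<omega>. \<bar>(Z i \<omega>)\<^sup>2\<bar>) \<le> sqrt (expectation (\<lambda>\<omega>. ((Z i \<omega>)\<^sup>2)\<^sup>2))"
      by (rule expectation_abs_le_sqrt[OF quart_integrable_square[OF Zq]])
    also have "\<dots> \<le> sqrt (\<beta>\<^sup>2)" using Z4[OF that] by (intro real_sqrt_le_mono) (simp flip: power_mult)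
    finally show ?thesis using beta0 by simp
  qed
  have Z3: "expectation (\<lambda>\<omega>. \<bar>Z i \<omega>\<bar> ^ 3) \<le> sqrt \<beta> * \<beta>" if "i < n" for i
  proof -
    have "expectation (\<lambda>\<omega>. \<bar>Z i \<omega> * (Z i \<omega>)\<^sup>2\<bar>) \<le> sqrt (expectation (\<lambda>\<omega>. (Z i \<omega>)\<^sup>2)) * sqrt (expectation (\<lambda>\<omega>. ((Z i \<omega>)\<^sup>2)\<^sup>2))"
      by (rule cauchy_schwarz_expectation[OF quart_integrable_sq[OF Zq] quart_integrable_square[OF Zq]])
    also have "\<dots> \<le> sqrt \<beta> * sqrt (\<beta>\<^sup>2)"
      using Z4[OF that] Z2[OF that] beta0 by (intro mult_mono real_sqrt_le_mono) (auto simp flip: power_mult)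
    finally have le: "expectation (\<lambda>\<omega>. \<bar>Z i \<omega> * (Z i \<omega>)\<^sup>2\<bar>) \<le> sqrt \<beta> * \<beta>" using beta0 by simp
    have "\<bar>z * z\<^sup>2\<bar> = \<bar>z\<bar> ^ 3" for z :: real
    proof -
      have "z * z\<^sup>2 = z ^ 3" by (simp add: power2_eq_square power3_eq_cube)
      then show ?thesis by (simp only: power_abs)
    qed
    with le show ?thesis by simp
  qed
  have Nn: "N i \<le> real n" if "i < n" for i using that by (simp add: N_def)
  have v0: "v i \<ge> 0" for i using W0 by (simp add: v_def N_def)
  have vb: "v i \<le> \<beta>" if "i < n" for i
  proof -
    have "kappa\<^sup>2 \<le> m4\<^sup>2" using kappa_nonneg kappa_le by (intro power_mono)
    then have "N i * W * kappa\<^sup>2 \<le> real n * W * m4\<^sup>2" using Nn[OF that] W0 by (intro mult_mono) auto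
    then have "v i \<le> lam\<^sup>2 * (real n * W * m4\<^sup>2)" unfolding v_def by (intro mult_left_mono) auto
    also have "\<dots> \<le> \<beta>" using W0 by (simp add: \<beta>_def mult_ac)
    finally show ?thesis .
  qed
  define h where "h i \<omega> = iexp (\<theta> * (\<Sum>l<i. Z l \<omega>))" for i \<omega>
  define hp where "hp i = (\<lambda>x. iexp (\<theta> * (lam * (\<Sum>t\<in>{1..int i}. increment w q t x))))" for i
  have hhp: "h i \<omega> = hp i (path \<omega>)" for i \<omega> by (simp add: h_def hp_def sumZ)
  have hp_m [measurable]: "hp i \<in> borel_measurable paths" for i unfolding hp_def by measurable
  have hp_b: "norm (hp i x) \<le> 1" for i x by (simp add: hp_def)
  have hp_upd: "hp i (x(r := y)) = hp i x" if "r > int i" for i r x y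
  proof -
    have "(\<Sum>t\<in>{1..int i}. increment w q t (x(r := y))) = (\<Sum>t\<in>{1..int i}. increment w q t x)"
      using that by (intro sum.cong refl increment_upd) auto
    then show ?thesis unfolding hp_def by (simp only:)
  qed
  have bnd: "integrable M (\<lambda>\<omega>. of_real (f \<omega>) * g (path \<omega>))"
    if "integrable M f" "g \<in> borel_measurable paths" "\<And>x. norm (g x) \<le> 1" for f and g :: "_ \<Rightarrow> complex"
  proof (rule Bochner_Integration.integrable_bound[OF that(1)])
    show "(\<lambda>\<omega>. of_real (f \<omega>) * g (path \<omega>)) \<in> borel_measurable M" using that by measurable
    show "AE \<omega> in M. norm (of_real (f \<omega>) * g (path \<omega>)) \<le> norm (f \<omega>)"
      using that(3) by (auto simp: norm_mult intro!: mult_left_le)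
  qed
  have main: "norm (expectation (\<lambda>\<omega>. of_real ((Z i \<omega>)\<^sup>2 - v i) * h i \<omega>)) \<le>
      \<bar>\<theta>\<bar> * (sqrt (2 * m4\<^sup>2 * (lam\<^sup>2 * (real q * real n * W))) * sqrt (2 * \<beta>\<^sup>2))
         + lam\<^sup>2 * (W * sqrt (3 * real n * B) + 2 * sqrt (2 * B * ((real n)\<^sup>2 * W)))" if i: "i < n" for i
  proof -
    define Y where "Y \<omega> = (Z i \<omega>)\<^sup>2 - v i" for \<omega>
    have Ysq: "sq_integrable Y" unfolding Y_def
      by (intro sq_integrable_diff quart_integrable_square Zq) simp
    have Yint: "integrable M Y" by (rule sq_integrable_integrable[OF Ysq])
    have Ym [measurable]: "Y \<in> borel_measurable M" using Ysq by (simp add: sq_integrable_def)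
    have EY2: "expectation (\<lambda>\<omega>. (Y \<omega>)\<^sup>2) \<le> 2 * \<beta>\<^sup>2"
    proof -
      have "expectation (\<lambda>\<omega>. (Y \<omega>)\<^sup>2) \<le> expectation (\<lambda>\<omega>. Z i \<omega> ^ 4 + (v i)\<^sup>2)"
      proof (rule integral_mono)
        show "(Y \<omega>)\<^sup>2 \<le> Z i \<omega> ^ 4 + (v i)\<^sup>2" for \<omega>
          using v0[of i] by (simp add: Y_def power2_diff flip: power_mult)
      qed (use Ysq Zq[of i] in \<open>auto simp: sq_integrable_def quart_integrable_def\<close>)
      also have "\<dots> \<le> \<beta>\<^sup>2 + \<beta>\<^sup>2"
        using add_mono[OF Z4[OF i] power_mono[OF vb[OF i] v0, of 2]] Zq[of i]
        by (simp add: quart_integrable_def prob_space)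
      finally show ?thesis by simp
    qed
    \<comment> \<open>the partial sum up to \<open>i - q\<close> depends only on variables before \<open>t - q\<close>, where \<open>t = i + 1\<close>; for \<open>i < q\<close> truncated subtraction makes it empty\<close>
    define i' where "i' = i - q"
    define A where "A = {int i' + 1..int i}"
    define X where "X \<omega> = lam * (\<Sum>t\<in>A. increment w q t (path \<omega>))" for \<omega>
    have Xdef: "(\<Sum>l<i. Z l \<omega>) - (\<Sum>l<i'. Z l \<omega>) = X \<omega>" for \<omega>
    proof -
      have "{1..int i} = {1..int i'} \<union> A" "{1..int i'} \<inter> A = {}" by (auto simp: A_def i'_def)
      then have "(\<Sum>t\<in>{1..int i}. increment w q t (path \<omega>)) =
         (\<Sum>t\<in>{1..int i'}. increment w q t (path \<omega>)) + (\<Sum>t\<in>A. increment w q t (path \<omega>))"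
        by (simp add: sum.union_disjoint A_def)
      then show ?thesis by (simp add: sumZ X_def distrib_left)
    qed
    have A: "finite A" "\<And>t. t \<in> A \<Longrightarrow> t \<le> int n" using i by (auto simp: A_def)
    have cA: "real (card A) \<le> real q" by (simp add: A_def i'_def)
    have Xsq: "sq_integrable X" unfolding X_def by (intro sq_integrable_cmult increments_variance[OF _ A]) simp
    have EX2: "expectation (\<lambda>\<omega>. (X \<omega>)\<^sup>2) \<le> 2 * m4\<^sup>2 * (lam\<^sup>2 * (real q * real n * W))"
    proof -
      have "expectation (\<lambda>\<omega>. (X \<omega>)\<^sup>2) = lam\<^sup>2 * expectation (\<lambda>\<omega>. (\<Sum>t\<in>A. increment w q t (path \<omega>))\<^sup>2)"
        by (simp add: X_def power_mult_distrib)
      also have "\<dots> \<le> lam\<^sup>2 * (2 * m4\<^sup>2 * (real (card A) * real n * W))"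
        unfolding W_def by (intro mult_left_mono increments_variance[OF _ A]) auto
      also have "\<dots> \<le> lam\<^sup>2 * (2 * m4\<^sup>2 * (real q * real n * W))"
        using cA W0 by (intro mult_left_mono mult_right_mono) auto
      finally show ?thesis by (simp add: mult_ac)
    qed
    have i1: "integrable M (\<lambda>\<omega>. of_real (Y \<omega>) * h l \<omega>)" for l
      unfolding hhp by (intro bnd Yint hp_m hp_b)
    have hm: "h l \<in> borel_measurable M" for l unfolding hhp[abs_def] by measurable
    have "norm (expectation (\<lambda>\<omega>. of_real (Y \<omega>) * h i \<omega>) - expectation (\<lambda>\<omega>. of_real (Y \<omega>) * h i' \<omega>)) =
       norm (expectation (\<lambda>\<omega>. of_real (Y \<omega>) * (h i \<omega> - h i' \<omega>)))"
      using i1[of i] i1[of i'] by (simp add: right_diff_distrib)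
    also have "\<dots> \<le> expectation (\<lambda>\<omega>. norm (of_real (Y \<omega>) * (h i \<omega> - h i' \<omega>)))"
      by (rule integral_norm_bound)
    also have "\<dots> \<le> expectation (\<lambda>\<omega>. \<bar>\<theta>\<bar> * \<bar>X \<omega> * Y \<omega>\<bar>)"
    proof (rule integral_mono)
      show "integrable M (\<lambda>\<omega>. norm (of_real (Y \<omega>) * (h i \<omega> - h i' \<omega>)))"
        using i1[of i] i1[of i'] by (simp add: right_diff_distrib)
      show "integrable M (\<lambda>\<omega>. \<bar>\<theta>\<bar> * \<bar>X \<omega> * Y \<omega>\<bar>)" using sq_integrable_mult[OF Xsq Ysq] by simp
      fix \<omega>
      have "norm (h i \<omega> - h i' \<omega>) \<le> \<bar>\<theta> * (\<Sum>l<i. Z l \<omega>) - \<theta> * (\<Sum>l<i'. Z l \<omega>)\<bar>"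
        unfolding h_def by (rule iexp_diff_le)
      also have "\<dots> = \<bar>\<theta>\<bar> * \<bar>X \<omega>\<bar>" unfolding Xdef[symmetric] abs_mult[symmetric] by (simp add: right_diff_distrib)
      finally show "norm (of_real (Y \<omega>) * (h i \<omega> - h i' \<omega>)) \<le> \<bar>\<theta>\<bar> * \<bar>X \<omega> * Y \<omega>\<bar>"
        by (simp add: norm_mult abs_mult mult.commute[of "\<bar>Y \<omega>\<bar>"] mult.assoc[symmetric] mult_right_mono)
    qed
    also have "\<dots> = \<bar>\<theta>\<bar> * expectation (\<lambda>\<omega>. \<bar>X \<omega> * Y \<omega>\<bar>)" by simp
    also have "\<dots> \<le> \<bar>\<theta>\<bar> * (sqrt (2 * m4\<^sup>2 * (lam\<^sup>2 * (real q * real n * W))) * sqrt (2 * \<beta>\<^sup>2))"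
      using EX2 EY2 W0 by (intro mult_left_mono order_trans[OF cauchy_schwarz_expectation[OF Xsq Ysq]] mult_mono real_sqrt_le_mono) auto
    finally have 1: "norm (expectation (\<lambda>\<omega>. of_real (Y \<omega>) * h i \<omega>) - expectation (\<lambda>\<omega>. of_real (Y \<omega>) * h i' \<omega>)) \<le>
      \<bar>\<theta>\<bar> * (sqrt (2 * m4\<^sup>2 * (lam\<^sup>2 * (real q * real n * W))) * sqrt (2 * \<beta>\<^sup>2))" .
    note cc = condvar_concentration[where w = w and q = "int q" and t = "int i + 1", OF w, folded N_def W_def B_def]
    have upd: "hp i' (x(r := y)) = hp i' x" if "r \<ge> int i + 1 - int q" for r x y
    proof (cases "i \<ge> q")
      case True then show ?thesis using that by (intro hp_upd) (simp add: i'_def)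
    next
      case False then show ?thesis by (simp add: hp_def i'_def)
    qed
    have E2: "expectation (\<lambda>\<omega>. of_real ((increment w q (int i + 1) (path \<omega>))\<^sup>2) * hp i' (path \<omega>)) =
        expectation (\<lambda>\<omega>. of_real (condvar w q (int i + 1) (path \<omega>)) * hp i' (path \<omega>))"
      by (rule increment_condvar[OF hp_m hp_b upd])
    have ci: "integrable M (\<lambda>\<omega>. condvar w q (int i + 1) (path \<omega>))" by (rule cc(1))
    have ii: "integrable M (\<lambda>\<omega>. (increment w q (int i + 1) (path \<omega>))\<^sup>2)"
      using quart_integrable_sq[OF increment_fourth_moment(1)] by (simp add: sq_integrable_def)
    have ch: "integrable M (\<lambda>\<omega>. hp i' (path \<omega>))" using bnd[of "\<lambda>_. 1", OF _ hp_m hp_b] by simp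
    have "expectation (\<lambda>\<omega>. of_real (Y \<omega>) * h i' \<omega>) =
       expectation (\<lambda>\<omega>. of_real (lam\<^sup>2) * (of_real ((increment w q (int i + 1) (path \<omega>))\<^sup>2) * hp i' (path \<omega>)) - of_real (v i) * hp i' (path \<omega>))"
      by (simp add: Y_def Z_def hhp power_mult_distrib algebra_simps)
    also have "\<dots> = of_real (lam\<^sup>2) * expectation (\<lambda>\<omega>. of_real ((increment w q (int i + 1) (path \<omega>))\<^sup>2) * hp i' (path \<omega>)) - of_real (v i) * expectation (\<lambda>\<omega>. hp i' (path \<omega>))"
      using bnd[OF ii hp_m hp_b] ch by simp
    also have "\<dots> = of_real (lam\<^sup>2) * expectation (\<lambda>\<omega>. of_real (condvar w q (int i + 1) (path \<omega>)) * hp i' (path \<omega>)) - of_real (v i) * expectation (\<lambda>\<omega>. hp i' (path \<omega>))"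
      unfolding E2 ..
    also have "\<dots> = expectation (\<lambda>\<omega>. of_real (lam\<^sup>2 * (condvar w q (int i + 1) (path \<omega>) - N i * W * kappa\<^sup>2)) * hp i' (path \<omega>))"
    proof -
      have "of_real (lam\<^sup>2 * (condvar w q (int i + 1) x - N i * W * kappa\<^sup>2)) * hp i' x =
         of_real (lam\<^sup>2) * (of_real (condvar w q (int i + 1) x) * hp i' x) - of_real (v i) * hp i' x" for x
        by (simp add: v_def algebra_simps)
      then show ?thesis using bnd[OF ci hp_m hp_b] ch by simp
    qed
    also have "norm \<dots> \<le> expectation (\<lambda>\<omega>. norm (of_real (lam\<^sup>2 * (condvar w q (int i + 1) (path \<omega>) - N i * W * kappa\<^sup>2)) * hp i' (path \<omega>)))"
      by (rule integral_norm_bound)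
    also have "\<dots> \<le> expectation (\<lambda>\<omega>. lam\<^sup>2 * \<bar>condvar w q (int i + 1) (path \<omega>) - N i * W * kappa\<^sup>2\<bar>)"
    proof (rule integral_mono)
      show "integrable M (\<lambda>\<omega>. norm (of_real (lam\<^sup>2 * (condvar w q (int i + 1) (path \<omega>) - N i * W * kappa\<^sup>2)) * hp i' (path \<omega>)))"
        using ci by (intro integrable_norm bnd hp_m hp_b) auto
      show "norm (of_real (lam\<^sup>2 * (condvar w q (int i + 1) (path \<omega>) - N i * W * kappa\<^sup>2)) * hp i' (path \<omega>)) \<le>
        lam\<^sup>2 * \<bar>condvar w q (int i + 1) (path \<omega>) - N i * W * kappa\<^sup>2\<bar>" for \<omega>
        unfolding norm_mult norm_of_real using hp_b by (simp add: abs_mult mult_left_le)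
    qed (use ci in auto)
    also have "\<dots> = lam\<^sup>2 * expectation (\<lambda>\<omega>. \<bar>condvar w q (int i + 1) (path \<omega>) - N i * W * kappa\<^sup>2\<bar>)" by simp
    also have "\<dots> \<le> lam\<^sup>2 * (W * sqrt (3 * N i * B) + 2 * sqrt (2 * B * ((N i)\<^sup>2 * W)))"
      by (rule mult_left_mono[OF cc(2) zero_le_power2])
    also have "\<dots> \<le> lam\<^sup>2 * (W * sqrt (3 * real n * B) + 2 * sqrt (2 * B * ((real n)\<^sup>2 * W)))"
    proof -
      have "B \<ge> 0" using sigma2_nonneg by (simp add: B_def)
      then show ?thesis using W0 Nn[OF i]
        by (intro mult_left_mono[OF _ zero_le_power2] add_mono real_sqrt_le_mono mult_right_mono mult_left_mono power_mono)
          (auto simp: N_def)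
    qed
    finally have 2: "norm (expectation (\<lambda>\<omega>. of_real (Y \<omega>) * h i' \<omega>)) \<le>
       lam\<^sup>2 * (W * sqrt (3 * real n * B) + 2 * sqrt (2 * B * ((real n)\<^sup>2 * W)))" .
    have "norm (expectation (\<lambda>\<omega>. of_real (Y \<omega>) * h i \<omega>)) \<le>
      norm (expectation (\<lambda>\<omega>. of_real (Y \<omega>) * h i \<omega>) - expectation (\<lambda>\<omega>. of_real (Y \<omega>) * h i' \<omega>)) +
      norm (expectation (\<lambda>\<omega>. of_real (Y \<omega>) * h i' \<omega>))" using norm_triangle_ineq[of "expectation (\<lambda>\<omega>. of_real (Y \<omega>) * h i \<omega>) - expectation (\<lambda>\<omega>. of_real (Y \<omega>) * h i' \<omega>)"
         "expectation (\<lambda>\<omega>. of_real (Y \<omega>) * h i' \<omega>)"] by simp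
    then show ?thesis using 1 2 unfolding Y_def by linarith
  qed
  have "norm (expectation (\<lambda>\<omega>. iexp (\<theta> * (\<Sum>l<n. Z l \<omega>))) - of_real (exp (- \<theta>\<^sup>2 * (\<Sum>l<n. v l) / 2))) \<le>
    real n * (\<theta>\<^sup>2 / 2 * (\<bar>\<theta>\<bar> * (sqrt (2 * m4\<^sup>2 * (lam\<^sup>2 * (real q * real n * W))) * sqrt (2 * \<beta>\<^sup>2))
         + lam\<^sup>2 * (W * sqrt (3 * real n * B) + 2 * sqrt (2 * B * ((real n)\<^sup>2 * W))))
      + \<bar>\<theta>\<bar> ^ 3 / 6 * (sqrt \<beta> * \<beta>) + \<theta> ^ 4 * \<beta>\<^sup>2 / 8)"
  proof (rule char_martingale_bound, fold h_def)
    fix i assume i: "i < n"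
    show "quart_integrable (Z i)" by (rule Zq)
    show "v i \<ge> 0" by (rule v0)
    have "expectation (\<lambda>\<omega>. of_real (increment w q (int i + 1) (path \<omega>)) * hp i (path \<omega>)) = 0"
      by (rule increment_martingale[OF hp_m hp_b hp_upd]) simp
    then show "expectation (\<lambda>\<omega>. of_real (Z i \<omega>) * h i \<omega>) = 0"
      by (simp add: Z_def hhp mult.assoc)
    show "\<theta>\<^sup>2 / 2 * norm (expectation (\<lambda>\<omega>. of_real ((Z i \<omega>)\<^sup>2 - v i) * h i \<omega>))
      + \<bar>\<theta>\<bar> ^ 3 / 6 * expectation (\<lambda>\<omega>. \<bar>Z i \<omega>\<bar> ^ 3) + \<theta> ^ 4 * (v i)\<^sup>2 / 8 \<le>
      \<theta>\<^sup>2 / 2 * (\<bar>\<theta>\<bar> * (sqrt (2 * m4\<^sup>2 * (lam\<^sup>2 * (real q * real n * W))) * sqrt (2 * \<beta>\<^sup>2))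
         + lam\<^sup>2 * (W * sqrt (3 * real n * B) + 2 * sqrt (2 * B * ((real n)\<^sup>2 * W))))
      + \<bar>\<theta>\<bar> ^ 3 / 6 * (sqrt \<beta> * \<beta>) + \<theta> ^ 4 * \<beta>\<^sup>2 / 8"
      using main[OF i] Z3[OF i] vb[OF i] v0[of i]
      by (intro add_mono mult_left_mono divide_right_mono power_mono) auto
  qed
  moreover have "(\<Sum>l<n. v l) = V" by (simp add: v_def V_def N_def sum_distrib_left mult_ac)
  ultimately show ?thesis by (simp add: sumZ)
qed

end

section \<open>Kernel sums\<close>

text \<open>Comparison with the integral: by the mean value theorem each summand is at most a difference of values of
\<open>x powr (1 - a) / (a - 1)\<close>, so the sum telescopes.\<close>

lemma sum_powr_tail:
  fixes a :: real
  assumes a: "a > 1" and m: "m \<ge> (1::nat)"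
  shows "(\<Sum>j = m + 1..n. real j powr (- a)) \<le> real m powr (1 - a) / (a - 1)"
proof (cases "m \<le> n")
  case True
  have "(\<Sum>j = m + 1..n. real j powr (- a)) \<le> (real m powr (1 - a) - real n powr (1 - a)) / (a - 1)"
    using True
  proof (induction n rule: dec_induct)
    case base then show ?case by simp
  next
    case (step n)
    have n: "real n > 0" using step m by simp
    have "\<exists>z. real n < z \<and> z < real (Suc n) \<and>
        real (Suc n) powr (1 - a) - real n powr (1 - a) = (real (Suc n) - real n) * ((1 - a) * z powr (1 - a - 1))"
      using n by (intro MVT2) (auto intro!: derivative_eq_intros)
    then obtain z where z: "real n < z" "z < real (Suc n)"
      and eq: "real (Suc n) powr (1 - a) - real n powr (1 - a) = (1 - a) * z powr (- a)" by auto
    have "real (Suc n) powr (- a) \<le> z powr (- a)"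
      using z n a by (intro powr_mono2') auto
    then have "(a - 1) * real (Suc n) powr (- a) \<le> (a - 1) * z powr (- a)" using a by (intro mult_left_mono) auto
    also have "\<dots> = real n powr (1 - a) - real (Suc n) powr (1 - a)" using eq by (simp add: algebra_simps)
    finally have "real (Suc n) powr (- a) \<le> (real n powr (1 - a) - real (Suc n) powr (1 - a)) / (a - 1)"
      using a by (simp add: field_simps)
    moreover have "(\<Sum>j = m + 1..Suc n. real j powr (- a)) = (\<Sum>j = m + 1..n. real j powr (- a)) + real (Suc n) powr (- a)"
      using step by simp
    ultimately show ?case using step.IH by (simp add: diff_divide_distrib)
  qed
  also have "\<dots> \<le> real m powr (1 - a) / (a - 1)" using a by (intro divide_right_mono) auto
  finally show ?thesis .
qed (use a in auto)

locale lag_kernel =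
  fixes k :: "real \<Rightarrow> real" and \<alpha> :: real
  assumes k_range: "\<And>x. k x \<in> {-1..1}"
    and k_cont_zero: "isCont k 0" and k_zero: "k 0 = 1"
    and \<alpha>: "\<alpha> > 1 / 2" and k_decay: "k \<in> O[at_top](\<lambda>x. x powr (- \<alpha>))"
begin

lemma k_sq_le_1: "(k x)\<^sup>2 \<le> 1"
  using k_range[of x] abs_square_le_1[of "k x"] by (simp add: abs_le_iff)

text \<open>The decay of \<open>k\<close> is square summable because \<open>2 \<alpha> > 1\<close>. For \<open>m\<close> much larger than \<open>p\<close> the bound is \<open>o(p)\<close>.\<close>

lemma kernel_tail:
  obtains B X :: real where "B \<ge> 0" "X \<ge> 1"
    "\<And>p m n. p > 0 \<Longrightarrow> m \<ge> 1 \<Longrightarrow> real m \<ge> X * p \<Longrightarrow>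
      (\<Sum>j = m + 1..n. (k (real j / p))\<^sup>2) \<le> B * p * (real m / p) powr (1 - 2 * \<alpha>)"
proof -
  from k_decay obtain c where c: "c > 0" "\<forall>\<^sub>F x in at_top. norm (k x) \<le> c * norm (x powr (- \<alpha>))"
    by (elim landau_o.bigE)
  then obtain X0 where X0: "\<And>x. x \<ge> X0 \<Longrightarrow> \<bar>k x\<bar> \<le> c * x powr (- \<alpha>)"
    unfolding eventually_at_top_linorder by auto
  define X where "X = max X0 1"
  define B where "B = c\<^sup>2 / (2 * \<alpha> - 1)"
  have B: "B \<ge> 0" using \<alpha> by (simp add: B_def)
  have "(\<Sum>j = m + 1..n. (k (real j / p))\<^sup>2) \<le> B * p * (real m / p) powr (1 - 2 * \<alpha>)"
    if p: "p > 0" and m: "m \<ge> 1" and mX: "real m \<ge> X * p" for p :: real and m n :: nat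
  proof -
    have "(k (real j / p))\<^sup>2 \<le> c\<^sup>2 * p powr (2 * \<alpha>) * real j powr (- (2 * \<alpha>))" if "j \<in> {m + 1..n}" for j
    proof -
      have "X * p \<le> real j" using mX that by simp
      then have "X0 \<le> real j / p" using p by (simp add: X_def field_simps)
        (metis max.cobounded1 mult.commute mult_right_mono order.trans less_imp_le)
      then have "\<bar>k (real j / p)\<bar> \<le> c * (real j / p) powr (- \<alpha>)" by (rule X0)
      then have "\<bar>k (real j / p)\<bar>\<^sup>2 \<le> (c * (real j / p) powr (- \<alpha>))\<^sup>2" by (intro power_mono) auto
      also have "\<dots> = c\<^sup>2 * (real j / p) powr (- (2 * \<alpha>))"
        using p by (simp add: power_mult_distrib power2_eq_square flip: powr_add)
      also have "(real j / p) powr (- (2 * \<alpha>)) = p powr (2 * \<alpha>) * real j powr (- (2 * \<alpha>))"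
        using p that m by (simp add: powr_divide powr_minus field_simps)
      finally show ?thesis by (simp add: mult.assoc)
    qed
    then have "(\<Sum>j = m + 1..n. (k (real j / p))\<^sup>2) \<le> (\<Sum>j = m + 1..n. c\<^sup>2 * p powr (2 * \<alpha>) * real j powr (- (2 * \<alpha>)))"
      by (rule sum_mono)
    also have "\<dots> \<le> c\<^sup>2 * p powr (2 * \<alpha>) * (real m powr (1 - 2 * \<alpha>) / (2 * \<alpha> - 1))"
      unfolding sum_distrib_left[symmetric] using sum_powr_tail[of "2 * \<alpha>" m n] \<alpha> m by (intro mult_left_mono) auto
    also have "\<dots> = B * (p powr (2 * \<alpha>) * real m powr (1 - 2 * \<alpha>))" by (simp add: B_def)
    also have "p powr (2 * \<alpha>) * real m powr (1 - 2 * \<alpha>) = p * (real m / p) powr (1 - 2 * \<alpha>)"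
      using p m by (simp add: powr_divide powr_diff field_simps)
    finally show ?thesis by (simp add: mult.assoc)
  qed
  then show ?thesis using B by (intro that[of B X]) (auto simp: X_def)
qed

lemma kernel_sum_bounded:
  obtains C :: real where "C > 0" "\<And>p n. p \<ge> 1 \<Longrightarrow> (\<Sum>j = 1..n. (k (real j / p))\<^sup>2) \<le> C * p"
proof -
  obtain B X :: real where B: "B \<ge> 0" and X: "X \<ge> 1" and tail: "\<And>p m n. p > 0 \<Longrightarrow> m \<ge> 1 \<Longrightarrow> real m \<ge> X * p \<Longrightarrow>
      (\<Sum>j = m + 1..n. (k (real j / p))\<^sup>2) \<le> B * p * (real m / p) powr (1 - 2 * \<alpha>)" by (rule kernel_tail) blast
  have "(\<Sum>j = 1..n. (k (real j / p))\<^sup>2) \<le> (X + 1 + B) * p" if p: "p \<ge> 1" for p :: real and n :: nat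
  proof -
    define m where "m = nat \<lceil>X * p\<rceil>"
    have Xp: "X * p \<ge> 1" using X p by (simp add: mult_ge1_I)
    have m: "real m \<ge> X * p" "real m \<le> X * p + 1" "m \<ge> 1" using Xp unfolding m_def by linarith+
    have "(\<Sum>j = 1..n. (k (real j / p))\<^sup>2) \<le> (\<Sum>j\<in>{1..m} \<union> {m + 1..n}. (k (real j / p))\<^sup>2)"
      by (intro sum_mono2) auto
    also have "\<dots> = (\<Sum>j = 1..m. (k (real j / p))\<^sup>2) + (\<Sum>j = m + 1..n. (k (real j / p))\<^sup>2)"
      by (subst sum.union_disjoint) auto
    also have "\<dots> \<le> (\<Sum>j = 1..m. 1) + B * p * (real m / p) powr (1 - 2 * \<alpha>)"
      using p m by (intro add_mono sum_mono k_sq_le_1 tail) auto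
    also have "(real m / p) powr (1 - 2 * \<alpha>) \<le> 1"
    proof -
      have "1 \<le> real m / p" using m(1) p X by (simp add: field_simps)
        (metis mult.commute mult_left_mono mult.right_neutral order.trans less_imp_le zero_less_one order_less_le_trans)
      then show ?thesis using \<alpha> powr_mono2'[of "1 - 2 * \<alpha>" 1 "real m / p"] by (simp add: powr_le_one_le)
    qed
    also have "(\<Sum>j = 1..m. 1) + B * p * 1 \<le> (X + 1 + B) * p"
      using m p by (simp add: algebra_simps)
    finally show ?thesis using B p by (simp add: mult_left_mono)
  qed
  then show ?thesis using B X by (intro that[of "X + 1 + B"]) auto
qed

text \<open>Continuity at zero keeps \<open>k\<close> above \<open>9/10\<close> on an interval, which contributes a number of lags proportional to \<open>p\<close>.\<close>

lemma D_coeff_lower: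
  obtains c P :: real where "c > 0" "P \<ge> 1"
    "\<And>p n. p \<ge> P \<Longrightarrow> p \<le> real n / 2 \<Longrightarrow> n \<ge> 4 \<Longrightarrow> D_coeff k p n \<ge> c * p"
proof -
  obtain d where d: "d > 0" "\<And>x. \<bar>x\<bar> < d \<Longrightarrow> \<bar>k x - 1\<bar> < 1 / 10"
    using k_cont_zero k_zero unfolding continuous_at_eps_delta
    by (metis dist_real_def diff_zero zero_less_divide_1_iff zero_less_numeral)
  define \<delta> where "\<delta> = min (d / 2) (1 / 2)"
  have \<delta>: "\<delta> > 0" "\<delta> \<le> 1 / 2" "\<delta> < d" using d(1) by (auto simp: \<delta>_def)
  have "D_coeff k p n \<ge> (\<delta> / 16) * p" if p: "p \<ge> max 1 (1 / \<delta>)" and pn: "p \<le> real n / 2" and n: "n \<ge> 4" for p :: real and n :: nat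
  proof -
    define m where "m = nat \<lfloor>\<delta> * p\<rfloor>"
    have p0: "p > 0" using p by simp
    have dp: "\<delta> * p \<ge> 1" using p \<delta> by (simp add: field_simps)
    have m: "real m \<le> \<delta> * p" "real m \<ge> \<delta> * p / 2"
    proof -
      have "\<lfloor>\<delta> * p\<rfloor> \<ge> 1" using dp by linarith
      then show "real m \<le> \<delta> * p" "real m \<ge> \<delta> * p / 2" unfolding m_def by linarith+
    qed
    have "\<delta> * p \<le> 1 / 2 * (real n / 2)" using \<delta> pn p0 by (intro mult_mono) auto
    then have mn: "real m \<le> real n / 4" using m by simp
    have mn2: "m \<le> n - 2" using mn n by linarith
    have "(\<delta> / 16) * p \<le> real m * (1 / 8)" using m by simp
    also have "\<dots> = (\<Sum>j = 1..m. 1 / 8)" by simp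
    also have "\<dots> \<le> (\<Sum>j = 1..m. (1 - real j / real n) * (1 - real (j + 1) / real n) * (k (real j / p)) ^ 4)"
    proof (rule sum_mono)
      fix j assume j: "j \<in> {1..m}"
      have "real j + 1 \<le> real n / 2" using j mn n by auto
      then have 1: "1 - real (j + 1) / real n \<ge> 1 / 2" "1 - real j / real n \<ge> 1 / 2" using n by (auto simp: field_simps)
      have "real j / p < d"
      proof -
        have "real j / p \<le> \<delta>" using j m p by (auto simp: field_simps)
        then show ?thesis using \<delta> by simp
      qed
      then have "\<bar>real j / p\<bar> < d" using p by simp
      then have "k (real j / p) \<ge> 9 / 10" using d(2)[of "real j / p"] by linarith
      then have "(k (real j / p)) ^ 4 \<ge> (9 / 10) ^ 4" by (intro power_mono) auto
      then have 2: "(k (real j / p)) ^ 4 \<ge> 1 / 2" by (simp add: power4_eq_xxxx)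
      have "1 / 2 * (1 / 2) * (1 / 2) \<le> a * b * c" if "1 / 2 \<le> a" "1 / 2 \<le> b" "1 / 2 \<le> c" for a b c :: real
        using that by (intro mult_mono) auto
      from this[OF 1(2) 1(1) 2] show "1 / 8 \<le> (1 - real j / real n) * (1 - real (j + 1) / real n) * (k (real j / p)) ^ 4" by simp
    qed
    also have "\<dots> \<le> D_coeff k p n" unfolding D_coeff_def
    proof (rule sum_mono2)
      fix j assume "j \<in> {1..n - 2} - {1..m}"
      then have "j + 1 \<le> n" using n by auto
      then have "real (j + 1) / real n \<le> 1" "real j / real n \<le> 1" using n by (auto simp: field_simps)
      then show "0 \<le> (1 - real j / real n) * (1 - real (j + 1) / real n) * (k (real j / p)) ^ 4" by simp
    qed (use mn2 in auto)
    finally show ?thesis .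
  qed
  then show ?thesis using \<delta> by (intro that[of "\<delta> / 16" "max 1 (1 / \<delta>)"]) auto
qed

end

section \<open>A Slutsky argument\<close>

context prob_space begin

lemma char_diff_le:
  assumes [measurable]: "A \<in> borel_measurable M" "B \<in> borel_measurable M" and e: "e \<ge> 0"
  shows "norm (expectation (\<lambda>\<omega>. iexp (\<theta> * A \<omega>)) - expectation (\<lambda>\<omega>. iexp (\<theta> * B \<omega>))) \<le>
    \<bar>\<theta>\<bar> * e + 2 * prob {\<omega>\<in>space M. \<bar>A \<omega> - B \<omega>\<bar> > e}"
proof -
  have int: "integrable M (\<lambda>\<omega>. iexp (\<theta> * X \<omega>))" if [measurable]: "X \<in> borel_measurable M" for X
    by (rule Bochner_Integration.integrable_bound[of M "\<lambda>_. 1::real"]) auto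
  define G where "G = {\<omega>\<in>space M. \<bar>A \<omega> - B \<omega>\<bar> > e}"
  have [measurable]: "G \<in> sets M" unfolding G_def by measurable
  have Gi: "integrable M (\<lambda>\<omega>. indicator G \<omega> :: real)"
    by (rule integrable_real_indicator) (auto simp: emeasure_eq_measure)
  have "norm (expectation (\<lambda>\<omega>. iexp (\<theta> * A \<omega>)) - expectation (\<lambda>\<omega>. iexp (\<theta> * B \<omega>))) =
    norm (expectation (\<lambda>\<omega>. iexp (\<theta> * A \<omega>) - iexp (\<theta> * B \<omega>)))" using int by simp
  also have "\<dots> \<le> expectation (\<lambda>\<omega>. norm (iexp (\<theta> * A \<omega>) - iexp (\<theta> * B \<omega>)))" by (rule integral_norm_bound)
  also have "\<dots> \<le> expectation (\<lambda>\<omega>. \<bar>\<theta>\<bar> * e + 2 * indicator G \<omega>)"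
  proof (rule integral_mono)
    fix \<omega> assume "\<omega> \<in> space M"
    show "norm (iexp (\<theta> * A \<omega>) - iexp (\<theta> * B \<omega>)) \<le> \<bar>\<theta>\<bar> * e + 2 * indicator G \<omega>"
    proof (cases "\<omega> \<in> G")
      case True
      have "norm (iexp (\<theta> * A \<omega>) - iexp (\<theta> * B \<omega>)) \<le> 1 + 1" by (rule order_trans[OF norm_triangle_ineq4]) simp
      moreover have "0 \<le> \<bar>\<theta>\<bar> * e" using e by simp
      moreover have "indicator G \<omega> = (1::real)" using True by simp
      ultimately show ?thesis by linarith
    next
      case False
      then have "\<bar>A \<omega> - B \<omega>\<bar> \<le> e" using \<open>\<omega> \<in> space M\<close> by (simp add: G_def)
      have "norm (iexp (\<theta> * A \<omega>) - iexp (\<theta> * B \<omega>)) \<le> \<bar>\<theta> * A \<omega> - \<theta> * B \<omega>\<bar>" by (rule iexp_diff_le)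
      also have "\<dots> = \<bar>\<theta>\<bar> * \<bar>A \<omega> - B \<omega>\<bar>" by (simp add: abs_mult flip: right_diff_distrib)
      also have "\<dots> \<le> \<bar>\<theta>\<bar> * e" using \<open>\<bar>A \<omega> - B \<omega>\<bar> \<le> e\<close> by (intro mult_left_mono) auto
      finally show ?thesis using False by simp
    qed
  qed (use int Gi in auto)
  also have "\<dots> = \<bar>\<theta>\<bar> * e + 2 * prob G" using Gi by (simp add: prob_space)
  finally show ?thesis by (simp add: G_def)
qed

lemma markov_abs:
  assumes "integrable M X" "a > 0"
  shows "prob {\<omega>\<in>space M. \<bar>X \<omega>\<bar> > a} \<le> expectation (\<lambda>\<omega>. \<bar>X \<omega>\<bar>) / a"
proof -
  have [measurable]: "X \<in> borel_measurable M" using assms by simp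
  have "prob {\<omega>\<in>space M. \<bar>X \<omega>\<bar> > a} \<le> prob {\<omega>\<in>space M. \<bar>X \<omega>\<bar> \<ge> a}"
    by (intro finite_measure_mono) auto
  also have "\<dots> \<le> expectation (\<lambda>\<omega>. \<bar>X \<omega>\<bar>) / a"
    using assms by (intro integral_Markov_inequality_measure[where A = "{}"]) auto
  finally show ?thesis .
qed

text \<open>Off an event of small probability, \<open>X\<close> is close to \<open>Y\<close>, the quotient \<open>\<kappa> / H\<close> is close to one, and \<open>Y\<close> is not too
large; the last point holds because the \<open>Y n\<close> are bounded in \<open>L\<^sup>1\<close>.\<close>

lemma slutsky_char:
  fixes X Y H :: "nat \<Rightarrow> 'a \<Rightarrow> real"
  assumes X: "\<forall>\<^sub>F n in sequentially. integrable M (X n)" and Y: "\<forall>\<^sub>F n in sequentially. integrable M (Y n)"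
    and H: "\<forall>\<^sub>F n in sequentially. integrable M (H n)"
    and XY: "(\<lambda>n. expectation (\<lambda>\<omega>. \<bar>X n \<omega> - Y n \<omega>\<bar>)) \<longlonglongrightarrow> 0"
    and Hk: "(\<lambda>n. expectation (\<lambda>\<omega>. \<bar>H n \<omega> - \<kappa>\<bar>)) \<longlonglongrightarrow> 0" and \<kappa>: "\<kappa> > 0"
    and K: "\<forall>\<^sub>F n in sequentially. expectation (\<lambda>\<omega>. \<bar>Y n \<omega>\<bar>) \<le> K"
    and char: "(\<lambda>n. expectation (\<lambda>\<omega>. iexp (\<theta> * Y n \<omega>))) \<longlonglongrightarrow> c"
  shows "(\<lambda>n. expectation (\<lambda>\<omega>. iexp (\<theta> * (X n \<omega> * \<kappa> / H n \<omega>)))) \<longlonglongrightarrow> c"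
proof -
  have K0: "\<bar>K\<bar> + 1 > 0" by simp
  have "(\<lambda>n. expectation (\<lambda>\<omega>. iexp (\<theta> * (X n \<omega> * \<kappa> / H n \<omega>))) - expectation (\<lambda>\<omega>. iexp (\<theta> * Y n \<omega>))) \<longlonglongrightarrow> 0"
  proof (rule LIMSEQ_I, goal_cases)
    case (1 r)
    define e where "e = r / (4 * (\<bar>\<theta>\<bar> + 1))"
    define d where "d = min (1 / 2) (r * e / (64 * (\<bar>K\<bar> + 1)))"
    have e: "e > 0" using 1 by (simp add: e_def)
    have d: "d > 0" using 1 e by (simp add: d_def)
    have d: "d > 0" "d \<le> 1 / 2" "d \<le> r * e / (64 * (\<bar>K\<bar> + 1))"
      by (fact d) (unfold d_def, rule min.cobounded1, rule min.cobounded2)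
    have \<theta>e: "\<bar>\<theta>\<bar> * e \<le> r / 4" using 1 by (simp add: e_def field_simps)
    have ev1: "\<forall>\<^sub>F n in sequentially. expectation (\<lambda>\<omega>. \<bar>X n \<omega> - Y n \<omega>\<bar>) < r * e / 64"
      using XY 1 e by (intro order_tendstoD(2)) auto
    have ev2: "\<forall>\<^sub>F n in sequentially. expectation (\<lambda>\<omega>. \<bar>H n \<omega> - \<kappa>\<bar>) < r * (d * \<kappa>) / 16"
      using Hk 1 d \<kappa> by (intro order_tendstoD(2)) auto
    have "\<forall>\<^sub>F n in sequentially. norm (expectation (\<lambda>\<omega>. iexp (\<theta> * (X n \<omega> * \<kappa> / H n \<omega>))) - expectation (\<lambda>\<omega>. iexp (\<theta> * Y n \<omega>))) < r"
      using X Y H K ev1 ev2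
    proof eventually_elim
      case (elim n)
      have [measurable]: "X n \<in> borel_measurable M" "Y n \<in> borel_measurable M" "H n \<in> borel_measurable M" using elim by auto
      define T where "T \<omega> = X n \<omega> * \<kappa> / H n \<omega>" for \<omega>
      have [measurable]: "T \<in> borel_measurable M" unfolding T_def by measurable
      define G1 where "G1 = {\<omega>\<in>space M. \<bar>X n \<omega> - Y n \<omega>\<bar> > e / 4}"
      define G2 where "G2 = {\<omega>\<in>space M. \<bar>H n \<omega> - \<kappa>\<bar> > d * \<kappa>}"
      define G3 where "G3 = {\<omega>\<in>space M. \<bar>Y n \<omega>\<bar> > e / (4 * d)}"
      have [measurable]: "G1 \<in> sets M" "G2 \<in> sets M" "G3 \<in> sets M" unfolding G1_def G2_def G3_def by measurable
      have "{\<omega>\<in>space M. \<bar>T \<omega> - Y n \<omega>\<bar> > e} \<subseteq> G1 \<union> G2 \<union> G3"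
      proof (rule ccontr)
        assume "\<not> ?thesis"
        then obtain \<omega> where \<omega>: "\<omega> \<in> space M" "\<bar>T \<omega> - Y n \<omega>\<bar> > e" "\<omega> \<notin> G1" "\<omega> \<notin> G2" "\<omega> \<notin> G3" by blast
        then have 1: "\<bar>X n \<omega> - Y n \<omega>\<bar> \<le> e / 4" and 2: "\<bar>H n \<omega> - \<kappa>\<bar> \<le> d * \<kappa>" and 3: "\<bar>Y n \<omega>\<bar> \<le> e / (4 * d)"
          by (auto simp: G1_def G2_def G3_def)
        define \<rho> where "\<rho> = \<kappa> / H n \<omega>"
        have "d * \<kappa> \<le> \<kappa> / 2" using d \<kappa> by simp
        then have Hpos: "H n \<omega> \<ge> \<kappa> / 2" using 2 by linarith
        then have Hp: "H n \<omega> > 0" using \<kappa> by linarith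
        have \<rho>: "\<bar>\<rho>\<bar> \<le> 2" using Hpos Hp \<kappa> by (simp add: \<rho>_def field_simps)
        have "\<rho> - 1 = (\<kappa> - H n \<omega>) / H n \<omega>" using Hp by (simp add: \<rho>_def field_simps)
        then have "\<bar>\<rho> - 1\<bar> = \<bar>H n \<omega> - \<kappa>\<bar> / H n \<omega>" using Hp by simp
        also have "\<dots> \<le> (d * \<kappa>) / (\<kappa> / 2)" using 2 Hpos \<kappa> d by (intro frac_le) auto
        finally have \<rho>1: "\<bar>\<rho> - 1\<bar> \<le> 2 * d" using \<kappa> by (simp add: mult.commute)
        have "T \<omega> - Y n \<omega> = (X n \<omega> - Y n \<omega>) * \<rho> + Y n \<omega> * (\<rho> - 1)" by (simp add: T_def \<rho>_def algebra_simps)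
        then have "\<bar>T \<omega> - Y n \<omega>\<bar> \<le> \<bar>X n \<omega> - Y n \<omega>\<bar> * \<bar>\<rho>\<bar> + \<bar>Y n \<omega>\<bar> * \<bar>\<rho> - 1\<bar>"
          by (metis abs_mult abs_triangle_ineq)
        also have "\<dots> \<le> e / 4 * 2 + e / (4 * d) * (2 * d)" using 1 3 \<rho> \<rho>1 e d by (intro add_mono mult_mono) auto
        also have "\<dots> = e" using d by simp
        finally show False using \<omega>(2) by simp
      qed
      then have "prob {\<omega>\<in>space M. \<bar>T \<omega> - Y n \<omega>\<bar> > e} \<le> prob (G1 \<union> G2 \<union> G3)" by (intro finite_measure_mono) auto
      also have "\<dots> \<le> prob G1 + prob G2 + prob G3"
        using measure_Un_le[of "G1 \<union> G2" M G3] measure_Un_le[of G1 M G2] by simp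
      also have "prob G1 \<le> expectation (\<lambda>\<omega>. \<bar>X n \<omega> - Y n \<omega>\<bar>) / (e / 4)"
        unfolding G1_def using elim e by (intro markov_abs) auto
      also have "\<dots> \<le> (r * e / 64) / (e / 4)" using elim e by (intro divide_right_mono) auto
      also have "\<dots> = r / 16" using e by simp
      also have "prob G2 \<le> expectation (\<lambda>\<omega>. \<bar>H n \<omega> - \<kappa>\<bar>) / (d * \<kappa>)"
        unfolding G2_def using elim d \<kappa> by (intro markov_abs) auto
      also have "\<dots> \<le> (r * (d * \<kappa>) / 16) / (d * \<kappa>)" using elim d \<kappa> by (intro divide_right_mono) auto
      also have "\<dots> = r / 16" using d \<kappa> by simp
      also have "prob G3 \<le> expectation (\<lambda>\<omega>. \<bar>Y n \<omega>\<bar>) / (e / (4 * d))"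
        unfolding G3_def using elim d e by (intro markov_abs) auto
      also have "\<dots> \<le> (\<bar>K\<bar> + 1) / (e / (4 * d))" using elim d e by (intro divide_right_mono) auto
      also have "\<dots> \<le> r / 16"
      proof -
        have "64 * (\<bar>K\<bar> + 1) * d \<le> r * e" using d(3) K0 by (simp add: field_simps)
        then show ?thesis using e d by (simp add: field_simps)
      qed
      finally have "prob {\<omega>\<in>space M. \<bar>T \<omega> - Y n \<omega>\<bar> > e} \<le> 3 * r / 16" by simp
      then have "\<bar>\<theta>\<bar> * e + 2 * prob {\<omega>\<in>space M. \<bar>T \<omega> - Y n \<omega>\<bar> > e} < r" using \<theta>e \<open>0 < r\<close> by linarith
      then show ?case using char_diff_le[of T "Y n" e \<theta>] e unfolding T_def by (auto intro: order_le_less_trans)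
    qed
    then show ?case by (simp add: eventually_sequentially)
  qed
  from tendsto_add[OF this char] show ?thesis by simp
qed

end

lemma sum_int_shift: "(\<Sum>j\<in>{1..int n}. f j) = (\<Sum>j = 1..n. f (int j))"
proof -
  have "{1..int n} = int ` {1..n}" by (simp add: image_int_atLeastAtMost)
  then show ?thesis by (simp add: sum.reindex)
qed

lemma sum_Un_le:
  fixes f :: "'i \<Rightarrow> real"
  assumes "finite A" "finite B" "\<And>i. f i \<ge> 0"
  shows "sum f (A \<union> B) \<le> sum f A + sum f B"
  using sum.union_inter[OF assms(1,2), of f] sum_nonneg[of "A \<inter> B" f] assms(3) by simp

context iid_process begin

section \<open>The normalizing estimators\<close>

lemma square_mean_variance:
  assumes n: "n \<ge> 1"
  shows "sq_integrable (\<lambda>\<omega>. sigma_hat_sq (path \<omega>) n)"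
    and "expectation (\<lambda>\<omega>. (sigma_hat_sq (path \<omega>) n - sigma2)\<^sup>2) \<le> m4 / real n"
proof -
  define X where "X t \<omega> = (norm (u t \<omega>))\<^sup>2 - sigma2" for t \<omega>
  have sq2: "sq_integrable (\<lambda>\<omega>. (norm (u t \<omega>))\<^sup>2)" for t
    using fourth_moment[of t] by (simp add: sq_integrable_def flip: power_mult)
  have sqX: "sq_integrable (X t)" for t unfolding X_def[abs_def] by (intro sq_integrable_diff sq2) simp
  have X2: "expectation (\<lambda>\<omega>. (X t \<omega>)\<^sup>2) \<le> m4" for t
  proof -
    have "expectation (\<lambda>\<omega>. (X t \<omega>)\<^sup>2) = expectation (\<lambda>\<omega>. norm (u t \<omega>) ^ 4 - 2 * sigma2 * (norm (u t \<omega>))\<^sup>2 + sigma2\<^sup>2)"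
      by (intro Bochner_Integration.integral_cong refl) (simp add: X_def power2_diff mult_ac flip: power_mult)
    also have "\<dots> = m4 - sigma2\<^sup>2"
      using fourth_moment[of t] integrable_norm_power[of 2 t] by (simp add: moment4 moment2 prob_space power2_eq_square[of sigma2])
    finally show ?thesis by simp
  qed
  have eq: "sigma_hat_sq (path \<omega>) n - sigma2 = (1 / real n) * (\<Sum>t\<in>{1..int n}. X t \<omega>)" for \<omega>
    using n by (simp add: sigma_hat_sq_def X_def path_def sum_subtractf right_diff_distrib)
  have sqS: "sq_integrable (\<lambda>\<omega>. sigma_hat_sq (path \<omega>) n - sigma2)"
    unfolding eq by (intro sq_integrable_cmult sq_integrable_sum sqX)
  from sq_integrable_add[OF sqS sq_integrable_const[of sigma2]]
  show "sq_integrable (\<lambda>\<omega>. sigma_hat_sq (path \<omega>) n)" by simp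
  have "expectation (\<lambda>\<omega>. (\<Sum>t\<in>{1..int n}. X t \<omega>)\<^sup>2) \<le> real 1 * (\<Sum>t\<in>{1..int n}. expectation (\<lambda>\<omega>. (X t \<omega>)\<^sup>2))"
  proof (rule second_moment_sum_le[where R = "\<lambda>i l. i = l"])
    fix s t :: int assume "s \<noteq> t"
    then have "expectation (\<lambda>\<omega>. X s \<omega> * X t \<omega>) = expectation (X s) * expectation (X t)"
      using product_moment(2)[of "{s, t}" "\<lambda>_ x. (norm x)\<^sup>2 - sigma2"] integrable_norm_power[of 2]
      by (simp add: X_def[abs_def])
    also have "expectation (X s) = 0"
      using integrable_norm_power[of 2 s] by (simp add: X_def[abs_def] moment2 prob_space)
    finally show "expectation (\<lambda>\<omega>. X s \<omega> * X t \<omega>) = 0" by simp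
  next
    fix i
    have "card {l \<in> {1..int n}. i = l} \<le> card {i}" by (intro card_mono) auto
    then show "card {l \<in> {1..int n}. i = l} \<le> 1" by simp
  qed (use sqX in auto)
  also have "\<dots> \<le> (\<Sum>t\<in>{1..int n}. m4)" unfolding of_nat_1 mult_1 by (intro sum_mono X2)
  also have "\<dots> = real n * m4" by simp
  finally have "(1 / real n)\<^sup>2 * expectation (\<lambda>\<omega>. (\<Sum>t\<in>{1..int n}. X t \<omega>)\<^sup>2) \<le> (1 / real n)\<^sup>2 * (real n * m4)"
    by (intro mult_left_mono) auto
  then show "expectation (\<lambda>\<omega>. (sigma_hat_sq (path \<omega>) n - sigma2)\<^sup>2) \<le> m4 / real n"
    unfolding eq power_mult_distrib using n by (simp add: power2_eq_square)
qed

lemma square_mean_square_error: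
  assumes n: "n \<ge> 1"
  shows "integrable M (\<lambda>\<omega>. (sigma_hat_sq (path \<omega>) n)\<^sup>2)"
    and "expectation (\<lambda>\<omega>. \<bar>(sigma_hat_sq (path \<omega>) n)\<^sup>2 - sigma2\<^sup>2\<bar>) \<le> 3 * m4 / sqrt (real n)"
proof -
  let ?S = "\<lambda>\<omega>. sigma_hat_sq (path \<omega>) n"
  note sv = square_mean_variance[OF n]
  show i2: "integrable M (\<lambda>\<omega>. (?S \<omega>)\<^sup>2)" using sv(1) by (simp add: sq_integrable_def)
  have d: "sq_integrable (\<lambda>\<omega>. ?S \<omega> - sigma2)" by (intro sq_integrable_diff sv) simp
  have di: "integrable M (\<lambda>\<omega>. (?S \<omega> - sigma2)\<^sup>2)" using d by (simp add: sq_integrable_def)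
  have d1: "integrable M (\<lambda>\<omega>. ?S \<omega> - sigma2)" by (rule sq_integrable_integrable[OF d])
  have eq: "(?S \<omega>)\<^sup>2 - sigma2\<^sup>2 = (?S \<omega> - sigma2)\<^sup>2 + 2 * sigma2 * (?S \<omega> - sigma2)" for \<omega>
    by (simp add: power2_eq_square algebra_simps)
  have a1: "expectation (\<lambda>\<omega>. \<bar>?S \<omega> - sigma2\<bar>) \<le> sqrt (m4 / real n)"
    using expectation_abs_le_sqrt[OF d] sv(2) by (meson order_trans real_sqrt_le_mono)
  have s4: "sigma2 \<le> sqrt m4" using sigma2_le sigma2_nonneg by (simp add: real_le_rsqrt)
  have "expectation (\<lambda>\<omega>. \<bar>(?S \<omega>)\<^sup>2 - sigma2\<^sup>2\<bar>) \<le> expectation (\<lambda>\<omega>. (?S \<omega> - sigma2)\<^sup>2 + 2 * sigma2 * \<bar>?S \<omega> - sigma2\<bar>)"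
  proof (rule integral_mono)
    show "\<bar>(?S \<omega>)\<^sup>2 - sigma2\<^sup>2\<bar> \<le> (?S \<omega> - sigma2)\<^sup>2 + 2 * sigma2 * \<bar>?S \<omega> - sigma2\<bar>" for \<omega>
      unfolding eq using sigma2_nonneg by (intro order_trans[OF abs_triangle_ineq]) (simp add: abs_mult)
  qed (use i2 di d1 in auto)
  also have "\<dots> = expectation (\<lambda>\<omega>. (?S \<omega> - sigma2)\<^sup>2) + 2 * sigma2 * expectation (\<lambda>\<omega>. \<bar>?S \<omega> - sigma2\<bar>)"
    using di d1 by simp
  also have "\<dots> \<le> m4 / real n + 2 * sqrt m4 * sqrt (m4 / real n)"
    using sv(2) a1 s4 sigma2_nonneg m4_nonneg by (intro add_mono mult_mono) auto
  also have "2 * sqrt m4 * sqrt (m4 / real n) = 2 * m4 / sqrt (real n)"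
    using m4_nonneg by (simp add: real_sqrt_divide)
  also have "m4 / real n \<le> m4 / sqrt (real n)"
  proof -
    have "sqrt (real n) \<le> real n" using n real_sqrt_le_mono[of "real n" "(real n)\<^sup>2"] by (simp add: power2_eq_square)
    then show ?thesis using n m4_nonneg by (intro divide_left_mono) auto
  qed
  finally show "expectation (\<lambda>\<omega>. \<bar>(?S \<omega>)\<^sup>2 - sigma2\<^sup>2\<bar>) \<le> 3 * m4 / sqrt (real n)"
    by (simp add: add_divide_distrib[symmetric])
qed

lemma sq_inner_moments:
  assumes "s \<noteq> r"
  shows "sq_integrable (\<lambda>\<omega>. (u s \<omega> \<bullet> u r \<omega>)\<^sup>2)"
    and "expectation (\<lambda>\<omega>. (u s \<omega> \<bullet> u r \<omega>)\<^sup>2) = kappa"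
    and "expectation (\<lambda>\<omega>. ((u s \<omega> \<bullet> u r \<omega>)\<^sup>2)\<^sup>2) \<le> m4\<^sup>2"
proof -
  have i4: "integrable M (\<lambda>\<omega>. norm (u s \<omega>) ^ 4 * norm (u r \<omega>) ^ 4)"
    and e4: "expectation (\<lambda>\<omega>. norm (u s \<omega>) ^ 4 * norm (u r \<omega>) ^ 4) = m4\<^sup>2"
    using product_moment[of "{s, r}" "\<lambda>_ x. norm x ^ 4"] fourth_moment assms
    by (auto simp: moment4 power2_eq_square)
  have le: "((u s \<omega> \<bullet> u r \<omega>)\<^sup>2)\<^sup>2 \<le> norm (u s \<omega>) ^ 4 * norm (u r \<omega>) ^ 4" for \<omega>
    using power_mono[OF Cauchy_Schwarz_ineq2[of "u s \<omega>" "u r \<omega>"], of 4]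
    by (simp add: power_mult_distrib flip: power_mult)
  have i: "integrable M (\<lambda>\<omega>. ((u s \<omega> \<bullet> u r \<omega>)\<^sup>2)\<^sup>2)"
    by (rule Bochner_Integration.integrable_bound[OF i4]) (use le in \<open>auto intro: order_trans[OF _ abs_ge_self]\<close>)
  then show sq: "sq_integrable (\<lambda>\<omega>. (u s \<omega> \<bullet> u r \<omega>)\<^sup>2)" by (simp add: sq_integrable_def)
  have "expectation (\<lambda>\<omega>. ((u s \<omega> \<bullet> u r \<omega>)\<^sup>2)\<^sup>2) \<le> expectation (\<lambda>\<omega>. norm (u s \<omega>) ^ 4 * norm (u r \<omega>) ^ 4)"
    by (rule integral_mono[OF i i4 le])
  then show "expectation (\<lambda>\<omega>. ((u s \<omega> \<bullet> u r \<omega>)\<^sup>2)\<^sup>2) \<le> m4\<^sup>2" using e4 by simp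
  have "expectation (\<lambda>\<omega>. (path \<omega> s \<bullet> path \<omega> r)\<^sup>2) = expectation (\<lambda>\<omega>. cov (path \<omega> r) (path \<omega> r))"
  proof (rule expectation_resample(1)[where r = s])
    show "integrable M (\<lambda>\<omega>. (path \<omega> s \<bullet> path \<omega> r)\<^sup>2)" using sq_integrable_integrable[OF sq] by (simp add: path_def)
    fix v show "(\<integral>\<omega>. ((v(s := u s \<omega>)) s \<bullet> (v(s := u s \<omega>)) r)\<^sup>2 \<partial>M) = cov (v r) (v r)"
      using assms cov_eq[of s "v r" "v r"] by (simp add: power2_eq_square)
  qed measurable
  also have "\<dots> = expectation (\<lambda>\<omega>. cov (u r \<omega>) (u r \<omega>))" by (simp add: path_def)
  also have "\<dots> = kappa" unfolding kappa_def
  proof (rule expectation_u[of "\<lambda>x. cov x x"])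
    have "(\<lambda>x. case_prod cov (x, x)) \<in> borel_measurable borel" by measurable
    then show "(\<lambda>x. cov x x) \<in> borel_measurable borel" by simp
  qed
  finally show "expectation (\<lambda>\<omega>. (u s \<omega> \<bullet> u r \<omega>)\<^sup>2) = kappa" by (simp add: path_def)
qed

lemma sq_inner_disjoint:
  assumes "distinct [s, r, s', r']"
  shows "expectation (\<lambda>\<omega>. (u s \<omega> \<bullet> u r \<omega>)\<^sup>2 * (u s' \<omega> \<bullet> u r' \<omega>)\<^sup>2) = kappa\<^sup>2"
proof -
  have d: "s \<noteq> r" "s \<noteq> s'" "s \<noteq> r'" "r \<noteq> s'" "r \<noteq> r'" "s' \<noteq> r'" using assms by auto
  have cm: "(\<lambda>x. cov x x) \<in> borel_measurable borel"
  proof -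
    have "(\<lambda>x. case_prod cov (x, x)) \<in> borel_measurable borel" by measurable
    then show ?thesis by simp
  qed
  have [measurable]: "(\<lambda>v. cov (v i) (v i)) \<in> borel_measurable paths" for i
    by (rule kernel_measurable[OF cov_degenerate])
  define F where "F v = (v s \<bullet> v r)\<^sup>2 * (v s' \<bullet> v r')\<^sup>2" for v :: "int \<Rightarrow> 'h"
  define F1 where "F1 v = cov (v r) (v r) * (v s' \<bullet> v r')\<^sup>2" for v
  define F2 where "F2 v = cov (v r) (v r) * cov (v r') (v r')" for v
  have m: "F \<in> borel_measurable paths" "F1 \<in> borel_measurable paths" unfolding F_def F1_def by measurable
  have i: "integrable M (\<lambda>\<omega>. F (path \<omega>))"
    unfolding F_def path_def using d by (intro sq_integrable_mult sq_inner_moments)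
  have 1: "(\<integral>\<omega>. F (v(s := u s \<omega>)) \<partial>M) = F1 v" for v
    using d cov_eq[of s "v r" "v r"] by (simp add: F_def F1_def power2_eq_square)
  note s1 = expectation_resample[where r = s, OF m(1) i 1]
  have 2: "(\<integral>\<omega>. F1 (v(s' := u s' \<omega>)) \<partial>M) = F2 v" for v
    using d cov_eq[of s' "v r'" "v r'"] by (simp add: F2_def F1_def power2_eq_square)
  note s2 = expectation_resample[where r = s', OF m(2) s1(2) 2]
  have ci: "integrable M (\<lambda>\<omega>. cov (u i \<omega>) (u i \<omega>))" for i
  proof (rule Bochner_Integration.integrable_bound)
    show "integrable M (\<lambda>\<omega>. sigma2 * (norm (u i \<omega>))\<^sup>2)" using integrable_norm_power[of 2 i] by simp
    show "(\<lambda>\<omega>. cov (u i \<omega>) (u i \<omega>)) \<in> borel_measurable M" using measurable_compose[OF u_measurable cm] .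
    show "AE \<omega> in M. norm (cov (u i \<omega>) (u i \<omega>)) \<le> norm (sigma2 * (norm (u i \<omega>))\<^sup>2)"
      using cov_bound sigma2_nonneg by (auto simp: power2_eq_square mult.assoc[symmetric])
  qed
  have ek: "expectation (\<lambda>\<omega>. cov (u i \<omega>) (u i \<omega>)) = kappa" for i
    using expectation_u[OF cm, of i] by (simp only: kappa_def)
  have e2: "expectation (\<lambda>\<omega>. F2 (path \<omega>)) = kappa * kappa"
    using product_moment(2)[of "{r, r'}" "\<lambda>_ x. cov x x"] cm ci d ek
    by (simp add: F2_def path_def)
  have "expectation (\<lambda>\<omega>. F (path \<omega>)) = kappa\<^sup>2"
    unfolding s1(1) s2(1) e2 by (simp add: power2_eq_square)
  then show ?thesis by (simp add: F_def path_def)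
qed

text \<open>By \<open>hs_norm_autocov_0\<close> this is the mean of \<open>\<langle>u\<^sub>s, u\<^sub>r\<rangle>\<^sup>2\<close> over all pairs \<open>(s, r)\<close>. The \<open>n\<close> diagonal pairs contribute
\<open>O(1/n)\<close>. Two other pairs are correlated only if they share an index, so each pair is correlated with at most
\<open>4 n\<close> of about \<open>n\<^sup>2\<close> pairs.\<close>

lemma hs_norm_error:
  assumes n: "n \<ge> 1"
  shows "integrable M (\<lambda>\<omega>. (hs_norm (autocov (path \<omega>) n 0))\<^sup>2)"
    and "expectation (\<lambda>\<omega>. \<bar>(hs_norm (autocov (path \<omega>) n 0))\<^sup>2 - kappa\<bar>) \<le> 6 * m4 / sqrt (real n)"
proof -
  let ?N = "{1..int n}"
  define X where "X = (\<lambda>(s, r) \<omega>. (u s \<omega> \<bullet> u r \<omega>)\<^sup>2 - kappa)"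
  define P where "P = (SIGMA s:?N. {r \<in> ?N. r < s})"
  have finP: "finite P" by (rule finite_subset[of _ "?N \<times> ?N"]) (auto simp: P_def)
  have P: "r < s" "s \<in> ?N" "r \<in> ?N" if "(s, r) \<in> P" for s r using that by (auto simp: P_def)
  have cP: "real (card P) \<le> (real n)\<^sup>2"
  proof -
    have "card P \<le> card (?N \<times> ?N)" by (rule card_mono) (auto simp: P_def)
    then have "real (card P) \<le> real (card (?N \<times> ?N))" by (simp only: of_nat_le_iff)
    then show ?thesis by (simp add: card_cartesian_product power2_eq_square)
  qed
  have sqX: "sq_integrable (X i)" if "i \<in> P" for i
    using that P(1) unfolding X_def by (cases i) (force intro!: sq_integrable_diff sq_inner_moments)
  have eX: "expectation (\<lambda>\<omega>. (X i \<omega>)\<^sup>2) \<le> m4\<^sup>2" if i: "i \<in> P" for i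
  proof -
    obtain s r where sr: "i = (s, r)" by (cases i)
    have ne: "s \<noteq> r" using P(1) i unfolding sr by auto
    note m = sq_inner_moments[OF ne]
    have "(X i \<omega>)\<^sup>2 = ((u s \<omega> \<bullet> u r \<omega>)\<^sup>2)\<^sup>2 - 2 * kappa * (u s \<omega> \<bullet> u r \<omega>)\<^sup>2 + kappa\<^sup>2" for \<omega>
      by (simp add: X_def sr power2_diff)
    then have "expectation (\<lambda>\<omega>. (X i \<omega>)\<^sup>2) = expectation (\<lambda>\<omega>. ((u s \<omega> \<bullet> u r \<omega>)\<^sup>2)\<^sup>2) - kappa\<^sup>2"
      using m(1,2) sq_integrable_integrable[OF m(1)] by (simp add: sq_integrable_def prob_space power2_eq_square[of kappa])
    then show ?thesis using m(3) by (smt (verit) zero_le_power2)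
  qed
  define S where "S \<omega> = (\<Sum>i\<in>P. X i \<omega>)" for \<omega>
  have sqS: "sq_integrable S" unfolding S_def[abs_def] using sqX by (rule sq_integrable_sum)
  have "expectation (\<lambda>\<omega>. (S \<omega>)\<^sup>2) \<le> real (4 * n) * (\<Sum>i\<in>P. expectation (\<lambda>\<omega>. (X i \<omega>)\<^sup>2))"
    unfolding S_def
  proof (rule second_moment_sum_le[OF finP sqX, where R = "\<lambda>i l. {fst i, snd i} \<inter> {fst l, snd l} \<noteq> {}"])
    fix i l assume il: "i \<in> P" "l \<in> P" "\<not> {fst i, snd i} \<inter> {fst l, snd l} \<noteq> {}"
    obtain s r s' r' where sr: "i = (s, r)" "l = (s', r')" by (cases i; cases l)
    have d: "distinct [s, r, s', r']" using il P(1)[of s r] P(1)[of s' r'] unfolding sr by auto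
    then have ne: "s \<noteq> r" "s' \<noteq> r'" by auto
    note m = sq_inner_moments[OF ne(1)] and m' = sq_inner_moments[OF ne(2)]
    have "X i \<omega> * X l \<omega> = (u s \<omega> \<bullet> u r \<omega>)\<^sup>2 * (u s' \<omega> \<bullet> u r' \<omega>)\<^sup>2 - kappa * (u s \<omega> \<bullet> u r \<omega>)\<^sup>2
      - kappa * (u s' \<omega> \<bullet> u r' \<omega>)\<^sup>2 + kappa\<^sup>2" for \<omega>
      by (simp add: X_def sr algebra_simps power2_eq_square[of kappa])
    then show "expectation (\<lambda>\<omega>. X i \<omega> * X l \<omega>) = 0"
      using sq_integrable_mult[OF m(1) m'(1)] sq_integrable_integrable[OF m(1)] sq_integrable_integrable[OF m'(1)]
      by (simp add: m(2) m'(2) sq_inner_disjoint[OF d] prob_space power2_eq_square[of kappa])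
  next
    fix i
    have "card {l \<in> P. {fst i, snd i} \<inter> {fst l, snd l} \<noteq> {}} \<le> card ({fst i, snd i} \<times> ?N \<union> ?N \<times> {fst i, snd i})"
      by (rule card_mono) (auto simp: P_def)
    also have "\<dots> \<le> card ({fst i, snd i} \<times> ?N) + card (?N \<times> {fst i, snd i})" by (rule card_Un_le)
    also have "\<dots> = card {fst i, snd i} * n + n * card {fst i, snd i}" by (simp only: card_cartesian_product) simp
    also have "\<dots> \<le> 2 * n + n * 2" by (intro add_mono mult_mono) (auto simp: card_insert_if)
    finally show "card {l \<in> P. {fst i, snd i} \<inter> {fst l, snd l} \<noteq> {}} \<le> 4 * n" by simp
  next
    fix i l :: "int \<times> int"
    show "({fst i, snd i} \<inter> {fst l, snd l} \<noteq> {}) = ({fst l, snd l} \<inter> {fst i, snd i} \<noteq> {})"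
      by (simp only: Int_commute)
  qed
  also have "\<dots> \<le> real (4 * n) * (\<Sum>i\<in>P. m4\<^sup>2)" by (intro mult_left_mono sum_mono eX) auto
  also have "\<dots> \<le> real (4 * n) * ((real n)\<^sup>2 * m4\<^sup>2)" using cP by (simp add: mult_left_mono mult_right_mono)
  also have "\<dots> = (2 * sqrt (real n) * real n * m4)\<^sup>2" by (simp add: power_mult_distrib)
  finally have "sqrt (expectation (\<lambda>\<omega>. (S \<omega>)\<^sup>2)) \<le> sqrt ((2 * sqrt (real n) * real n * m4)\<^sup>2)" by (rule real_sqrt_le_mono)
  then have ES: "expectation (\<lambda>\<omega>. \<bar>S \<omega>\<bar>) \<le> 2 * sqrt (real n) * real n * m4"
    using expectation_abs_le_sqrt[OF sqS] m4_nonneg by simp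
  define Dg where "Dg \<omega> = (\<Sum>s\<in>?N. norm (u s \<omega>) ^ 4 - kappa)" for \<omega>
  have iD: "integrable M Dg" unfolding Dg_def[abs_def] using fourth_moment by simp
  have ED: "expectation (\<lambda>\<omega>. \<bar>Dg \<omega>\<bar>) \<le> real n * (2 * m4)"
  proof -
    have "expectation (\<lambda>\<omega>. \<bar>Dg \<omega>\<bar>) \<le> expectation (\<lambda>\<omega>. \<Sum>s\<in>?N. (norm (u s \<omega>) ^ 4 + kappa))"
    proof (rule integral_mono)
      show "\<bar>Dg \<omega>\<bar> \<le> (\<Sum>s\<in>?N. (norm (u s \<omega>) ^ 4 + kappa))" for \<omega>
      proof -
        have "\<bar>x - kappa\<bar> \<le> x + kappa" if "x \<ge> 0" for x using that kappa_nonneg by linarith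
        then show ?thesis unfolding Dg_def by (intro order_trans[OF sum_abs] sum_mono) simp
      qed
    qed (use iD fourth_moment in auto)
    also have "\<dots> = real n * (m4 + kappa)" using fourth_moment by (simp add: moment4 prob_space)
    also have "\<dots> \<le> real n * (2 * m4)" using kappa_le by (intro mult_left_mono) auto
    finally show ?thesis .
  qed
  have eq: "(hs_norm (autocov (path \<omega>) n 0))\<^sup>2 - kappa = (1 / (real n)\<^sup>2) * (Dg \<omega> + 2 * S \<omega>)" for \<omega>
  proof -
    have "(\<Sum>s\<in>?N. \<Sum>r\<in>?N. (u s \<omega> \<bullet> u r \<omega>)\<^sup>2 - kappa) =
      (\<Sum>s\<in>?N. (u s \<omega> \<bullet> u s \<omega>)\<^sup>2 - kappa) + 2 * (\<Sum>s\<in>?N. \<Sum>r\<in>{r \<in> ?N. r < s}. (u s \<omega> \<bullet> u r \<omega>)\<^sup>2 - kappa)"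
      by (rule sum_symmetric_split) (auto simp: inner_commute)
    also have "(\<Sum>s\<in>?N. (u s \<omega> \<bullet> u s \<omega>)\<^sup>2 - kappa) = Dg \<omega>"
      by (simp add: Dg_def flip: power2_norm_eq_inner power_mult)
    also have "(\<Sum>s\<in>?N. \<Sum>r\<in>{r \<in> ?N. r < s}. (u s \<omega> \<bullet> u r \<omega>)\<^sup>2 - kappa) = S \<omega>"
      unfolding S_def P_def X_def by (subst sum.Sigma) (simp_all add: split_def del: atLeastAtMost_iff)
    also have "(\<Sum>s\<in>?N. \<Sum>r\<in>?N. (u s \<omega> \<bullet> u r \<omega>)\<^sup>2 - kappa) = (real n)\<^sup>2 * ((hs_norm (autocov (path \<omega>) n 0))\<^sup>2 - kappa)"
      unfolding hs_norm_autocov_0 path_def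
      using n by (simp add: sum_subtractf power2_eq_square[of "real n"] right_diff_distrib)
    finally show ?thesis using n by (simp add: eq_divide_eq mult.commute)
  qed
  have iS: "integrable M S" by (rule sq_integrable_integrable[OF sqS])
  have "integrable M (\<lambda>\<omega>. (1 / (real n)\<^sup>2) * (Dg \<omega> + 2 * S \<omega>) + kappa)" using iD iS by simp
  then show "integrable M (\<lambda>\<omega>. (hs_norm (autocov (path \<omega>) n 0))\<^sup>2)" unfolding eq[symmetric] by simp
  have "expectation (\<lambda>\<omega>. \<bar>(hs_norm (autocov (path \<omega>) n 0))\<^sup>2 - kappa\<bar>) \<le>
     expectation (\<lambda>\<omega>. (1 / (real n)\<^sup>2) * (\<bar>Dg \<omega>\<bar> + 2 * \<bar>S \<omega>\<bar>))"
  proof (rule integral_mono)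
    show "\<bar>(hs_norm (autocov (path \<omega>) n 0))\<^sup>2 - kappa\<bar> \<le> (1 / (real n)\<^sup>2) * (\<bar>Dg \<omega>\<bar> + 2 * \<bar>S \<omega>\<bar>)" for \<omega>
      unfolding eq abs_mult by (intro mult_mono order_trans[OF abs_triangle_ineq]) auto
    show "integrable M (\<lambda>\<omega>. \<bar>(hs_norm (autocov (path \<omega>) n 0))\<^sup>2 - kappa\<bar>)" unfolding eq using iD iS by simp
  qed (use iD iS in auto)
  also have "\<dots> = (1 / (real n)\<^sup>2) * (expectation (\<lambda>\<omega>. \<bar>Dg \<omega>\<bar>) + 2 * expectation (\<lambda>\<omega>. \<bar>S \<omega>\<bar>))"
    using iD iS by simp
  also have "\<dots> \<le> (1 / (real n)\<^sup>2) * (real n * (2 * m4) + 2 * (2 * sqrt (real n) * real n * m4))"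
    using ED ES by (intro mult_left_mono add_mono) auto
  also have "\<dots> \<le> (1 / (real n)\<^sup>2) * (real n * (2 * m4) * sqrt (real n) + 2 * (2 * sqrt (real n) * real n * m4))"
    using n m4_nonneg mult_left_mono[of 1 "sqrt (real n)" "real n * (2 * m4)"]
    by (intro mult_left_mono add_mono order_refl) simp_all
  also have "\<dots> = 6 * m4 * (sqrt (real n) / real n)" using n by (simp add: power2_eq_square field_simps)
  also have "sqrt (real n) / real n = 1 / sqrt (real n)"
    using n by (simp add: field_simps)
  finally show "expectation (\<lambda>\<omega>. \<bar>(hs_norm (autocov (path \<omega>) n 0))\<^sup>2 - kappa\<bar>) \<le> 6 * m4 / sqrt (real n)" by simp
qed

text \<open>By \<open>sq_inner_moments\<close>, \<open>kappa = E \<langle>u\<^sub>0, u\<^sub>1\<rangle>\<^sup>2\<close>. Inner products within a ball around \<open>d \<noteq> 0\<close> of radius \<open>\<parallel>d\<parallel>/4\<close> are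
positive. If \<open>kappa = 0\<close>, two independent copies almost surely do not meet in such a ball, so the ball is a null set. Countably
many of these balls, with centres in a dense set, cover everything except \<open>0\<close>.\<close>

lemma kappa_pos:
  assumes pos: "sigma2 > 0"
  shows "kappa > 0"
proof (rule ccontr)
  assume "\<not> kappa > 0"
  then have "kappa = 0" using kappa_nonneg by simp
  note m = sq_inner_moments[of 0 1]
  have "AE \<omega> in M. (u 0 \<omega> \<bullet> u 1 \<omega>)\<^sup>2 = 0"
    using integral_nonneg_eq_0_iff_AE[of M "\<lambda>\<omega>. (u 0 \<omega> \<bullet> u 1 \<omega>)\<^sup>2"] m(2) \<open>kappa = 0\<close>
      sq_integrable_integrable[OF m(1)] by simp
  then have ae: "AE \<omega> in M. u 0 \<omega> \<bullet> u 1 \<omega> = 0" by simp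
  have null: "AE \<omega> in M. u 0 \<omega> \<notin> ball d (norm d / 4)" if d: "d \<noteq> 0" for d
  proof -
    define b where "b = ball d (norm d / 4)"
    have [measurable]: "b \<in> sets borel" by (simp add: b_def)
    have bpos: "x \<bullet> y > 0" if "x \<in> b" "y \<in> b" for x y
    proof -
      have n: "norm (x - d) < norm d / 4" "norm (y - d) < norm d / 4"
        using that by (auto simp: b_def dist_norm norm_minus_commute)
      have "x \<bullet> y = (norm d)\<^sup>2 + d \<bullet> (y - d) + (x - d) \<bullet> d + (x - d) \<bullet> (y - d)"
        by (simp add: inner_diff inner_commute power2_norm_eq_inner)
      moreover have "\<bar>d \<bullet> (y - d)\<bar> \<le> norm d * (norm d / 4)"
        using n by (intro order_trans[OF Cauchy_Schwarz_ineq2] mult_left_mono) auto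
      moreover have "\<bar>(x - d) \<bullet> d\<bar> \<le> (norm d / 4) * norm d"
        using n by (intro order_trans[OF Cauchy_Schwarz_ineq2] mult_right_mono) auto
      moreover have "\<bar>(x - d) \<bullet> (y - d)\<bar> \<le> (norm d / 4) * (norm d / 4)"
        using n by (intro order_trans[OF Cauchy_Schwarz_ineq2] mult_mono) auto
      moreover have "norm d * norm d > 0" using d by simp
      ultimately show ?thesis unfolding power2_eq_square by (simp add: field_simps)
    qed
    have "AE \<omega> in M. (indicator b (u 0 \<omega>) * indicator b (u 1 \<omega>) :: real) = 0"
      using ae by eventually_elim (auto simp: indicator_def dest: bpos)
    then have "expectation (\<lambda>\<omega>. indicator b (u 0 \<omega>) * indicator b (u 1 \<omega>) :: real) = 0"
      by (rule integral_eq_zero_AE)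
    moreover have ib: "integrable M (\<lambda>\<omega>. indicator b (u i \<omega>) :: real)" for i
      by (rule Bochner_Integration.integrable_bound[of M "\<lambda>_. 1::real"]) (auto simp: indicator_def)
    ultimately have "expectation (\<lambda>\<omega>. indicator b (u 0 \<omega>) :: real) * expectation (\<lambda>\<omega>. indicator b (u 1 \<omega>)) = 0"
      using product_moment(2)[of "{0, 1}" "\<lambda>_. indicator b"] by simp
    moreover have "expectation (\<lambda>\<omega>. indicator b (u 1 \<omega>)) = expectation (\<lambda>\<omega>. indicator b (u 0 \<omega>) :: real)"
      by (rule expectation_u) simp
    ultimately have "expectation (\<lambda>\<omega>. indicator b (u 0 \<omega>) :: real) = 0" by simp
    then have "AE \<omega> in M. (indicator b (u 0 \<omega>) :: real) = 0"
      using integral_nonneg_eq_0_iff_AE[OF ib[of 0]] by simp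
    then show ?thesis by (simp add: b_def indicator_def)
  qed
  obtain D :: "'h set" where D: "countable D" "\<And>X. open X \<Longrightarrow> X \<noteq> {} \<Longrightarrow> \<exists>d\<in>D. d \<in> X"
    using countable_dense_setE by blast
  have "AE \<omega> in M. \<forall>d\<in>D - {0}. u 0 \<omega> \<notin> ball d (norm d / 4)"
    using D(1) null by (subst AE_ball_countable) auto
  then have "AE \<omega> in M. u 0 \<omega> = 0"
  proof eventually_elim
    case (elim \<omega>)
    show ?case
    proof (rule ccontr)
      let ?x = "u 0 \<omega>"
      assume x: "?x \<noteq> 0"
      then obtain d where d: "d \<in> D" "d \<in> ball ?x (norm ?x / 8)" using D(2)[of "ball ?x (norm ?x / 8)"] by auto
      have xd: "norm (?x - d) < norm ?x / 8" using d(2) by (simp add: dist_norm)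
      then have nd: "norm d > 7 / 8 * norm ?x" using norm_triangle_ineq2[of ?x d] by linarith
      then have "d \<noteq> 0" using x by auto
      moreover have "norm ?x > 0" using x by simp
      then have "norm (d - ?x) < norm d / 4" using xd nd unfolding norm_minus_commute[of d ?x] by linarith
      then have "?x \<in> ball d (norm d / 4)" by (simp add: dist_norm)
      ultimately show False using elim d(1) by blast
    qed
  qed
  then have "AE \<omega> in M. (norm (u 0 \<omega>))\<^sup>2 = 0" by eventually_elim simp
  then have "sigma2 = 0" unfolding sigma2_def by (intro integral_eq_zero_AE) auto
  then show False using pos by simp
qed

section \<open>Decomposition of the statistic\<close>

text \<open>The part of the centred numerator that comes from the terms \<open>s = t\<close> of the squared norms of the sample
autocovariances.\<close>

definition diag_err :: "(real \<Rightarrow> real) \<Rightarrow> real \<Rightarrow> nat \<Rightarrow> (int \<Rightarrow> 'h) \<Rightarrow> real" where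
  "diag_err k p n v = (\<Sum>j = 1..n - 1. (k (real j / p))\<^sup>2 *
     ((1 / real n) * (\<Sum>t\<in>{int j + 1..int n}. (norm (v t))\<^sup>2 * (norm (v (t - int j)))\<^sup>2)
       - (1 - real j / real n) * (sigma_hat_sq v n)\<^sup>2))"

text \<open>All triples \<open>(t, s, j)\<close> that occur in the statistic, without those that occur in the increments.\<close>

definition rest_idx :: "nat \<Rightarrow> nat \<Rightarrow> (int \<times> int \<times> int) set" where
  "rest_idx q n = {(t, s, j). 1 \<le> j \<and> j < s \<and> s < t \<and> t \<le> int n} -
     (SIGMA t:{1..int n}. {int q + 1..t - int q - 1} \<times> {1..int q})"

lemma finite_triples: "finite {(t, s, j). 1 \<le> j \<and> j < s \<and> s < t \<and> t \<le> int n}"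
  by (rule finite_subset[of _ "{1..int n} \<times> {1..int n} \<times> {1..int n}"]) auto

text \<open>For each lag the mean of \<open>\<parallel>u\<^sub>t\<parallel>\<^sup>2 \<parallel>u\<^sub>t\<^sub>-\<^sub>j\<parallel>\<^sup>2\<close> and the squared sample variance are within \<open>O(1/\<surd>n)\<close> of \<open>sigma2\<^sup>2\<close> in \<open>L\<^sup>1\<close>.
This is the reason for the centring by \<open>C_coeff\<close>.\<close>

lemma diag_err_bound:
  assumes n: "n \<ge> 1"
  shows "integrable M (\<lambda>\<omega>. diag_err k p n (path \<omega>))"
    and "expectation (\<lambda>\<omega>. \<bar>diag_err k p n (path \<omega>)\<bar>) \<le> (\<Sum>j = 1..n. (k (real j / p))\<^sup>2) * (5 * m4 / sqrt (real n))"
proof -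
  define S where "S \<omega> = (sigma_hat_sq (path \<omega>) n)\<^sup>2 - sigma2\<^sup>2" for \<omega>
  define D where "D j \<omega> = (\<Sum>t\<in>{int j + 1..int n}. ((norm (u t \<omega>))\<^sup>2 * (norm (u (t - int j) \<omega>))\<^sup>2 - sigma2\<^sup>2))" for j \<omega>
  define E where "E j \<omega> = (1 / real n) * D j \<omega> - (1 - real j / real n) * S \<omega>" for j \<omega>
  have iS: "integrable M S" unfolding S_def[abs_def] using square_mean_square_error(1)[OF n] by simp
  have ES: "expectation (\<lambda>\<omega>. \<bar>S \<omega>\<bar>) \<le> 3 * m4 / sqrt (real n)"
    unfolding S_def by (rule square_mean_square_error(2)[OF n])
  have D: "integrable M (D j)" "expectation (\<lambda>\<omega>. \<bar>D j \<omega>\<bar>) \<le> sqrt (3 * real n * m4\<^sup>2)" if j: "j \<in> {1..n - 1}" for j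
  proof -
    note dv = diagonal_variance[of "\<lambda>x. (norm x)\<^sup>2" 1 "int j" "{int j + 1..int n}" sigma2]
    have sq: "sq_integrable (D j)" unfolding D_def[abs_def] using j by (intro dv(1)) (auto simp: sigma2_def)
    then show "integrable M (D j)" by (rule sq_integrable_integrable)
    have "expectation (\<lambda>\<omega>. (D j \<omega>)\<^sup>2) \<le> 3 * real (card {int j + 1..int n}) * (1 ^ 4 * m4\<^sup>2)"
      unfolding D_def using j by (intro dv(2)) (auto simp: sigma2_def)
    also have "\<dots> \<le> 3 * real n * m4\<^sup>2" by (simp add: mult_right_mono)
    finally have le: "expectation (\<lambda>\<omega>. (D j \<omega>)\<^sup>2) \<le> 3 * real n * m4\<^sup>2" .
    show "expectation (\<lambda>\<omega>. \<bar>D j \<omega>\<bar>) \<le> sqrt (3 * real n * m4\<^sup>2)"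
      by (rule order_trans[OF expectation_abs_le_sqrt[OF sq] real_sqrt_le_mono[OF le]])
  qed
  have E: "integrable M (E j)" "expectation (\<lambda>\<omega>. \<bar>E j \<omega>\<bar>) \<le> 5 * m4 / sqrt (real n)" if j: "j \<in> {1..n - 1}" for j
  proof -
    show iE: "integrable M (E j)" unfolding E_def[abs_def] using D(1)[OF j] iS by simp
    have jn: "0 \<le> 1 - real j / real n" "1 - real j / real n \<le> 1" using j n by (auto simp: field_simps)
    have "expectation (\<lambda>\<omega>. \<bar>E j \<omega>\<bar>) \<le> expectation (\<lambda>\<omega>. (1 / real n) * \<bar>D j \<omega>\<bar> + \<bar>S \<omega>\<bar>)"
    proof (rule integral_mono)
      fix \<omega>
      have "\<bar>(1 - real j / real n) * S \<omega>\<bar> \<le> 1 * \<bar>S \<omega>\<bar>" unfolding abs_mult using jn by (intro mult_right_mono) auto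
      moreover have "\<bar>(1 / real n) * D j \<omega>\<bar> = (1 / real n) * \<bar>D j \<omega>\<bar>" by (simp add: abs_mult)
      ultimately show "\<bar>E j \<omega>\<bar> \<le> (1 / real n) * \<bar>D j \<omega>\<bar> + \<bar>S \<omega>\<bar>" unfolding E_def by linarith
    qed (use iE D(1)[OF j] iS in auto)
    also have "\<dots> = (1 / real n) * expectation (\<lambda>\<omega>. \<bar>D j \<omega>\<bar>) + expectation (\<lambda>\<omega>. \<bar>S \<omega>\<bar>)" using D(1)[OF j] iS by simp
    also have "\<dots> \<le> (1 / real n) * sqrt (3 * real n * m4\<^sup>2) + 3 * m4 / sqrt (real n)"
      by (intro add_mono mult_left_mono D(2)[OF j] ES) simp
    also have "(1 / real n) * sqrt (3 * real n * m4\<^sup>2) \<le> (1 / real n) * sqrt (4 * real n * m4\<^sup>2)"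
      by (intro mult_left_mono real_sqrt_le_mono mult_right_mono) auto
    also have "\<dots> = 2 * m4 * (sqrt (real n) / real n)" using m4_nonneg by (simp add: real_sqrt_mult)
    also have "sqrt (real n) / real n = 1 / sqrt (real n)" using n by (simp add: field_simps)
    finally show "expectation (\<lambda>\<omega>. \<bar>E j \<omega>\<bar>) \<le> 5 * m4 / sqrt (real n)" by (simp add: add_divide_distrib[symmetric])
  qed
  have eq: "diag_err k p n (path \<omega>) = (\<Sum>j = 1..n - 1. (k (real j / p))\<^sup>2 * E j \<omega>)" for \<omega>
    unfolding diag_err_def
  proof (intro sum.cong refl arg_cong2[where f = "(*)"])
    fix j assume j: "j \<in> {1..n - 1}"
    have "D j \<omega> = (\<Sum>t\<in>{int j + 1..int n}. (norm (u t \<omega>))\<^sup>2 * (norm (u (t - int j) \<omega>))\<^sup>2) - (real n - real j) * sigma2\<^sup>2"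
    proof -
      have "j \<le> n" using j by auto
      then show ?thesis by (simp add: D_def sum_subtractf of_nat_diff nat_diff_distrib')
    qed
    then show "1 / real n * (\<Sum>t = int j + 1..int n. (norm (path \<omega> t))\<^sup>2 * (norm (path \<omega> (t - int j)))\<^sup>2) -
         (1 - real j / real n) * (sigma_hat_sq (path \<omega>) n)\<^sup>2 = E j \<omega>"
      using n by (simp add: E_def S_def path_def field_simps)
  qed
  show "integrable M (\<lambda>\<omega>. diag_err k p n (path \<omega>))"
    unfolding eq using E(1) by (intro Bochner_Integration.integrable_sum integrable_mult_right) auto
  have "expectation (\<lambda>\<omega>. \<bar>diag_err k p n (path \<omega>)\<bar>) \<le> expectation (\<lambda>\<omega>. \<Sum>j = 1..n - 1. (k (real j / p))\<^sup>2 * \<bar>E j \<omega>\<bar>)"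
  proof (rule integral_mono)
    show "integrable M (\<lambda>\<omega>. \<bar>diag_err k p n (path \<omega>)\<bar>)"
      unfolding eq using E(1) by (intro integrable_abs Bochner_Integration.integrable_sum integrable_mult_right) auto
    show "integrable M (\<lambda>\<omega>. \<Sum>j = 1..n - 1. (k (real j / p))\<^sup>2 * \<bar>E j \<omega>\<bar>)"
      using E(1) by (intro Bochner_Integration.integrable_sum integrable_mult_right) auto
    show "\<bar>diag_err k p n (path \<omega>)\<bar> \<le> (\<Sum>j = 1..n - 1. (k (real j / p))\<^sup>2 * \<bar>E j \<omega>\<bar>)" for \<omega>
      unfolding eq by (intro order_trans[OF sum_abs] sum_mono) (simp add: abs_mult)
  qed
  also have "\<dots> = (\<Sum>j = 1..n - 1. (k (real j / p))\<^sup>2 * expectation (\<lambda>\<omega>. \<bar>E j \<omega>\<bar>))"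
  proof -
    have "integrable M (\<lambda>\<omega>. (k (real j / p))\<^sup>2 * \<bar>E j \<omega>\<bar>)" if "j \<in> {1..n - 1}" for j using E(1)[OF that] by simp
    then show ?thesis by (simp del: atLeastAtMost_iff)
  qed
  also have "\<dots> \<le> (\<Sum>j = 1..n - 1. (k (real j / p))\<^sup>2 * (5 * m4 / sqrt (real n)))"
    by (intro sum_mono mult_left_mono E(2)) auto
  also have "\<dots> \<le> (\<Sum>j = 1..n. (k (real j / p))\<^sup>2 * (5 * m4 / sqrt (real n)))"
    using m4_nonneg by (intro sum_mono2) auto
  finally show "expectation (\<lambda>\<omega>. \<bar>diag_err k p n (path \<omega>)\<bar>) \<le> (\<Sum>j = 1..n. (k (real j / p))\<^sup>2) * (5 * m4 / sqrt (real n))"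
    by (simp only: sum_distrib_right)
qed

lemma statistic_numerator:
  fixes k :: "real \<Rightarrow> real" and v :: "int \<Rightarrow> 'h" and p :: real and q n :: nat
  assumes n: "n \<ge> 1" and k0: "k 0 = 1" and ksym: "\<And>x. k (- x) = k x"
  defines "w \<equiv> \<lambda>j::int. (k (of_int j / p))\<^sup>2"
  shows "(1 / 2) * real n * Q_hat_sq k p v n - (sigma_hat_sq v n)\<^sup>2 * C_coeff k p n =
    diag_err k p n v + (2 / real n) * ((\<Sum>t\<in>{1..int n}. increment w (int q) t v)
       + (\<Sum>(t, s, j)\<in>rest_idx q n. w j * lagged (\<bullet>) t s j v))"
proof -
  let ?all = "{(t, s, j). 1 \<le> j \<and> j < s \<and> s < t \<and> t \<le> int n}"
  let ?main = "SIGMA t:{1..int n}. {int q + 1..t - int q - 1} \<times> {1..int q}"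
  let ?f = "\<lambda>(t, s, j). w j * lagged (\<bullet>) t s j v"
  let ?d = "\<lambda>j. (\<Sum>t\<in>{int j + 1..int n}. (norm (v t))\<^sup>2 * (norm (v (t - int j)))\<^sup>2)"
  let ?o = "\<lambda>j. (\<Sum>t\<in>{j + 1..int n}. \<Sum>s\<in>{s \<in> {j + 1..int n}. s < t}. lagged (\<bullet>) t s j v)"
  have lag: "lag_sum v n (int j) = ?d j + 2 * ?o (int j)" for j
    unfolding lag_sum_def
    by (subst sum_symmetric_split) (auto simp: lagged_def inner_commute power2_norm_eq_inner)
  have main_sub: "?main \<subseteq> ?all" by auto
  have "(\<Sum>i\<in>?main. ?f i) = (\<Sum>t\<in>{1..int n}. \<Sum>s\<in>{int q + 1..t - int q - 1}. \<Sum>j\<in>{1..int q}. w j * lagged (\<bullet>) t s j v)"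
    by (subst sum_Sigma_Times) (simp_all del: atLeastAtMost_iff)
  also have "\<dots> = (\<Sum>t\<in>{1..int n}. increment w (int q) t v)"
    unfolding increment_def by (intro sum.cong refl sum.swap)
  finally have 1: "(\<Sum>t\<in>{1..int n}. increment w (int q) t v) = (\<Sum>i\<in>?main. ?f i)" by simp
  have "(\<Sum>j = 1..n - 1. w (int j) * ?o (int j)) = (\<Sum>j\<in>{1..int (n - 1)}. w j * ?o j)"
    by (simp add: sum_int_shift)
  also have "\<dots> = (\<Sum>j\<in>{1..int (n - 1)}. \<Sum>t\<in>{j + 1..int n}. \<Sum>s\<in>{s \<in> {j + 1..int n}. s < t}. ?f (t, s, j))"
    by (simp add: sum_distrib_left)
  also have "\<dots> = (\<Sum>(j, t, s)\<in>(SIGMA j:{1..int (n - 1)}. SIGMA t:{j + 1..int n}. {s \<in> {j + 1..int n}. s < t}). ?f (t, s, j))"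
    by (simp add: sum.Sigma split_def del: atLeastAtMost_iff)
  also have "\<dots> = (\<Sum>i\<in>?all. ?f i)"
    by (rule sum.reindex_bij_witness[of _ "\<lambda>(t, s, j). (j, t, s)" "\<lambda>(j, t, s). (t, s, j)"]) (use n in auto)
  also have "\<dots> = (\<Sum>i\<in>rest_idx q n. ?f i) + (\<Sum>i\<in>?main. ?f i)"
    unfolding rest_idx_def by (rule sum.subset_diff[OF main_sub finite_triples])
  finally have 2: "(\<Sum>j = 1..n - 1. w (int j) * ?o (int j)) = (\<Sum>t\<in>{1..int n}. increment w (int q) t v) + (\<Sum>i\<in>rest_idx q n. ?f i)"
    using 1 by simp
  have "(1 / 2) * real n * Q_hat_sq k p v n = (1 / real n) * (\<Sum>j = 1..n - 1. (k (real j / p))\<^sup>2 * lag_sum v n (int j))"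
    unfolding Q_hat_sq_eq[OF k0 ksym] using n by (simp add: power2_eq_square)
  also have "\<dots> = (\<Sum>j = 1..n - 1. (k (real j / p))\<^sup>2 * ((1 / real n) * ?d j)) + (2 / real n) * (\<Sum>j = 1..n - 1. w (int j) * ?o (int j))"
  proof -
    have "(1 / real n) * (\<Sum>j = 1..n - 1. a j * (d j + 2 * b j)) =
        (\<Sum>j = 1..n - 1. a j * ((1 / real n) * d j)) + (2 / real n) * (\<Sum>j = 1..n - 1. a j * b j)"
      for a d b :: "nat \<Rightarrow> real"
      by (simp add: distrib_left sum.distrib sum_distrib_left mult_ac)
    then show ?thesis unfolding lag w_def of_int_of_nat_eq .
  qed
  finally show ?thesis unfolding 2 diag_err_def C_coeff_def
    by (simp add: right_diff_distrib sum_subtractf sum_distrib_left mult_ac)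
qed

text \<open>The omitted triples have \<open>j > q\<close>, or \<open>s \<le> q\<close>, or \<open>t - s \<le> q\<close>. The first kind is controlled by the tail of the
weights; of each of the other two kinds there are at most \<open>n q\<close> for each lag.\<close>

lemma rest_bound:
  fixes w :: "int \<Rightarrow> real" and q n :: nat
  shows "sq_integrable (\<lambda>\<omega>. \<Sum>(t, s, j)\<in>rest_idx q n. w j * lagged (\<bullet>) t s j (path \<omega>))"
    and "expectation (\<lambda>\<omega>. (\<Sum>(t, s, j)\<in>rest_idx q n. w j * lagged (\<bullet>) t s j (path \<omega>))\<^sup>2) \<le>
      2 * m4\<^sup>2 * ((real n)\<^sup>2 * (\<Sum>j\<in>{int q + 1..int n}. (w j)\<^sup>2) + 2 * real n * real q * (\<Sum>j\<in>{1..int q}. (w j)\<^sup>2))"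
proof -
  let ?g = "\<lambda>(t, s, j). (w j)\<^sup>2"
  have fin: "finite (rest_idx q n)" unfolding rest_idx_def using finite_triples by simp
  have I: "s < t \<and> j \<ge> 1" if "(t, s, j) \<in> rest_idx q n" for t s j using that by (auto simp: rest_idx_def)
  note lv = lagged_sum_variance[OF inner_degenerate fin I, of "\<lambda>(t, s, j). w j", unfolded split]
  show "sq_integrable (\<lambda>\<omega>. \<Sum>(t, s, j)\<in>rest_idx q n. w j * lagged (\<bullet>) t s j (path \<omega>))"
    using lv(1) by simp
  define A1 where "A1 = {1..int n} \<times> {1..int n} \<times> {int q + 1..int n}"
  define A2 where "A2 = {1..int n} \<times> {1..int q} \<times> {1..int q}"
  define A3 where "A3 = (SIGMA t:{1..int n}. {t - int q..t - 1} \<times> {1..int q})"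
  have sub: "rest_idx q n \<subseteq> (A1 \<union> A2) \<union> A3" by (auto simp: rest_idx_def A1_def A2_def A3_def)
  have finA: "finite A1" "finite A2" "finite A3" by (auto simp: A1_def A2_def A3_def)
  have g0: "?g i \<ge> 0" for i by (cases i) simp
  have e: "(\<Sum>i\<in>rest_idx q n. (case i of (t, s, j) \<Rightarrow> w j)\<^sup>2) = sum ?g (rest_idx q n)"
    by (intro sum.cong refl) auto
  have "sum ?g (rest_idx q n) \<le> sum ?g ((A1 \<union> A2) \<union> A3)" using sub finA g0 by (intro sum_mono2) auto
  also have "\<dots> \<le> sum ?g (A1 \<union> A2) + sum ?g A3" using finA g0 by (intro sum_Un_le) auto
  also have "\<dots> \<le> (sum ?g A1 + sum ?g A2) + sum ?g A3" using finA g0 by (intro add_right_mono sum_Un_le) auto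
  also have "sum ?g A1 = (real n)\<^sup>2 * (\<Sum>j\<in>{int q + 1..int n}. (w j)\<^sup>2)"
    unfolding A1_def by (subst sum_Sigma_Times) (simp_all add: power2_eq_square)
  also have "sum ?g A2 = real n * real q * (\<Sum>j\<in>{1..int q}. (w j)\<^sup>2)"
    unfolding A2_def by (subst sum_Sigma_Times) simp_all
  also have "sum ?g A3 = real n * real q * (\<Sum>j\<in>{1..int q}. (w j)\<^sup>2)"
    unfolding A3_def by (subst sum_Sigma_Times) simp_all
  finally have X: "sum ?g (rest_idx q n) \<le> (real n)\<^sup>2 * (\<Sum>j\<in>{int q + 1..int n}. (w j)\<^sup>2) + 2 * real n * real q * (\<Sum>j\<in>{1..int q}. (w j)\<^sup>2)"
    by simp
  have "2 * (1 ^ 4 * m4\<^sup>2) * sum ?g (rest_idx q n) \<le> 2 * m4\<^sup>2 * ((real n)\<^sup>2 * (\<Sum>j\<in>{int q + 1..int n}. (w j)\<^sup>2) + 2 * real n * real q * (\<Sum>j\<in>{1..int q}. (w j)\<^sup>2))"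
    using mult_left_mono[OF X, of "2 * m4\<^sup>2"] by simp
  with lv(2)[unfolded e] show "expectation (\<lambda>\<omega>. (\<Sum>(t, s, j)\<in>rest_idx q n. w j * lagged (\<bullet>) t s j (path \<omega>))\<^sup>2) \<le>
      2 * m4\<^sup>2 * ((real n)\<^sup>2 * (\<Sum>j\<in>{int q + 1..int n}. (w j)\<^sup>2) + 2 * real n * real q * (\<Sum>j\<in>{1..int q}. (w j)\<^sup>2))"
    by (rule order_trans)
qed

end

section \<open>Asymptotics\<close>

locale lag_window_test = iid_process M u + lag_kernel k \<alpha>
  for M :: "'a measure" and u :: "int \<Rightarrow> 'a \<Rightarrow> 'h::{real_inner, complete_space, second_countable_topology}"
    and k :: "real \<Rightarrow> real" and \<alpha> :: real +
  fixes p :: "nat \<Rightarrow> real"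
  assumes k_symmetric: "\<And>x. k (- x) = k x"
    and p_pos: "\<And>n. n \<ge> 1 \<Longrightarrow> p n > 0"
    and p_infinity: "filterlim p at_top sequentially"
    and p_rate: "(\<lambda>n. p n / real n) \<longlonglongrightarrow> 0"
    and sigma2_pos: "sigma2 > 0"
begin

text \<open>The cut-off for the lags is the geometric mean of \<open>p\<close> and \<open>n\<close>, so that \<open>p \<lless> q \<lless> n\<close>.\<close>

definition q :: "nat \<Rightarrow> nat" where "q n = nat \<lceil>sqrt (p n * real n)\<rceil>"

definition w :: "nat \<Rightarrow> int \<Rightarrow> real" where "w n j = (k (of_int j / p n))\<^sup>2"

text \<open>\<open>W\<close> is \<open>D_coeff\<close> with the boundary factors removed and the sum cut off at \<open>q\<close>.\<close>

definition W :: "nat \<Rightarrow> real" where "W n = (\<Sum>j\<in>{1..int (q n)}. (w n j)\<^sup>2)"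

definition D :: "nat \<Rightarrow> real" where "D n = D_coeff k (p n) n"

text \<open>The factor \<open>2/n\<close> of the off-diagonal part of the numerator, divided by the normalization in which the estimator
\<open>\<parallel>C\<^sub>n(0)\<parallel>\<^sup>2\<close> is replaced by its limit \<open>kappa\<close>.\<close>

definition lam :: "nat \<Rightarrow> real" where "lam n = 2 / (real n * (kappa * sqrt (2 * D n)))"

definition rho :: "nat \<Rightarrow> real" where "rho n = real (q n) / real n"

lemma kpos: "kappa > 0" by (rule kappa_pos[OF sigma2_pos])

lemma W_nonneg: "W n \<ge> 0" unfolding W_def by (intro sum_nonneg) simp

lemma w_le_1: "\<bar>w n j\<bar> \<le> 1" unfolding w_def using k_sq_le_1 by simp

lemma W_eq: "W n = (\<Sum>j = 1..q n. (k (real j / p n)) ^ 4)"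
  by (simp add: W_def sum_int_shift w_def flip: power_mult)

lemma ratio_limit: "filterlim (\<lambda>n. sqrt (real n / p n)) at_top sequentially"
proof -
  have "\<forall>\<^sub>F n in sequentially. 0 < p n / real n"
    using eventually_ge_at_top[of 1] by eventually_elim (simp add: p_pos)
  then have "filterlim (\<lambda>n. inverse (p n / real n)) at_top sequentially"
    using p_rate by (intro filterlim_inverse_at_top)
  then have "filterlim (\<lambda>n. real n / p n) at_top sequentially" by simp
  then show ?thesis by (rule filterlim_compose[OF sqrt_at_top])
qed

lemma rho_limit: "rho \<longlonglongrightarrow> 0"
proof (rule tendsto_sandwich[of "\<lambda>_. 0"])
  show "\<forall>\<^sub>F n in sequentially. rho n \<le> sqrt (p n / real n) + 1 / real n"
    using eventually_ge_at_top[of 1]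
  proof eventually_elim
    case (elim n)
    have "real (q n) \<le> sqrt (p n * real n) + 1"
      using p_pos[OF elim] unfolding q_def by (simp add: of_nat_nat)
    then have "rho n \<le> (sqrt (p n * real n) + 1) / real n" unfolding rho_def by (intro divide_right_mono) auto
    also have "\<dots> = sqrt (p n / real n) + 1 / real n"
    proof -
      define s where "s = sqrt (real n)"
      have s: "s > 0" "real n = s * s" using elim by (simp_all add: s_def)
      have "sqrt (p n * real n) / real n = sqrt (p n) * s / (s * s)"
        by (simp add: real_sqrt_mult s_def)
      also have "\<dots> = sqrt (p n) / s" using s(1) by simp
      also have "\<dots> = sqrt (p n / real n)" by (simp add: real_sqrt_divide s_def)
      finally show ?thesis by (simp add: add_divide_distrib)
    qed
    finally show ?case .
  qed
  have "(\<lambda>n. sqrt (p n / real n) + 1 / real n) \<longlonglongrightarrow> sqrt 0 + 0"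
    by (intro tendsto_add tendsto_real_sqrt p_rate lim_1_over_n)
  then show "(\<lambda>n. sqrt (p n / real n) + 1 / real n) \<longlonglongrightarrow> 0" by simp
qed (auto simp: rho_def)

text \<open>The orders of magnitude of all kernel sums: \<open>D\<close> and \<open>W\<close> are of order \<open>p\<close>, their quotient tends to one, and the lags
beyond \<open>q\<close> contribute \<open>p \<tau>\<close>, where \<open>\<tau>\<close> will be a null sequence.\<close>

definition lag_bounds :: "real \<Rightarrow> real \<Rightarrow> (nat \<Rightarrow> real) \<Rightarrow> nat \<Rightarrow> bool" where
  "lag_bounds C c \<tau> n \<longleftrightarrow>
     n \<ge> 4 \<and> p n \<ge> 1 \<and> q n + 2 \<le> n \<and>
       (\<Sum>j = 1..n. (k (real j / p n))\<^sup>2) \<le> C * p n \<and> W n \<le> C * p n \<and>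
       (\<Sum>j\<in>{int (q n) + 1..int n}. (w n j)\<^sup>2) \<le> p n * \<tau> n \<and>
       c * p n \<le> D n \<and> D n \<le> W n + p n * \<tau> n \<and> (1 - (rho n + 1 / real n))\<^sup>2 * W n \<le> D n"

text \<open>Since \<open>q / p\<close> is at least \<open>\<surd>(n / p)\<close>, which tends to infinity, \<open>kernel_tail\<close> with \<open>m = q\<close> provides \<open>\<tau>\<close>.\<close>

lemma asymptotic_bounds:
  obtains C c :: real and \<tau> :: "nat \<Rightarrow> real" where "C > 0" "c > 0" "\<tau> \<longlonglongrightarrow> 0"
    "\<forall>\<^sub>F n in sequentially. lag_bounds C c \<tau> n"
proof -
  obtain C where C: "C > 0" "\<And>p n. p \<ge> 1 \<Longrightarrow> (\<Sum>j = 1..n. (k (real j / p))\<^sup>2) \<le> C * p"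
    by (rule kernel_sum_bounded) blast
  obtain c P where c: "c > 0" "P \<ge> 1" "\<And>p n. p \<ge> P \<Longrightarrow> p \<le> real n / 2 \<Longrightarrow> n \<ge> 4 \<Longrightarrow> D_coeff k p n \<ge> c * p"
    by (rule D_coeff_lower) blast
  obtain B X where B: "B \<ge> 0" "X \<ge> 1" and tail: "\<And>p m n. p > 0 \<Longrightarrow> m \<ge> 1 \<Longrightarrow> real m \<ge> X * p \<Longrightarrow>
      (\<Sum>j = m + 1..n. (k (real j / p))\<^sup>2) \<le> B * p * (real m / p) powr (1 - 2 * \<alpha>)"
    by (rule kernel_tail) blast
  define \<tau> where "\<tau> n = B * sqrt (real n / p n) powr (1 - 2 * \<alpha>)" for n
  have "(\<lambda>n. B * sqrt (real n / p n) powr (1 - 2 * \<alpha>)) \<longlonglongrightarrow> B * 0"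
    using \<alpha> by (intro tendsto_mult tendsto_const tendsto_neg_powr ratio_limit) auto
  then have \<tau>: "\<tau> \<longlonglongrightarrow> 0" by (simp add: \<tau>_def[abs_def])
  have ev: "\<forall>\<^sub>F n in sequentially. p n \<ge> P" "\<forall>\<^sub>F n in sequentially. p n / real n < 1 / 2"
    "\<forall>\<^sub>F n in sequentially. rho n < 1 / 2" "\<forall>\<^sub>F n in sequentially. sqrt (real n / p n) \<ge> X"
    using p_infinity ratio_limit unfolding filterlim_at_top apply blast
    using order_tendstoD(2)[OF p_rate, of "1/2"] order_tendstoD(2)[OF rho_limit, of "1/2"] apply (simp, simp)
    using ratio_limit unfolding filterlim_at_top by blast
  have "\<forall>\<^sub>F n in sequentially. lag_bounds C c \<tau> n"
    unfolding lag_bounds_def using ev eventually_ge_at_top[of 4]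
  proof eventually_elim
    case (elim n)
    have n: "real n > 0" and p1: "p n \<ge> 1" using elim c by auto
    have qn: "real (q n) < real n / 2" using elim(3) n by (simp add: rho_def field_simps)
    have q2: "q n + 2 \<le> n" using qn elim(5) by linarith
    have qs: "real (q n) \<ge> sqrt (p n * real n)" unfolding q_def by linarith
    have "sqrt (p n * real n) = p n * sqrt (real n / p n)"
    proof -
      define s where "s = sqrt (p n)"
      have s: "s > 0" "p n = s * s" using p1 by (simp_all add: s_def)
      have "p n * sqrt (real n / p n) = (s * s) * (sqrt (real n) / s)" using p1 by (simp add: real_sqrt_divide s_def)
      also have "\<dots> = s * sqrt (real n)" using s(1) by simp
      finally show ?thesis by (simp add: real_sqrt_mult s_def)
    qed
    then have qp: "real (q n) / p n \<ge> sqrt (real n / p n)" using qs p1 by (simp add: field_simps)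
    have qX: "real (q n) \<ge> X * p n"
    proof -
      have "X * p n \<le> real (q n) / p n * p n" using qp elim(4) p1 by (intro mult_right_mono) auto
      then show ?thesis using p1 by simp
    qed
    have "X * p n \<ge> 1 * 1" using B p1 by (intro mult_mono) auto
    then have q1: "q n \<ge> 1" using qX by linarith
    have CC: "(\<Sum>j = 1..m. (k (real j / p n))\<^sup>2) \<le> C * p n" for m using C(2) p1 by blast
    have k4: "(k x) ^ 4 \<le> (k x)\<^sup>2" for x
      using mult_left_le[OF k_sq_le_1[of x], of "(k x)\<^sup>2"] by (simp add: power4_eq_xxxx power2_eq_square mult.assoc)
    have WC: "W n \<le> C * p n" unfolding W_eq using CC by (intro order_trans[OF sum_mono[OF k4]])
    have "(\<Sum>j = q n + 1..n. (k (real j / p n)) ^ 4) \<le> (\<Sum>j = q n + 1..n. (k (real j / p n))\<^sup>2)" by (rule sum_mono[OF k4])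
    also have "\<dots> \<le> B * p n * (real (q n) / p n) powr (1 - 2 * \<alpha>)" using p1 q1 qX by (intro tail) auto
    also have "\<dots> \<le> B * p n * sqrt (real n / p n) powr (1 - 2 * \<alpha>)"
      using qp B p1 n \<alpha> by (intro mult_left_mono powr_mono2') auto
    also have "\<dots> = p n * \<tau> n" by (simp add: \<tau>_def)
    finally have tl: "(\<Sum>j = q n + 1..n. (k (real j / p n)) ^ 4) \<le> p n * \<tau> n" .
    have "(\<Sum>j\<in>{int (q n) + 1..int n}. (w n j)\<^sup>2) = (\<Sum>j = q n + 1..n. (k (real j / p n)) ^ 4)"
    proof -
      have "{int (q n) + 1..int n} = int ` {q n + 1..n}" by (simp add: image_int_atLeastAtMost)
      then show ?thesis by (simp add: sum.reindex w_def flip: power_mult)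
    qed
    with tl have tl2: "(\<Sum>j\<in>{int (q n) + 1..int n}. (w n j)\<^sup>2) \<le> p n * \<tau> n" by simp
    have coef: "0 \<le> 1 - real j / real n" "1 - real j / real n \<le> 1" if "j \<le> n" for j
      using that n by (auto simp: field_simps)
    have "D n \<le> (\<Sum>j = 1..n - 2. (k (real j / p n)) ^ 4)" unfolding D_def D_coeff_def
    proof (rule sum_mono)
      fix j assume "j \<in> {1..n - 2}"
      then have "j \<le> n" "j + 1 \<le> n" using elim(5) by auto
      from coef[OF this(1)] coef[OF this(2)]
      have "(1 - real j / real n) * (1 - real (j + 1) / real n) \<le> 1 * 1" by (intro mult_mono) auto
      then show "(1 - real j / real n) * (1 - real (j + 1) / real n) * k (real j / p n) ^ 4 \<le> k (real j / p n) ^ 4"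
        using mult_right_mono[of "(1 - real j / real n) * (1 - real (j + 1) / real n)" 1 "k (real j / p n) ^ 4"] by simp
    qed
    also have "\<dots> \<le> (\<Sum>j\<in>{1..q n} \<union> {q n + 1..n}. (k (real j / p n)) ^ 4)" by (intro sum_mono2) auto
    also have "\<dots> = W n + (\<Sum>j = q n + 1..n. (k (real j / p n)) ^ 4)"
      unfolding W_eq by (intro sum.union_disjoint) auto
    finally have DU: "D n \<le> W n + p n * \<tau> n" using tl by linarith
    have "(1 - (rho n + 1 / real n))\<^sup>2 * W n = (\<Sum>j = 1..q n. (1 - (rho n + 1 / real n))\<^sup>2 * (k (real j / p n)) ^ 4)"
      unfolding W_eq by (rule sum_distrib_left)
    also have "\<dots> \<le> (\<Sum>j = 1..q n. (1 - real j / real n) * (1 - real (j + 1) / real n) * k (real j / p n) ^ 4)"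
    proof (rule sum_mono)
      fix j assume j: "j \<in> {1..q n}"
      have r: "rho n + 1 / real n = real (q n + 1) / real n" by (simp add: rho_def add_divide_distrib)
      have "real j / real n \<le> real (q n + 1) / real n" "real (j + 1) / real n \<le> real (q n + 1) / real n"
        using j by (auto intro!: divide_right_mono)
      moreover have "real (q n + 1) / real n \<le> 1" using q2 n by simp
      ultimately have "(1 - (rho n + 1 / real n)) * (1 - (rho n + 1 / real n)) \<le> (1 - real j / real n) * (1 - real (j + 1) / real n)"
        unfolding r by (intro mult_mono) auto
      then show "(1 - (rho n + 1 / real n))\<^sup>2 * k (real j / p n) ^ 4 \<le> (1 - real j / real n) * (1 - real (j + 1) / real n) * k (real j / p n) ^ 4"
        unfolding power2_eq_square by (intro mult_right_mono) auto
    qed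
    also have "\<dots> \<le> D n" unfolding D_def D_coeff_def
    proof (rule sum_mono2)
      show "{1..q n} \<subseteq> {1..n - 2}" using q2 by auto
      fix j assume "j \<in> {1..n - 2} - {1..q n}"
      then have "j \<le> n" "j + 1 \<le> n" using elim(5) by auto
      from coef(1)[OF this(1)] coef(1)[OF this(2)]
      show "0 \<le> (1 - real j / real n) * (1 - real (j + 1) / real n) * k (real j / p n) ^ 4" by simp
    qed simp
    finally have DL: "(1 - (rho n + 1 / real n))\<^sup>2 * W n \<le> D n" .
    have "c * p n \<le> D n" unfolding D_def using elim n by (intro c(3)) (auto simp: field_simps)
    then show ?case using elim p1 q2 CC WC tl2 DU DL by blast
  qed
  then show ?thesis using C(1) c(1) \<tau> by (intro that[of C c \<tau>]) auto
qed

text \<open>The total of the variance proxies of the scaled increments, as in \<open>char_increments_bound\<close>.\<close>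

definition V :: "nat \<Rightarrow> real" where
  "V n = (lam n)\<^sup>2 * kappa\<^sup>2 * W n * (\<Sum>i<n. real (card {int (q n) + 1..int i + 1 - int (q n) - 1}))"

text \<open>\<open>V\<close> is the product of \<open>W / D\<close> and \<open>2 T / n\<^sup>2\<close>, where \<open>T\<close> is the number of admissible pairs \<open>(t, s)\<close>. Both factors tend to one
because the gaps of length \<open>q\<close> remove a negligible proportion of all pairs.\<close>

lemma V_limit: "V \<longlonglongrightarrow> 1"
proof -
  obtain C c \<tau> where C: "C > 0" and c: "c > 0" and \<tau>: "\<tau> \<longlonglongrightarrow> 0"
    and ev: "\<forall>\<^sub>F n in sequentially. lag_bounds C c \<tau> n"
    by (rule asymptotic_bounds)
  define T where "T n = (\<Sum>i<n. real (card {int (q n) + 1..int i + 1 - int (q n) - 1}))" for n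
  have gauss: "(\<Sum>i<n. real i) = real n * (real n - 1) / 2" for n by (induction n) (auto simp: field_simps)
  have TU: "2 * T n / (real n)\<^sup>2 \<le> 1" if "n \<ge> 4" for n
  proof -
    have "T n \<le> (\<Sum>i<n. real i)" unfolding T_def by (intro sum_mono) simp
    also have "\<dots> \<le> (real n)\<^sup>2 / 2" using that unfolding gauss by (simp add: power2_eq_square field_simps)
    finally show ?thesis using that by (simp add: field_simps)
  qed
  have TL: "2 * T n / (real n)\<^sup>2 \<ge> 1 - 1 / real n - 4 * rho n" if "n \<ge> 4" for n
  proof -
    have "real n * (real n - 1) / 2 - real n * (2 * real (q n)) = (\<Sum>i<n. real i - 2 * real (q n))"
      by (simp add: sum_subtractf gauss)
    also have "\<dots> \<le> T n" unfolding T_def card_atLeastAtMost_int by (intro sum_mono) linarith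
    finally have "(real n * (real n - 1) - 4 * real n * real (q n)) / (real n)\<^sup>2 \<le> 2 * T n / (real n)\<^sup>2"
      by (intro divide_right_mono) auto
    moreover have "(real n * (real n - 1) - 4 * real n * real (q n)) / (real n)\<^sup>2 = 1 - 1 / real n - 4 * rho n"
      using that by (simp add: rho_def power2_eq_square field_simps)
    ultimately show ?thesis by simp
  qed
  have T1: "(\<lambda>n. 2 * T n / (real n)\<^sup>2) \<longlonglongrightarrow> 1"
  proof (rule tendsto_sandwich)
    have "(\<lambda>n. 1 - 1 / real n - 4 * rho n) \<longlonglongrightarrow> 1 - 0 - 4 * 0"
      by (intro tendsto_intros lim_1_over_n rho_limit)
    then show "(\<lambda>n. 1 - 1 / real n - 4 * rho n) \<longlonglongrightarrow> 1" by simp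
    show "\<forall>\<^sub>F n in sequentially. 1 - 1 / real n - 4 * rho n \<le> 2 * T n / (real n)\<^sup>2"
      using eventually_ge_at_top[of 4] by eventually_elim (rule TL)
    show "\<forall>\<^sub>F n in sequentially. 2 * T n / (real n)\<^sup>2 \<le> 1"
      using eventually_ge_at_top[of 4] by eventually_elim (rule TU)
  qed simp
  have W1: "(\<lambda>n. W n / D n) \<longlonglongrightarrow> 1"
  proof (rule tendsto_sandwich)
    have "(\<lambda>n. 1 - \<tau> n / c) \<longlonglongrightarrow> 1 - 0 / c" using c by (intro tendsto_intros \<tau>) auto
    then show "(\<lambda>n. 1 - \<tau> n / c) \<longlonglongrightarrow> 1" by simp
    have l: "(\<lambda>n. rho n + 1 / real n) \<longlonglongrightarrow> 0 + 0" by (intro tendsto_add rho_limit lim_1_over_n)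
    have "(\<lambda>n. 1 / (1 - (rho n + 1 / real n))\<^sup>2) \<longlonglongrightarrow> 1 / (1 - (0 + 0))\<^sup>2"
      by (intro tendsto_intros l) auto
    then show "(\<lambda>n. 1 / (1 - (rho n + 1 / real n))\<^sup>2) \<longlonglongrightarrow> 1" by simp
    have ev2: "\<forall>\<^sub>F n in sequentially. rho n + 1 / real n < 1" using order_tendstoD(2)[OF l, of 1] by simp
    show "\<forall>\<^sub>F n in sequentially. W n / D n \<le> 1 / (1 - (rho n + 1 / real n))\<^sup>2"
      using ev[unfolded lag_bounds_def] ev2
    proof eventually_elim
      case (elim n)
      have "c * p n > 0" using c elim by simp
      then have "D n > 0" using elim by linarith
      moreover have "(1 - (rho n + 1 / real n))\<^sup>2 > 0" using elim by simp
      moreover have "x / d \<le> 1 / a" if "0 < d" "0 < a" "a * x \<le> d" for x d a :: real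
        using that by (simp add: field_simps)
      ultimately show ?case using elim by blast
    qed
    show "\<forall>\<^sub>F n in sequentially. 1 - \<tau> n / c \<le> W n / D n"
      using ev[unfolded lag_bounds_def]
    proof eventually_elim
      case (elim n)
      have pp: "p n > 0" using elim by linarith
      have "c * p n > 0" using c elim by simp
      then have D: "D n > 0" using elim by linarith
      have "0 \<le> p n * \<tau> n" using elim by (meson order_trans sum_nonneg zero_le_power2)
      then have "\<tau> n \<ge> 0" using pp by (simp add: zero_le_mult_iff)
      have "p n * \<tau> n / D n \<le> p n * \<tau> n / (c * p n)"
        using \<open>0 \<le> p n * \<tau> n\<close> \<open>c * p n > 0\<close> elim by (intro divide_left_mono) auto
      also have "\<dots> = \<tau> n / c" using pp by simp
      finally have "p n * \<tau> n / D n \<le> \<tau> n / c" .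
      moreover have "1 - e / d \<le> x / d" if "0 < d" "d \<le> x + e" for x d e :: real
      proof -
        have "1 \<le> (x + e) / d" using that by simp
        then show ?thesis by (simp add: add_divide_distrib)
      qed
      then have "1 - p n * \<tau> n / D n \<le> W n / D n" using elim D by blast
      ultimately show ?case by linarith
    qed
  qed
  have "\<forall>\<^sub>F n in sequentially. 2 * T n / (real n)\<^sup>2 * (W n / D n) = V n"
    using ev[unfolded lag_bounds_def]
  proof eventually_elim
    case (elim n)
    have "c * p n > 0" using c elim by simp
    then have D: "D n > 0" using elim by linarith
    have "(lam n)\<^sup>2 * kappa\<^sup>2 = 2 / ((real n)\<^sup>2 * D n)"
      using D kpos elim by (simp add: lam_def power_divide power_mult_distrib field_simps)
    then show ?case unfolding V_def T_def[symmetric] by simp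
  qed
  moreover have "(\<lambda>n. 2 * T n / (real n)\<^sup>2 * (W n / D n)) \<longlonglongrightarrow> 1 * 1" by (intro tendsto_mult T1 W1)
  ultimately show ?thesis by (simp add: tendsto_cong)
qed

text \<open>\<open>Y\<close> is the scaled sum of the increments. \<open>X\<close> is the statistic with \<open>\<parallel>C\<^sub>n(0)\<parallel>\<^sup>2\<close> replaced by \<open>kappa\<close> in the
denominator. They turn out to be asymptotically equivalent.\<close>

definition Y :: "nat \<Rightarrow> 'a \<Rightarrow> real" where
  "Y n \<omega> = lam n * (\<Sum>t\<in>{1..int n}. increment (w n) (int (q n)) t (path \<omega>))"

definition X :: "nat \<Rightarrow> 'a \<Rightarrow> real" where
  "X n \<omega> = ((1 / 2) * real n * Q_hat_sq k (p n) (path \<omega>) n - (sigma_hat_sq (path \<omega>) n)\<^sup>2 * C_coeff k (p n) n)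
     / (kappa * sqrt (2 * D n))"

text \<open>The bounds for the scaling factor \<open>lam\<close> that follow from \<open>lag_bounds\<close>. The last one controls the variance of the
discarded off-diagonal terms.\<close>

definition scale_bounds :: "real \<Rightarrow> real \<Rightarrow> real \<Rightarrow> (nat \<Rightarrow> real) \<Rightarrow> nat \<Rightarrow> bool" where
  "scale_bounds C L c \<tau> n \<longleftrightarrow>
     n \<ge> 4 \<and> p n \<ge> 1 \<and> (\<Sum>j = 1..n. (k (real j / p n))\<^sup>2) \<le> C * p n \<and> W n \<le> C * p n \<and>
       c * p n \<le> D n \<and> (lam n)\<^sup>2 \<le> L / ((real n)\<^sup>2 * p n) \<and> (lam n)\<^sup>2 * W n \<le> L * C / (real n)\<^sup>2 \<and>
       (lam n)\<^sup>2 * ((real n)\<^sup>2 * (\<Sum>j\<in>{int (q n) + 1..int n}. (w n j)\<^sup>2) + 2 * real n * real (q n) * W n)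
         \<le> L * (\<tau> n + 2 * C * rho n)"

lemma scaled_bounds:
  obtains C L c :: real and \<tau> :: "nat \<Rightarrow> real" where "C > 0" "L > 0" "c > 0" "\<tau> \<longlonglongrightarrow> 0"
    "\<forall>\<^sub>F n in sequentially. scale_bounds C L c \<tau> n"
proof -
  obtain C c \<tau> where C: "C > 0" and c: "c > 0" and \<tau>: "\<tau> \<longlonglongrightarrow> 0"
    and ev: "\<forall>\<^sub>F n in sequentially. lag_bounds C c \<tau> n"
    by (rule asymptotic_bounds)
  define L where "L = 2 / (kappa\<^sup>2 * c)"
  have L: "L > 0" using c kpos by (simp add: L_def)
  have "\<forall>\<^sub>F n in sequentially. scale_bounds C L c \<tau> n"
    unfolding scale_bounds_def using ev[unfolded lag_bounds_def]
  proof eventually_elim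
    case (elim n)
    have n: "real n > 0" and pp: "p n > 0" using elim by auto
    have cp: "c * p n > 0" using c elim by simp
    then have D: "D n > 0" using elim by linarith
    have l0: "(lam n)\<^sup>2 = 2 / ((real n)\<^sup>2 * kappa\<^sup>2 * D n)"
      using D by (simp add: lam_def power_divide power_mult_distrib)
    have "c * p n \<le> D n" using elim by blast
    then have "2 / ((real n)\<^sup>2 * kappa\<^sup>2 * D n) \<le> 2 / ((real n)\<^sup>2 * kappa\<^sup>2 * (c * p n))"
      using D c pp n kpos by (intro divide_left_mono mult_left_mono mult_pos_pos) auto
    also have "2 / ((real n)\<^sup>2 * kappa\<^sup>2 * (c * p n)) = L / ((real n)\<^sup>2 * p n)" by (simp add: L_def)
    finally have l: "(lam n)\<^sup>2 \<le> L / ((real n)\<^sup>2 * p n)" unfolding l0 .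
    have lp: "0 \<le> L / ((real n)\<^sup>2 * p n)" using L pp by simp
    have "(lam n)\<^sup>2 * W n \<le> L / ((real n)\<^sup>2 * p n) * (C * p n)"
      using elim l lp W_nonneg by (intro mult_mono) auto
    also have "\<dots> = L * C / (real n)\<^sup>2" using pp by simp
    finally have lW: "(lam n)\<^sup>2 * W n \<le> L * C / (real n)\<^sup>2" .
    have "(lam n)\<^sup>2 * ((real n)\<^sup>2 * (\<Sum>j\<in>{int (q n) + 1..int n}. (w n j)\<^sup>2) + 2 * real n * real (q n) * W n) \<le>
       L / ((real n)\<^sup>2 * p n) * ((real n)\<^sup>2 * (p n * \<tau> n) + 2 * real n * real (q n) * (C * p n))"
      using elim l lp W_nonneg[of n] by (intro mult_mono add_mono mult_left_mono add_nonneg_nonneg mult_nonneg_nonneg sum_nonneg) auto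
    also have "\<dots> = L * (\<tau> n + 2 * C * rho n)"
      using pp n by (simp add: rho_def field_simps power2_eq_square)
    finally show ?case using elim l lW by blast
  qed
  then show ?thesis using C L c \<tau> by (intro that[of C L c \<tau>]) auto
qed

text \<open>With \<open>lam\<^sup>2 W = O(1/n\<^sup>2)\<close> the bound of \<open>char_increments_bound\<close> is at most \<open>E n\<close>, a sum of terms of orders \<open>\<surd>(q/n)\<close>, \<open>1/\<surd>n\<close>,
\<open>1/\<surd>p\<close> and \<open>1/n\<close>.\<close>

lemma char_Y_limit: "(\<lambda>n. expectation (\<lambda>\<omega>. iexp (\<theta> * Y n \<omega>))) \<longlonglongrightarrow> of_real (exp (- \<theta>\<^sup>2 / 2))"
proof -
  obtain C L c \<tau> where C: "C > 0" and L: "L > 0" and c: "c > 0" and \<tau>: "\<tau> \<longlonglongrightarrow> 0"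
    and ev: "\<forall>\<^sub>F n in sequentially. scale_bounds C L c \<tau> n"
    by (rule scaled_bounds)
  define K where "K = L * C"
  define b where "b = 3 * m4\<^sup>2 * K"
  define B where "B = sigma2 ^ 4 * m4\<^sup>2"
  have K: "K > 0" using C L by (simp add: K_def)
  have b: "b \<ge> 0" using K by (simp add: b_def)
  have B: "B \<ge> 0" using sigma2_nonneg by (simp add: B_def)
  define E where "E n = \<theta>\<^sup>2 / 2 * (\<bar>\<theta>\<bar> * (sqrt (2 * m4\<^sup>2 * (K * rho n)) * (sqrt 2 * b))
      + (K * sqrt (3 * B) * (1 / sqrt (real n)) + 2 * L * sqrt (2 * B * C) * (1 / sqrt (p n))))
      + \<bar>\<theta>\<bar> ^ 3 / 6 * (sqrt b * b * (1 / sqrt (real n))) + \<theta> ^ 4 * b\<^sup>2 / 8 * (1 / real n)" for n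
  have sn: "(\<lambda>n. 1 / sqrt (real n)) \<longlonglongrightarrow> 0"
    using tendsto_real_sqrt[OF lim_1_over_n] by (simp add: real_sqrt_divide)
  have sp: "(\<lambda>n. 1 / sqrt (p n)) \<longlonglongrightarrow> 0"
    using tendsto_inverse_0_at_top[OF filterlim_compose[OF sqrt_at_top p_infinity]] by (simp add: inverse_eq_divide)
  have "E \<longlonglongrightarrow> \<theta>\<^sup>2 / 2 * (\<bar>\<theta>\<bar> * (sqrt (2 * m4\<^sup>2 * (K * 0)) * (sqrt 2 * b))
      + (K * sqrt (3 * B) * 0 + 2 * L * sqrt (2 * B * C) * 0))
      + \<bar>\<theta>\<bar> ^ 3 / 6 * (sqrt b * b * 0) + \<theta> ^ 4 * b\<^sup>2 / 8 * 0"
    unfolding E_def[abs_def] by (intro tendsto_intros sn sp rho_limit lim_1_over_n)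
  then have E0: "E \<longlonglongrightarrow> 0" by simp
  have "\<forall>\<^sub>F n in sequentially. norm (expectation (\<lambda>\<omega>. iexp (\<theta> * Y n \<omega>)) - of_real (exp (- \<theta>\<^sup>2 * V n / 2))) \<le> E n"
    using ev[unfolded scale_bounds_def]
  proof eventually_elim
    case (elim n)
    have n: "real n > 0" and pp: "p n > 0" using elim by auto
    define \<beta> where "\<beta> = 3 * m4\<^sup>2 * ((lam n)\<^sup>2 * (real n * W n))"
    have lW: "(lam n)\<^sup>2 * W n \<le> K / (real n)\<^sup>2" using elim by (simp add: K_def)
    have b1: "(lam n)\<^sup>2 * (real n * W n) \<le> K / real n"
      using mult_left_mono[OF lW, of "real n"] n by (simp add: power2_eq_square mult_ac)
    have \<beta>: "\<beta> \<le> b / real n" "\<beta> \<ge> 0"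
      using mult_left_mono[OF b1, of "3 * m4\<^sup>2"] W_nonneg[of n] by (simp_all add: \<beta>_def b_def)
    have t1: "(lam n)\<^sup>2 * (real (q n) * real n * W n) \<le> K * rho n"
      using mult_left_mono[OF b1, of "real (q n)"] by (simp add: rho_def mult_ac)
    have t2: "(lam n)\<^sup>2 * (W n * sqrt (3 * real n * B)) \<le> K / (real n)\<^sup>2 * sqrt (3 * real n * B)"
      using mult_right_mono[OF lW, of "sqrt (3 * real n * B)"] B by (simp add: mult.assoc)
    have t3: "(lam n)\<^sup>2 * (2 * sqrt (2 * B * ((real n)\<^sup>2 * W n))) \<le> L / ((real n)\<^sup>2 * p n) * (2 * (real n * sqrt (2 * B * (C * p n))))"
    proof -
      have "sqrt (2 * B * ((real n)\<^sup>2 * W n)) = real n * sqrt (2 * B * W n)" by (simp add: real_sqrt_mult mult_ac)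
      also have "\<dots> \<le> real n * sqrt (2 * B * (C * p n))" using elim B by (intro mult_left_mono real_sqrt_le_mono) auto
      finally show ?thesis using elim L pp B W_nonneg[of n] by (intro mult_mono) auto
    qed
    have "norm (expectation (\<lambda>\<omega>. iexp (\<theta> * Y n \<omega>)) - of_real (exp (- \<theta>\<^sup>2 * V n / 2))) \<le>
     real n * (\<theta>\<^sup>2 / 2 * (\<bar>\<theta>\<bar> * (sqrt (2 * m4\<^sup>2 * ((lam n)\<^sup>2 * (real (q n) * real n * W n))) * sqrt (2 * \<beta>\<^sup>2))
         + (lam n)\<^sup>2 * (W n * sqrt (3 * real n * B) + 2 * sqrt (2 * B * ((real n)\<^sup>2 * W n))))
      + \<bar>\<theta>\<bar> ^ 3 / 6 * (sqrt \<beta> * \<beta>) + \<theta> ^ 4 * \<beta>\<^sup>2 / 8)"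
      unfolding Y_def V_def W_def \<beta>_def B_def by (rule char_increments_bound) (rule w_le_1)
    also have "\<dots> \<le> real n * (\<theta>\<^sup>2 / 2 * (\<bar>\<theta>\<bar> * (sqrt (2 * m4\<^sup>2 * (K * rho n)) * sqrt (2 * (b / real n)\<^sup>2))
         + (K / (real n)\<^sup>2 * sqrt (3 * real n * B) + L / ((real n)\<^sup>2 * p n) * (2 * (real n * sqrt (2 * B * (C * p n))))))
      + \<bar>\<theta>\<bar> ^ 3 / 6 * (sqrt (b / real n) * (b / real n)) + \<theta> ^ 4 * (b / real n)\<^sup>2 / 8)"
    proof -
      have s1: "sqrt (2 * m4\<^sup>2 * ((lam n)\<^sup>2 * (real (q n) * real n * W n))) \<le> sqrt (2 * m4\<^sup>2 * (K * rho n))"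
        using t1 by (intro real_sqrt_le_mono mult_left_mono) auto
      have s2: "sqrt (2 * \<beta>\<^sup>2) \<le> sqrt (2 * (b / real n)\<^sup>2)"
        using \<beta> by (intro real_sqrt_le_mono mult_left_mono power_mono) auto
      have s3: "sqrt \<beta> * \<beta> \<le> sqrt (b / real n) * (b / real n)"
        using \<beta> b by (intro mult_mono real_sqrt_le_mono) auto
      have s4: "\<beta>\<^sup>2 \<le> (b / real n)\<^sup>2" using \<beta> by (intro power_mono)
      have s12: "sqrt (2 * m4\<^sup>2 * ((lam n)\<^sup>2 * (real (q n) * real n * W n))) * sqrt (2 * \<beta>\<^sup>2) \<le>
         sqrt (2 * m4\<^sup>2 * (K * rho n)) * sqrt (2 * (b / real n)\<^sup>2)"
        using K by (intro mult_mono s1 s2) (auto simp: rho_def)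
      have s5: "(lam n)\<^sup>2 * (W n * sqrt (3 * real n * B) + 2 * sqrt (2 * B * ((real n)\<^sup>2 * W n))) \<le>
        K / (real n)\<^sup>2 * sqrt (3 * real n * B) + L / ((real n)\<^sup>2 * p n) * (2 * (real n * sqrt (2 * B * (C * p n))))"
        unfolding distrib_left by (intro add_mono t2 t3)
      show ?thesis
        by (intro mult_left_mono add_mono divide_right_mono s12 s3 s4 s5) auto
    qed
    also have "\<dots> = E n"
    proof -
      have r1: "sqrt (2 * (b / real n)\<^sup>2) = sqrt 2 * b / real n" using b n by (simp add: real_sqrt_mult)
      have sq: "sqrt (real n) * sqrt (real n) = real n" "sqrt (p n) * sqrt (p n) = p n" using n pp by auto
      have r2: "real n * (K / (real n)\<^sup>2 * sqrt (3 * real n * B)) = K * sqrt (3 * B) * (1 / sqrt (real n))"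
        using n by (simp add: real_sqrt_mult power2_eq_square field_simps)
      have r3: "real n * (L / ((real n)\<^sup>2 * p n) * (2 * (real n * sqrt (2 * B * (C * p n))))) = 2 * L * sqrt (2 * B * C) * (1 / sqrt (p n))"
        using n pp sq by (simp add: real_sqrt_mult power2_eq_square field_simps)
      have r4: "real n * (sqrt (b / real n) * (b / real n)) = sqrt b * b * (1 / sqrt (real n))"
        using n by (simp add: real_sqrt_divide field_simps)
      have r5: "real n * (b / real n)\<^sup>2 = b\<^sup>2 * (1 / real n)" using n by (simp add: power2_eq_square field_simps)
      have "real n * (x / 2 * (y * (z * (sqrt 2 * b / real n)) + (f + g)) + h / 6 * e + i * j / 8) =
         x / 2 * (y * (z * (sqrt 2 * b)) + (real n * f + real n * g)) + h / 6 * (real n * e) + i * (real n * j) / 8" for x y z f g h e i j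
        using n by (simp add: field_simps)
      then show ?thesis unfolding r1 E_def by (simp only: r2 r3 r4 r5) simp
    qed
    finally show ?case .
  qed
  then have "(\<lambda>n. norm (expectation (\<lambda>\<omega>. iexp (\<theta> * Y n \<omega>)) - of_real (exp (- \<theta>\<^sup>2 * V n / 2)))) \<longlonglongrightarrow> 0"
    by (intro tendsto_sandwich[OF _ _ tendsto_const E0]) auto
  then have 1: "(\<lambda>n. expectation (\<lambda>\<omega>. iexp (\<theta> * Y n \<omega>)) - of_real (exp (- \<theta>\<^sup>2 * V n / 2))) \<longlonglongrightarrow> 0"
    by (simp add: tendsto_norm_zero_iff)
  have "(\<lambda>n. complex_of_real (exp (- \<theta>\<^sup>2 * V n / 2))) \<longlonglongrightarrow> of_real (exp (- \<theta>\<^sup>2 * 1 / 2))"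
    by (intro tendsto_intros V_limit) auto
  from tendsto_add[OF 1 this] show ?thesis by simp
qed

lemma Y_sq: "n \<ge> 1 \<Longrightarrow> sq_integrable (Y n)"
  unfolding Y_def[abs_def] by (intro sq_integrable_cmult increments_variance(1)[where n = n]) auto

lemma X_eq:
  assumes "n \<ge> 1"
  shows "X n \<omega> = Y n \<omega> + (diag_err k (p n) n (path \<omega>) / (kappa * sqrt (2 * D n))
     + lam n * (\<Sum>(t, s, j)\<in>rest_idx (q n) n. w n j * lagged (\<bullet>) t s j (path \<omega>)))"
proof -
  have l: "lam n = (2 / real n) / (kappa * sqrt (2 * D n))" by (simp add: lam_def)
  show ?thesis
    unfolding X_def statistic_numerator[OF assms k_zero k_symmetric, where q = "q n"] w_def[symmetric] Y_def l
    by (simp add: w_def[abs_def] add_divide_distrib distrib_left)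
qed

text \<open>The difference consists of the diagonal part, of order \<open>\<surd>(p/n)\<close> after scaling, and of the discarded off-diagonal terms.\<close>

lemma X_close:
  shows "(\<lambda>n. expectation (\<lambda>\<omega>. \<bar>X n \<omega> - Y n \<omega>\<bar>)) \<longlonglongrightarrow> 0"
    and "\<forall>\<^sub>F n in sequentially. integrable M (X n)"
    and "\<exists>K. \<forall>\<^sub>F n in sequentially. expectation (\<lambda>\<omega>. \<bar>Y n \<omega>\<bar>) \<le> K"
proof -
  obtain C L c \<tau> where C: "C > 0" and L: "L > 0" and c: "c > 0" and \<tau>: "\<tau> \<longlonglongrightarrow> 0"
    and ev: "\<forall>\<^sub>F n in sequentially. scale_bounds C L c \<tau> n"
    by (rule scaled_bounds)
  define R where "R n \<omega> = (\<Sum>(t, s, j)\<in>rest_idx (q n) n. w n j * lagged (\<bullet>) t s j (path \<omega>))" for n \<omega>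
  define G where "G n \<omega> = diag_err k (p n) n (path \<omega>) / (kappa * sqrt (2 * D n))" for n \<omega>
  have Xe: "X n \<omega> = Y n \<omega> + (G n \<omega> + lam n * R n \<omega>)" if "n \<ge> 1" for n \<omega>
    using X_eq[OF that] by (simp add: G_def R_def)
  have R: "sq_integrable (R n)" for n unfolding R_def[abs_def] by (rule rest_bound(1))
  have iR: "integrable M (R n)" for n by (rule sq_integrable_integrable[OF R])
  have iG: "integrable M (G n)" if "n \<ge> 1" for n unfolding G_def[abs_def] using diag_err_bound(1)[OF that] by simp
  show "\<forall>\<^sub>F n in sequentially. integrable M (X n)" using eventually_ge_at_top[of 1]
  proof eventually_elim
    case (elim n)
    have "integrable M (\<lambda>\<omega>. Y n \<omega> + (G n \<omega> + lam n * R n \<omega>))"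
      using sq_integrable_integrable[OF Y_sq[OF elim]] iG[OF elim] iR by auto
    then show ?case using Xe[OF elim] by (metis (no_types, lifting) Bochner_Integration.integrable_cong)
  qed
  define E where "E n = 5 * m4 * C / (kappa * sqrt (2 * c)) * sqrt (p n / real n) + sqrt (2 * m4\<^sup>2 * (L * (\<tau> n + 2 * C * rho n)))" for n
  have "E \<longlonglongrightarrow> 5 * m4 * C / (kappa * sqrt (2 * c)) * sqrt 0 + sqrt (2 * m4\<^sup>2 * (L * (0 + 2 * C * 0)))"
    unfolding E_def[abs_def] by (intro tendsto_intros p_rate \<tau> rho_limit)
  then have E0: "E \<longlonglongrightarrow> 0" by simp
  have "\<forall>\<^sub>F n in sequentially. expectation (\<lambda>\<omega>. \<bar>X n \<omega> - Y n \<omega>\<bar>) \<le> E n"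
    using ev[unfolded scale_bounds_def]
  proof eventually_elim
    case (elim n)
    have n1: "n \<ge> 1" and n: "real n > 0" and pp: "p n > 0" using elim by auto
    have cp: "c * p n > 0" using c elim by simp
    then have D: "D n > 0" using elim by linarith
    have "expectation (\<lambda>\<omega>. \<bar>X n \<omega> - Y n \<omega>\<bar>) \<le> expectation (\<lambda>\<omega>. \<bar>G n \<omega>\<bar> + \<bar>lam n * R n \<omega>\<bar>)"
      unfolding Xe[OF n1] using iG[OF n1] iR by (intro integral_mono) auto
    also have "\<dots> = expectation (\<lambda>\<omega>. \<bar>G n \<omega>\<bar>) + expectation (\<lambda>\<omega>. \<bar>lam n * R n \<omega>\<bar>)"
      using iG[OF n1] iR by (intro Bochner_Integration.integral_add) auto
    also have "expectation (\<lambda>\<omega>. \<bar>G n \<omega>\<bar>) \<le> 5 * m4 * C / (kappa * sqrt (2 * c)) * sqrt (p n / real n)"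
    proof -
      have "expectation (\<lambda>\<omega>. \<bar>G n \<omega>\<bar>) = expectation (\<lambda>\<omega>. \<bar>diag_err k (p n) n (path \<omega>)\<bar>) / (kappa * sqrt (2 * D n))"
        using kpos D by (simp add: G_def abs_mult)
      also have "\<dots> \<le> (C * p n * (5 * m4 / sqrt (real n))) / (kappa * sqrt (2 * (c * p n)))"
      proof (rule frac_le)
        show "expectation (\<lambda>\<omega>. \<bar>diag_err k (p n) n (path \<omega>)\<bar>) \<le> C * p n * (5 * m4 / sqrt (real n))"
          using elim m4_nonneg by (intro order_trans[OF diag_err_bound(2)[OF n1]] mult_right_mono) auto
        show "kappa * sqrt (2 * (c * p n)) \<le> kappa * sqrt (2 * D n)"
          using elim kpos by (intro mult_left_mono real_sqrt_le_mono) auto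
      qed (use kpos cp C pp m4_nonneg in auto)
      also have "\<dots> = 5 * m4 * C / (kappa * sqrt (2 * c)) * (p n / sqrt (p n) / sqrt (real n))"
        by (simp add: real_sqrt_mult mult_ac)
      also have "p n / sqrt (p n) / sqrt (real n) = sqrt (p n / real n)"
        using pp by (simp add: real_sqrt_divide real_div_sqrt)
      finally show ?thesis .
    qed
    also have "expectation (\<lambda>\<omega>. \<bar>lam n * R n \<omega>\<bar>) \<le> sqrt (2 * m4\<^sup>2 * (L * (\<tau> n + 2 * C * rho n)))"
    proof -
      have "expectation (\<lambda>\<omega>. (lam n * R n \<omega>)\<^sup>2) = (lam n)\<^sup>2 * expectation (\<lambda>\<omega>. (R n \<omega>)\<^sup>2)" by (simp add: power_mult_distrib)
      also have "\<dots> \<le> (lam n)\<^sup>2 * (2 * m4\<^sup>2 * ((real n)\<^sup>2 * (\<Sum>j\<in>{int (q n) + 1..int n}. (w n j)\<^sup>2) + 2 * real n * real (q n) * W n))"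
        unfolding R_def W_def by (rule mult_left_mono[OF rest_bound(2) zero_le_power2])
      also have "\<dots> = 2 * m4\<^sup>2 * ((lam n)\<^sup>2 * ((real n)\<^sup>2 * (\<Sum>j\<in>{int (q n) + 1..int n}. (w n j)\<^sup>2) + 2 * real n * real (q n) * W n))"
        by (simp only: mult_ac)
      also have "\<dots> \<le> 2 * m4\<^sup>2 * (L * (\<tau> n + 2 * C * rho n))" using elim by (intro mult_left_mono) auto
      finally show ?thesis
        by (intro order_trans[OF expectation_abs_le_sqrt[OF sq_integrable_cmult[OF R]]] real_sqrt_le_mono)
    qed
    finally show ?case unfolding E_def by simp
  qed
  then show "(\<lambda>n. expectation (\<lambda>\<omega>. \<bar>X n \<omega> - Y n \<omega>\<bar>)) \<longlonglongrightarrow> 0"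
    by (intro tendsto_sandwich[OF _ _ tendsto_const E0]) auto
  have "\<forall>\<^sub>F n in sequentially. expectation (\<lambda>\<omega>. \<bar>Y n \<omega>\<bar>) \<le> sqrt (2 * m4\<^sup>2 * (L * C))"
    using ev[unfolded scale_bounds_def]
  proof eventually_elim
    case (elim n)
    have n1: "n \<ge> 1" and n: "real n > 0" using elim by auto
    have "expectation (\<lambda>\<omega>. (Y n \<omega>)\<^sup>2) = (lam n)\<^sup>2 * expectation (\<lambda>\<omega>. (\<Sum>t\<in>{1..int n}. increment (w n) (int (q n)) t (path \<omega>))\<^sup>2)"
      by (simp add: Y_def power_mult_distrib)
    also have "\<dots> \<le> (lam n)\<^sup>2 * (2 * m4\<^sup>2 * (real (card {1..int n}) * real n * W n))"
      unfolding W_def by (intro mult_left_mono increments_variance(2)) auto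
    also have "\<dots> = 2 * m4\<^sup>2 * ((real n)\<^sup>2 * ((lam n)\<^sup>2 * W n))" by (simp add: power2_eq_square mult_ac)
    also have "\<dots> \<le> 2 * m4\<^sup>2 * ((real n)\<^sup>2 * (L * C / (real n)\<^sup>2))" using elim by (intro mult_left_mono) auto
    also have "\<dots> = 2 * m4\<^sup>2 * (L * C)" using n by simp
    finally show ?case
      by (intro order_trans[OF expectation_abs_le_sqrt[OF Y_sq[OF n1]]] real_sqrt_le_mono)
  qed
  then show "\<exists>K. \<forall>\<^sub>F n in sequentially. expectation (\<lambda>\<omega>. \<bar>Y n \<omega>\<bar>) \<le> K" by blast
qed

lemma T_stat_measurable: "(\<lambda>\<omega>. T_stat k (p n) (path \<omega>) n) \<in> borel_measurable M"
proof -
  have [measurable]: "(\<lambda>\<omega>. lag_sum (path \<omega>) n j) \<in> borel_measurable M" for j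
    unfolding lag_sum_def path_def by measurable
  have [measurable]: "(\<lambda>\<omega>. Q_hat_sq k (p n) (path \<omega>) n) \<in> borel_measurable M"
    unfolding Q_hat_sq_eq[where k = k, OF k_zero k_symmetric] by measurable
  have [measurable]: "(\<lambda>\<omega>. sigma_hat_sq (path \<omega>) n) \<in> borel_measurable M"
    unfolding sigma_hat_sq_def path_def by measurable
  have [measurable]: "(\<lambda>\<omega>. (hs_norm (autocov (path \<omega>) n 0))\<^sup>2) \<in> borel_measurable M"
    unfolding hs_norm_autocov_0 path_def by measurable
  show ?thesis unfolding T_stat_def by measurable
qed

theorem T_stat_weak_conv: "weak_conv_m (\<lambda>n. distr M borel (\<lambda>\<omega>. T_stat k (p n) (path \<omega>) n)) std_normal_distribution"
proof (rule levy_continuity)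
  show "real_distribution (distr M borel (\<lambda>\<omega>. T_stat k (p n) (path \<omega>) n))" for n
    by (rule real_distribution_distr[OF T_stat_measurable])
  show "real_distribution std_normal_distribution" by (rule real_dist_normal_dist)
  fix \<theta> :: real
  define H where "H n \<omega> = (hs_norm (autocov (path \<omega>) n 0))\<^sup>2" for n \<omega>
  obtain K where K: "\<forall>\<^sub>F n in sequentially. expectation (\<lambda>\<omega>. \<bar>Y n \<omega>\<bar>) \<le> K" using X_close(3) by blast
  have Hlim: "(\<lambda>n. expectation (\<lambda>\<omega>. \<bar>H n \<omega> - kappa\<bar>)) \<longlonglongrightarrow> 0"
  proof (rule tendsto_sandwich[of "\<lambda>_. 0"])
    show "\<forall>\<^sub>F n in sequentially. expectation (\<lambda>\<omega>. \<bar>H n \<omega> - kappa\<bar>) \<le> 6 * m4 * (1 / sqrt (real n))"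
      using eventually_ge_at_top[of 1] unfolding H_def
      by eventually_elim (use hs_norm_error(2) in simp)
    have "(\<lambda>n. 6 * m4 * (1 / sqrt (real n))) \<longlonglongrightarrow> 6 * m4 * 0"
      using tendsto_real_sqrt[OF lim_1_over_n] by (intro tendsto_intros) (simp add: real_sqrt_divide)
    then show "(\<lambda>n. 6 * m4 * (1 / sqrt (real n))) \<longlonglongrightarrow> 0" by simp
  qed auto
  have "(\<lambda>n. expectation (\<lambda>\<omega>. iexp (\<theta> * (X n \<omega> * kappa / H n \<omega>)))) \<longlonglongrightarrow> of_real (exp (- \<theta>\<^sup>2 / 2))"
  proof (rule slutsky_char[OF X_close(2) _ _ X_close(1) Hlim kpos K char_Y_limit])
    show "\<forall>\<^sub>F n in sequentially. integrable M (Y n)"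
      using eventually_ge_at_top[of 1] by eventually_elim (rule sq_integrable_integrable[OF Y_sq])
    show "\<forall>\<^sub>F n in sequentially. integrable M (H n)"
      using eventually_ge_at_top[of 1] unfolding H_def by eventually_elim (rule hs_norm_error(1))
  qed
  moreover have "T_stat k (p n) (path \<omega>) n = X n \<omega> * kappa / H n \<omega>" for n \<omega>
    using kpos unfolding T_stat_def X_def H_def D_def by simp
  moreover have "char (distr M borel (\<lambda>\<omega>. T_stat k (p n) (path \<omega>) n)) \<theta> =
      expectation (\<lambda>\<omega>. iexp (\<theta> * T_stat k (p n) (path \<omega>) n))" for n
    unfolding char_def using T_stat_measurable by (subst integral_distr) auto
  ultimately show "(\<lambda>n. char (distr M borel (\<lambda>\<omega>. T_stat k (p n) (path \<omega>) n)) \<theta>) \<longlonglongrightarrow> char std_normal_distribution \<theta>"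
    by (simp add: char_std_normal_distribution)
qed

end

theorem theorem1:
  fixes M :: "'a measure"
    and u :: "int \<Rightarrow> 'a \<Rightarrow> 'h::{real_inner, complete_space, second_countable_topology}"
    and k :: "real \<Rightarrow> real"
    and \<alpha> :: real
    and p :: "nat \<Rightarrow> real"
  assumes "prob_space M"
    and indep: "prob_space.indep_vars M (\<lambda>_. borel) u UNIV"
    and ident_distr: "\<And>t. distr M borel (u t) = distr M borel (u 0)"
    and mean_zero: "\<And>t. integral\<^sup>L M (u t) = 0"
    and fourth_moment: "\<And>t. integrable M (\<lambda>x. (norm (u t x)) ^ 4)"
    and nondegenerate: "integral\<^sup>L M (\<lambda>x. (norm (u 0 x))\<^sup>2) > 0"
    and k_range: "\<And>x. k x \<in> {-1..1}"
    and k_symmetric: "\<And>x. k (- x) = k x"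
    and k_cont_zero: "isCont k 0"
    and k_cont: "finite {x. \<not> isCont k x}"
    and k_zero: "k 0 = 1"
    and \<alpha>: "\<alpha> > 1 / 2"
    and k_decay: "k \<in> O[at_top](\<lambda>x. x powr (- \<alpha>))"
    and p_pos: "\<And>n. n \<ge> 1 \<Longrightarrow> p n > 0"
    and p_infinity: "filterlim p at_top sequentially"
    and p_rate: "(\<lambda>n. p n / real n) \<longlonglongrightarrow> 0"
  shows "weak_conv_m (\<lambda>n. distr M borel (\<lambda>x. T_stat k (p n) (\<lambda>t. u t x) n)) std_normal_distribution"
proof -
  interpret prob_space M by fact
  interpret iid_process M u by unfold_locales (fact indep ident_distr mean_zero fourth_moment)+
  interpret lag_window_test M u k \<alpha> p
    by unfold_locales
      (fact k_range k_cont_zero k_zero \<alpha> k_decay k_symmetric p_pos p_infinity p_rate nondegenerate[folded sigma2_def])+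
  show ?thesis using T_stat_weak_conv by (simp only: path_def[abs_def])
qed

end
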